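(* Let $(M,L)$ be a Finsler manifold with Finsler metric $g$ and let $\nabla$ be its Cartan connection, with (h)hv-torsion $T$, v-curvature $S$ and hv-curvature $P$. Then for all $\pi$-vector fields $X,Y,Z,W$: (a) $S(X,Y,Z,W)=-S(Y,X,Z,W)$; (b) $S(X,Y,Z,W)=-S(X,Y,W,Z)$; (c) $S(X,Y)Z=T(X,T(Y,Z))-T(Y,T(X,Z))$; (d) $S(X,Y,Z,W)=g(T(X,W),T(Y,Z))-g(T(Y,W),T(X,Z))$; (e) $S(Z,W,X,Y)=S(X,Y,Z,W)$; (f) $S(X,\eta)Y=S(\eta,X)Y=\widehat S(X,Y)=0$; (g) $\mathfrak S_{X,Y,Z}\{(\nabla_{\gamma X}S)(Y,Z,W)\}=0$; (h) $\mathfrak S_{X,Y,Z}\{S(X,Y)Z\}=0$; (i) $(\nabla_{\gamma\eta}S)(X,Y,Z)=-2S(X,Y)Z$; (j) $(\nabla_{\beta Z}S)(X,Y,W)=(\nabla_{\gamma X}P)(Z,Y,W)-(\nabla_{\gamma Y}P)(Z,X,W)-S(\widehat P(Z,Y),X)W+S(\widehat P(Z,X),Y)W-P(T(Y,Z),X)W+P(T(X,Z),Y)W$.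
   Context: $M$ is a real paracompact $C^\infty$ manifold of finite dimension, $\mathcal TM\subset TM$ is the set of nonzero tangent vectors, $\pi:\mathcal TM\to M$ the projection, $\pi^{-1}(TM)\to\mathcal TM$ the pullback of $TM$ by $\pi$; everything is $C^\infty$. Sections of $\pi^{-1}(TM)$ are called $\pi$-vector fields. $\eta$ is the $\pi$-vector field $\eta(u)=(u,u)$. $\rho:T(\mathcal TM)\to\pi^{-1}(TM)$ is $\rho(A)=(u,d\pi(A))$ for $A\in T_u(\mathcal TM)$, and $\gamma:\pi^{-1}(TM)\to T(\mathcal TM)$ is the vertical lift $\gamma(u,v)=\frac{d}{dt}|_{t=0}(u+tv)$; $V=\ker\rho=\operatorname{im}\gamma$. $(M,L)$ is a Finsler manifold: $L:TM\to[0,\infty)$ is smooth and positive on $\mathcal TM$, positively homogeneous of degree 1 on fibres, and the fibrewise Hessian of $E=\frac12L^2$ is positive definite on $\mathcal TM$; this Hessian (in coordinates $g_{ij}=\frac12\partial^2L^2/\partial y^i\partial y^j$) is the Finsler metric $g$ on $\pi^{-1}(TM)$. For a linear connection $D$ on $\pi^{-1}(TM)$, put $K(A)=D_A\eta$ and $H=\ker K$. $D$ is regular if $T(\mathcal TM)=V\oplus H$; then $\beta:=(\rho|_H)^{-1}:\pi^{-1}(TM)\to H$. Torsion: $\mathbf T(A,B)=D_A\rho B-D_B\rho A-\rho[A,B]$; curvature (note the sign): $\mathbf K(A,B)\rho C=-D_AD_B\rho C+D_BD_A\rho C+D_{[A,B]}\rho C$. $Q(X,Y)=\mathbf T(\beta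 X,\beta Y)$, $T(X,Y)=\mathbf T(\gamma X,\beta Y)$; h-, hv-, v-curvatures $R(X,Y)Z=\mathbf K(\beta X,\beta Y)Z$, $P(X,Y)Z=\mathbf K(\beta X,\gamma Y)Z$, $S(X,Y)Z=\mathbf K(\gamma X,\gamma Y)Z$; $\widehat R(X,Y)=R(X,Y)\eta$, $\widehat P(X,Y)=P(X,Y)\eta$, $\widehat S(X,Y)=S(X,Y)\eta$. The Cartan connection $\nabla$ is the unique regular connection on $\pi^{-1}(TM)$ with $\nabla g=0$, $Q=0$, and $g(T(X,Y),Z)=g(T(X,Z),Y)$. Notation: $S(X,Y,Z,W):=g(S(X,Y)Z,W)$. For $B\in\{P,S\}$, $(\nabla_AB)(X,Y,Z)=\nabla_A(B(X,Y)Z)-B(\nabla_AX,Y)Z-B(X,\nabla_AY)Z-B(X,Y)\nabla_AZ$ (vector-valued). $\mathfrak S_{X,Y,Z}$ is the cyclic sum. *)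

theory Defs
  imports "HOL-Analysis.Analysis" "HOL-Library.Function_Algebras"
begin

section \<open>Smooth manifolds\<close>

text \<open>Only used for open \<open>S\<close>, where it says that \<open>f\<close> is of class \<open>C\<^sup>k\<close> on \<open>S\<close>.\<close>

primrec Ck_on :: "nat \<Rightarrow> 'e::euclidean_space set \<Rightarrow> ('e \<Rightarrow> 'f::euclidean_space) \<Rightarrow> bool" where
  "Ck_on 0 S f \<longleftrightarrow> continuous_on S f"
| "Ck_on (Suc k) S f \<longleftrightarrow> (\<forall>x\<in>S. f differentiable (at x)) \<and>
     (\<forall>v. Ck_on k S (\<lambda>x. frechet_derivative f (at x) v))"

definition smooth_on :: "'e::euclidean_space set \<Rightarrow> ('e \<Rightarrow> 'f::euclidean_space) \<Rightarrow> bool" where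
  "smooth_on S f \<longleftrightarrow> (\<forall>k. Ck_on k S f)"

text \<open>A chart is a pair of a domain and a coordinate map; the map is irrelevant off the domain.
  Atlases are not required to be maximal, and the points of the manifold are those covered by
  the charts.\<close>

type_synonym ('a, 'e) atlas = "('a set \<times> ('a \<Rightarrow> 'e)) set"

definition carrier :: "('a, 'e) atlas \<Rightarrow> 'a set" where
  "carrier M = \<Union> (fst ` M)"

definition mtop :: "('a, 'e::euclidean_space) atlas \<Rightarrow> 'a topology" where
  "mtop M = topology (\<lambda>W. W \<subseteq> carrier M \<and> (\<forall>(U, \<phi>)\<in>M. open (\<phi> ` (U \<inter> W))))"

lemma openin_mtop:
  assumes "\<And>U \<phi>. (U, \<phi>) \<in> M \<Longrightarrow> inj_on \<phi> U"
  shows "openin (mtop M) W \<longleftrightarrow> W \<subseteq> carrier M \<and> (\<forall>(U, \<phi>)\<in>M. open (\<phi> ` (U \<inter> W)))"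
proof -
  have int: "open (\<phi> ` (U \<inter> (S \<inter> T)))"
    if "(U, \<phi>) \<in> M" "open (\<phi> ` (U \<inter> S))" "open (\<phi> ` (U \<inter> T))" for U \<phi> S T
  proof -
    have "\<phi> ` (U \<inter> (S \<inter> T)) = \<phi> ` (U \<inter> S) \<inter> \<phi> ` (U \<inter> T)"
      using assms[OF that(1)] by (auto simp: inj_on_def)
    then show ?thesis using that by auto
  qed
  have un: "open (\<phi> ` (U \<inter> \<Union> K))" if "\<And>S. S \<in> K \<Longrightarrow> open (\<phi> ` (U \<inter> S))"
    for U K and \<phi> :: "'a \<Rightarrow> 'b"
  proof -
    have "\<phi> ` (U \<inter> \<Union> K) = (\<Union>S\<in>K. \<phi> ` (U \<inter> S))" by auto
    then show ?thesis using that by auto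
  qed
  have "istopology (\<lambda>W. W \<subseteq> carrier M \<and> (\<forall>(U, \<phi>)\<in>M. open (\<phi> ` (U \<inter> W))))"
    unfolding istopology_def by (fastforce intro: int un)
  then show ?thesis unfolding mtop_def by (simp add: topology_inverse')
qed

definition paracompact_space :: "'a topology \<Rightarrow> bool" where
  "paracompact_space X \<longleftrightarrow>
     (\<forall>\<U>. (\<forall>U\<in>\<U>. openin X U) \<and> topspace X \<subseteq> \<Union>\<U> \<longrightarrow>
        (\<exists>\<V>. (\<forall>V\<in>\<V>. openin X V) \<and> topspace X \<subseteq> \<Union>\<V> \<and>
             (\<forall>V\<in>\<V>. \<exists>U\<in>\<U>. V \<subseteq> U) \<and> locally_finite_in X \<V>))"

definition smooth_manifold :: "('a, 'e::euclidean_space) atlas \<Rightarrow> bool" where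
  "smooth_manifold M \<longleftrightarrow>
     (\<forall>(U, \<phi>)\<in>M. inj_on \<phi> U \<and> open (\<phi> ` U)) \<and>
     (\<forall>(U, \<phi>)\<in>M. \<forall>(V, \<psi>)\<in>M.
        open (\<phi> ` (U \<inter> V)) \<and> smooth_on (\<phi> ` (U \<inter> V)) (\<psi> \<circ> inv_into U \<phi>)) \<and>
     Hausdorff_space (mtop M) \<and> paracompact_space (mtop M)"

text \<open>The open submanifold on \<open>W\<close>.\<close>

definition restrict_atlas :: "('a, 'e) atlas \<Rightarrow> 'a set \<Rightarrow> ('a, 'e) atlas" where
  "restrict_atlas M W = (\<lambda>(U, \<phi>). (U \<inter> W, \<phi>)) ` M"

definition smooth_map ::
  "('a, 'e::euclidean_space) atlas \<Rightarrow> ('b, 'f::euclidean_space) atlas \<Rightarrow> ('a \<Rightarrow> 'b) \<Rightarrow> bool" where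
  "smooth_map M N F \<longleftrightarrow> F ` carrier M \<subseteq> carrier N \<and>
     (\<forall>(U, \<phi>)\<in>M. \<forall>(V, \<psi>)\<in>N. open (\<phi> ` (U \<inter> F -` V)) \<and>
        smooth_on (\<phi> ` (U \<inter> F -` V)) (\<psi> \<circ> F \<circ> inv_into U \<phi>))"

definition smooth_fun :: "('a, 'e::euclidean_space) atlas \<Rightarrow> ('a \<Rightarrow> real) \<Rightarrow> bool" where
  "smooth_fun M f \<longleftrightarrow> (\<forall>(U, \<phi>)\<in>M. smooth_on (\<phi> ` U) (f \<circ> inv_into U \<phi>))"

text \<open>Functions that are smooth on some neighbourhood of \<open>p\<close>.\<close>

definition smooth_near :: "('a, 'e::euclidean_space) atlas \<Rightarrow> 'a \<Rightarrow> ('a \<Rightarrow> real) set" where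
  "smooth_near M p =
     {f. \<exists>W. openin (mtop M) W \<and> p \<in> W \<and> smooth_fun (restrict_atlas M W) f}"


section \<open>Tangent vectors and vector fields\<close>

text \<open>A tangent vector at \<open>p\<close> is a directional derivative operator
  \<open>f \<mapsto> \<Sum>\<^sub>i w\<^sup>i \<partial>f/\<partial>x\<^sup>i(p)\<close>. It acts on the functions that are smooth near \<open>p\<close> and is set
  to \<open>0\<close> on all others, so that equal tangent vectors are equal as HOL functions. Sums, differences
  and \<open>0\<close> are the pointwise ones of \<^theory>\<open>HOL-Library.Function_Algebras\<close>.\<close>

type_synonym 'a tvec = "('a \<Rightarrow> real) \<Rightarrow> real"

definition vscale :: "real \<Rightarrow> 'a tvec \<Rightarrow> 'a tvec" where
  "vscale c v = (\<lambda>f. c * v f)"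

definition tangent_space :: "('a, 'e::euclidean_space) atlas \<Rightarrow> 'a \<Rightarrow> 'a tvec set" where
  "tangent_space M p = {v. \<exists>(U, \<phi>)\<in>M. p \<in> U \<and> (\<exists>w. v =
     (\<lambda>f. if f \<in> smooth_near M p
           then frechet_derivative (f \<circ> inv_into U \<phi>) (at (\<phi> p)) w else 0))}"

definition differential ::
  "('b, 'f::euclidean_space) atlas \<Rightarrow> ('a \<Rightarrow> 'b) \<Rightarrow> 'a \<Rightarrow> 'a tvec \<Rightarrow> 'b tvec" where
  "differential N F p a = (\<lambda>f. if f \<in> smooth_near N (F p) then a (f \<circ> F) else 0)"

text \<open>The points of \<open>TM\<close> are the pairs \<open>(p, v)\<close> with \<open>v \<in> T\<^sub>pM\<close>; the second component of an
  induced chart is the vector of the components \<open>v(x\<^sup>i)\<close> of \<open>v\<close>.\<close>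

type_synonym 'a tpoint = "'a \<times> 'a tvec"

definition tangent_bundle ::
  "('a, 'e::euclidean_space) atlas \<Rightarrow> ('a tpoint, 'e \<times> 'e) atlas" where
  "tangent_bundle M = (\<lambda>(U, \<phi>). (Sigma U (tangent_space M),
      \<lambda>(p, v). (\<phi> p, \<Sum>b\<in>Basis. v (\<lambda>q. \<phi> q \<bullet> b) *\<^sub>R b))) ` M"

definition vector_field ::
  "('a, 'e::euclidean_space) atlas \<Rightarrow> ('a \<Rightarrow> 'a tvec) \<Rightarrow> bool" where
  "vector_field M A \<longleftrightarrow> smooth_map M (tangent_bundle M) (\<lambda>p. (p, A p))"

definition lie_bracket ::
  "('a, 'e::euclidean_space) atlas \<Rightarrow> ('a \<Rightarrow> 'a tvec) \<Rightarrow> ('a \<Rightarrow> 'a tvec) \<Rightarrow> 'a \<Rightarrow> 'a tvec" where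
  "lie_bracket M A B p = (\<lambda>f. if f \<in> smooth_near M p
     then A p (\<lambda>q. B q f) - B p (\<lambda>q. A q f) else 0)"


section \<open>The slit tangent bundle and \<open>\<pi>\<close>-vector fields\<close>

definition slit :: "('a, 'e::euclidean_space) atlas \<Rightarrow> ('a tpoint, 'e \<times> 'e) atlas" where
  "slit M = restrict_atlas (tangent_bundle M) {(p, v). v \<noteq> 0}"

text \<open>The fibre of \<open>\<pi>\<^sup>-\<^sup>1(TM)\<close> over \<open>u\<close> is \<open>T\<^bsub>\<pi>(u)\<^esub>M\<close>; a \<open>\<pi>\<close>-vector field is given by the
  second component of a section. The values of all fields off the slit bundle are irrelevant.\<close>

type_synonym 'a pi_field = "'a tpoint \<Rightarrow> 'a tvec"
type_synonym 'a slit_field = "'a tpoint \<Rightarrow> 'a tpoint tvec"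

definition pi_vector_field :: "('a, 'e::euclidean_space) atlas \<Rightarrow> 'a pi_field \<Rightarrow> bool" where
  "pi_vector_field M Y \<longleftrightarrow> smooth_map (slit M) (tangent_bundle M) (\<lambda>u. (fst u, Y u))"

definition eta :: "'a pi_field" where
  "eta u = snd u"

definition rho :: "('a, 'e::euclidean_space) atlas \<Rightarrow> 'a slit_field \<Rightarrow> 'a pi_field" where
  "rho M A u = differential M fst u (A u)"

definition gamma :: "('a, 'e::euclidean_space) atlas \<Rightarrow> 'a pi_field \<Rightarrow> 'a slit_field" where
  "gamma M X u = (\<lambda>f. if f \<in> smooth_near (slit M) u
     then deriv (\<lambda>t. f (fst u, snd u + vscale t (X u))) 0 else 0)"


section \<open>Finsler manifolds\<close>

text \<open>The fibrewise Hessian of \<open>E = L\<^sup>2/2\<close> at \<open>u = (p, y)\<close>: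
  \<open>\<partial>\<^sup>2/\<partial>s\<partial>t E(p, y + sv + tw)\<close> at \<open>s = t = 0\<close>.\<close>

definition fibre_hessian :: "('a tpoint \<Rightarrow> real) \<Rightarrow> 'a tpoint \<Rightarrow> 'a tvec \<Rightarrow> 'a tvec \<Rightarrow> real" where
  "fibre_hessian L u v w =
     deriv (\<lambda>s. deriv (\<lambda>t. (1/2) * (L (fst u, snd u + vscale s v + vscale t w))\<^sup>2) 0) 0"

definition finsler_manifold ::
  "('a, 'e::euclidean_space) atlas \<Rightarrow> ('a tpoint \<Rightarrow> real) \<Rightarrow> bool" where
  "finsler_manifold M L \<longleftrightarrow> smooth_manifold M \<and>
     (\<forall>u\<in>carrier (tangent_bundle M). L u \<ge> 0) \<and>
     smooth_fun (slit M) L \<and>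
     (\<forall>u\<in>carrier (slit M). L u > 0) \<and>
     (\<forall>(p, v)\<in>carrier (tangent_bundle M). \<forall>c>0. L (p, vscale c v) = c * L (p, v)) \<and>
     (\<forall>u\<in>carrier (slit M). \<forall>v\<in>tangent_space M (fst u). v \<noteq> 0 \<longrightarrow> fibre_hessian L u v v > 0)"

definition finsler_metric ::
  "('a tpoint \<Rightarrow> real) \<Rightarrow> 'a pi_field \<Rightarrow> 'a pi_field \<Rightarrow> 'a tpoint \<Rightarrow> real" where
  "finsler_metric L X Y u = fibre_hessian L u (X u) (Y u)"


section \<open>Linear connections on the pullback bundle\<close>

text \<open>\<open>D u a Y\<close> is the covariant derivative \<open>D\<^sub>aY\<close> of the \<open>\<pi>\<close>-vector field \<open>Y\<close> along the tangent
  vector \<open>a\<close> of the slit bundle at \<open>u\<close>.\<close>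

type_synonym 'a conn = "'a tpoint \<Rightarrow> 'a tpoint tvec \<Rightarrow> 'a pi_field \<Rightarrow> 'a tvec"

definition cov :: "'a conn \<Rightarrow> 'a slit_field \<Rightarrow> 'a pi_field \<Rightarrow> 'a pi_field" where
  "cov D A Y u = D u (A u) Y"

definition linear_connection :: "('a, 'e::euclidean_space) atlas \<Rightarrow> 'a conn \<Rightarrow> bool" where
  "linear_connection M D \<longleftrightarrow>
     (\<forall>A Y. vector_field (slit M) A \<and> pi_vector_field M Y \<longrightarrow> pi_vector_field M (cov D A Y)) \<and>
     (\<forall>u\<in>carrier (slit M). \<forall>a\<in>tangent_space (slit M) u. \<forall>Y. pi_vector_field M Y \<longrightarrow>
        D u a Y \<in> tangent_space M (fst u) \<and>
        (\<forall>b\<in>tangent_space (slit M) u. D u (a + b) Y = D u a Y + D u b Y) \<and>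
        (\<forall>c. D u (vscale c a) Y = vscale c (D u a Y)) \<and>
        (\<forall>Z. pi_vector_field M Z \<longrightarrow> D u a (Y + Z) = D u a Y + D u a Z) \<and>
        (\<forall>f. smooth_fun (slit M) f \<longrightarrow>
           D u a (\<lambda>x. vscale (f x) (Y x)) = vscale (a f) (Y u) + vscale (f u) (D u a Y)))"

definition vertical :: "('a, 'e::euclidean_space) atlas \<Rightarrow> 'a tpoint \<Rightarrow> 'a tpoint tvec set" where
  "vertical M u = {a \<in> tangent_space (slit M) u. differential M fst u a = 0}"

definition horizontal ::
  "('a, 'e::euclidean_space) atlas \<Rightarrow> 'a conn \<Rightarrow> 'a tpoint \<Rightarrow> 'a tpoint tvec set" where
  "horizontal M D u = {a \<in> tangent_space (slit M) u. D u a eta = 0}"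

definition regular_connection :: "('a, 'e::euclidean_space) atlas \<Rightarrow> 'a conn \<Rightarrow> bool" where
  "regular_connection M D \<longleftrightarrow> linear_connection M D \<and>
     (\<forall>u\<in>carrier (slit M). vertical M u \<inter> horizontal M D u = {0} \<and>
        tangent_space (slit M) u = {v + h | v h. v \<in> vertical M u \<and> h \<in> horizontal M D u})"

definition beta ::
  "('a, 'e::euclidean_space) atlas \<Rightarrow> 'a conn \<Rightarrow> 'a pi_field \<Rightarrow> 'a slit_field" where
  "beta M D X u = inv_into (horizontal M D u) (differential M fst u) (X u)"

definition torsion ::
  "('a, 'e::euclidean_space) atlas \<Rightarrow> 'a conn \<Rightarrow> 'a slit_field \<Rightarrow> 'a slit_field \<Rightarrow> 'a pi_field" where
  "torsion M D A B =
     cov D A (rho M B) - cov D B (rho M A) - rho M (lie_bracket (slit M) A B)"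

text \<open>The curvature has the opposite of the most common sign.\<close>

definition curvature :: "('a, 'e::euclidean_space) atlas \<Rightarrow> 'a conn \<Rightarrow>
    'a slit_field \<Rightarrow> 'a slit_field \<Rightarrow> 'a pi_field \<Rightarrow> 'a pi_field" where
  "curvature M D A B Z =
     - cov D A (cov D B Z) + cov D B (cov D A Z) + cov D (lie_bracket (slit M) A B) Z"

definition Q_torsion :: "('a, 'e::euclidean_space) atlas \<Rightarrow> 'a conn \<Rightarrow>
    'a pi_field \<Rightarrow> 'a pi_field \<Rightarrow> 'a pi_field" where
  "Q_torsion M D X Y = torsion M D (beta M D X) (beta M D Y)"

definition T_torsion :: "('a, 'e::euclidean_space) atlas \<Rightarrow> 'a conn \<Rightarrow>
    'a pi_field \<Rightarrow> 'a pi_field \<Rightarrow> 'a pi_field" where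
  "T_torsion M D X Y = torsion M D (gamma M X) (beta M D Y)"

definition P_curv :: "('a, 'e::euclidean_space) atlas \<Rightarrow> 'a conn \<Rightarrow>
    'a pi_field \<Rightarrow> 'a pi_field \<Rightarrow> 'a pi_field \<Rightarrow> 'a pi_field" where
  "P_curv M D X Y Z = curvature M D (beta M D X) (gamma M Y) Z"

definition S_curv :: "('a, 'e::euclidean_space) atlas \<Rightarrow> 'a conn \<Rightarrow>
    'a pi_field \<Rightarrow> 'a pi_field \<Rightarrow> 'a pi_field \<Rightarrow> 'a pi_field" where
  "S_curv M D X Y Z = curvature M D (gamma M X) (gamma M Y) Z"

definition P_hat :: "('a, 'e::euclidean_space) atlas \<Rightarrow> 'a conn \<Rightarrow>
    'a pi_field \<Rightarrow> 'a pi_field \<Rightarrow> 'a pi_field" where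
  "P_hat M D X Y = P_curv M D X Y eta"

definition S_hat :: "('a, 'e::euclidean_space) atlas \<Rightarrow> 'a conn \<Rightarrow>
    'a pi_field \<Rightarrow> 'a pi_field \<Rightarrow> 'a pi_field" where
  "S_hat M D X Y = S_curv M D X Y eta"

definition S4 :: "('a, 'e::euclidean_space) atlas \<Rightarrow> ('a tpoint \<Rightarrow> real) \<Rightarrow> 'a conn \<Rightarrow>
    'a pi_field \<Rightarrow> 'a pi_field \<Rightarrow> 'a pi_field \<Rightarrow> 'a pi_field \<Rightarrow> 'a tpoint \<Rightarrow> real" where
  "S4 M L D X Y Z W = finsler_metric L (S_curv M D X Y Z) W"

definition cov_curv :: "'a conn \<Rightarrow> 'a slit_field \<Rightarrow>
    ('a pi_field \<Rightarrow> 'a pi_field \<Rightarrow> 'a pi_field \<Rightarrow> 'a pi_field) \<Rightarrow>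
    'a pi_field \<Rightarrow> 'a pi_field \<Rightarrow> 'a pi_field \<Rightarrow> 'a pi_field" where
  "cov_curv D A B X Y Z =
     cov D A (B X Y Z) - B (cov D A X) Y Z - B X (cov D A Y) Z - B X Y (cov D A Z)"

definition cyclic_sum :: "('b \<Rightarrow> 'b \<Rightarrow> 'b \<Rightarrow> 'c::plus) \<Rightarrow> 'b \<Rightarrow> 'b \<Rightarrow> 'b \<Rightarrow> 'c" where
  "cyclic_sum F X Y Z = F X Y Z + F Y Z X + F Z X Y"

definition cartan_connection ::
  "('a, 'e::euclidean_space) atlas \<Rightarrow> ('a tpoint \<Rightarrow> real) \<Rightarrow> 'a conn \<Rightarrow> bool" where
  "cartan_connection M L D \<longleftrightarrow> regular_connection M D \<and>
     (\<forall>A X Y. vector_field (slit M) A \<and> pi_vector_field M X \<and> pi_vector_field M Y \<longrightarrow>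
        (\<forall>u\<in>carrier (slit M). A u (finsler_metric L X Y) =
           finsler_metric L (cov D A X) Y u + finsler_metric L X (cov D A Y) u)) \<and>
     (\<forall>X Y. pi_vector_field M X \<and> pi_vector_field M Y \<longrightarrow>
        (\<forall>u\<in>carrier (slit M). Q_torsion M D X Y u = 0)) \<and>
     (\<forall>X Y Z. pi_vector_field M X \<and> pi_vector_field M Y \<and> pi_vector_field M Z \<longrightarrow>
        (\<forall>u\<in>carrier (slit M). finsler_metric L (T_torsion M D X Y) Z u =
           finsler_metric L (T_torsion M D X Z) Y u))"

end

(* Write T_X for the endomorphism T(X, -) and D0_X Y = rho [gamma X, beta Y]. From the definition of the
   torsion, D0_X = nabla_{gamma X} - T_X, and D0 is flat by the Jacobi identity. Expanding the
   flatness, S(X, Y) - [T_X, T_Y] equals an expression in the covariant derivative of T. The former is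
   skew-adjoint for g because nabla g = 0, the latter is selfadjoint because every T_X is; so both
   vanish. This gives S(X, Y) = [T_X, T_Y] and the Codazzi equation for T, from which the algebraic
   identities and the homogeneity (i) follow; (g) and (j) are the second Bianchi identity on vertical
   and mixed triples. The Finsler structure enters in two places only: 2 g(T(X, Y), Z) is the third
   fibre derivative of L^2/2, hence totally symmetric, and it vanishes for Z = eta since the Hessian is
   homogeneous of degree 0, so that nabla_{gamma X} eta = X.
   Analytically, the point to check is that beta X is smooth: in a chart its components solve a linear
   system with smooth coefficients, which are read off global fields made with bump functions. *)

theory Submission
  imports Defs
begin

subsection \<open>Calculus of smooth maps\<close>

text \<open>Fields are total functions whose values off the slit bundle mean nothing, whereas a
  connection takes an entire field as argument. That \<open>D\<close> ignores the irrelevant values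
  is derived from its Leibniz rule; the fields are then cut off to 0 there, and each identity
  becomes an equation in an abelian group. The algebra is set up for abelian groups with additive
  operations, and its main device is the splitting \<open>A = gam (nab A eta) + bet (rho A)\<close>:
  a bracket is known once \<open>rho\<close> of it and the derivative of \<open>eta\<close> along it
  are known. D0 can be iterated because rho [gamma X, A] depends on A through rho A alone: brackets
  of vertical fields are vertical. In coordinates D0 differentiates components in fibre directions,
  and this description is also what compares T with the fibre derivative of g. A tangent vector is
  by definition a coordinate direction acting on germs, so membership in a tangent space means
  exhibiting components; for brackets these come from the symmetry of second derivatives.\<close>

abbreviation (input) \<D> where "\<D> f x \<equiv> frechet_derivative f (at x)"

section \<open>Functions of class \<open>C\<^sup>k\<close> on open sets\<close>

lemma Ck_on_cong:
  assumes "open S" "\<And>x. x \<in> S \<Longrightarrow> f x = g x"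
  shows "Ck_on k S f \<longleftrightarrow> Ck_on k S g"
  using assms(2)
proof (induction k arbitrary: f g)
  case 0
  then show ?case by (auto cong: continuous_on_cong)
next
  case (Suc k)
  have D: "(f has_derivative f') (at x) \<longleftrightarrow> (g has_derivative f') (at x)" if "x \<in> S" for x f'
    using has_derivative_transform_within_open[OF _ \<open>open S\<close> that] Suc.prems by metis
  have "\<D> f x = \<D> g x" if "x \<in> S" for x
    using D[OF that] by (simp add: frechet_derivative_def)
  then have "Ck_on k S (\<lambda>x. \<D> f x v) \<longleftrightarrow>
      Ck_on k S (\<lambda>x. \<D> g x v)" for v
    by (intro Suc.IH) auto
  then show ?case using D by (simp add: differentiable_def)
qed

text \<open>Allows the derivative to be given by a formula. The closure properties below are
  inductions in which the derivative is an expression in functions of one order less.\<close>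

lemma Ck_on_SucI:
  assumes "open S" "\<And>x. x \<in> S \<Longrightarrow> (f has_derivative f' x) (at x)"
    and "\<And>v. Ck_on k S (\<lambda>x. f' x v)"
  shows "Ck_on (Suc k) S f"
proof -
  have "Ck_on k S (\<lambda>x. \<D> f x v)" for v
    using assms(3)[of v] fun_cong[OF frechet_derivative_at[OF assms(2)], of _ v]
    by (subst Ck_on_cong[OF \<open>open S\<close>, where g="\<lambda>x. f' x v"]) auto
  then show ?thesis using assms(2) by (auto simp: differentiable_def)
qed

lemma Ck_on_Suc_deriv:
  assumes "Ck_on (Suc k) S f" "x \<in> S"
  shows "(f has_derivative \<D> f x) (at x)"
  using assms frechet_derivative_works by auto

lemma Ck_on_SucD: "Ck_on (Suc k) S f \<Longrightarrow> Ck_on k S f"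
proof (induction k arbitrary: f)
  case 0
  then show ?case
    by (auto intro!: continuous_at_imp_continuous_on differentiable_imp_continuous_within)
next
  case (Suc k)
  then show ?case by (metis Ck_on.simps(2))
qed

lemma Ck_on_subset: "Ck_on k S f \<Longrightarrow> T \<subseteq> S \<Longrightarrow> Ck_on k T f"
  by (induction k arbitrary: f) (auto intro: continuous_on_subset)

lemma Ck_on_local:
  assumes "\<And>x. x \<in> S \<Longrightarrow> \<exists>T. open T \<and> x \<in> T \<and> Ck_on k T f"
  shows "Ck_on k S f"
  using assms
proof (induction k arbitrary: f)
  case 0
  then show ?case
    by (auto intro!: continuous_at_imp_continuous_on simp: continuous_on_eq_continuous_at)
       (metis continuous_on_eq_continuous_at)
next
  case (Suc k)
  show ?case
  proof (simp, intro conjI ballI allI)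
    fix x assume "x \<in> S" then show "f differentiable at x" using Suc.prems by fastforce
  next
    fix v show "Ck_on k S (\<lambda>x. \<D> f x v)"
      using Suc.prems by (intro Suc.IH) (fastforce)
  qed
qed

lemma Ck_on_const [simp]: "Ck_on k S (\<lambda>x. c)"
  by (induction k arbitrary: c) auto

lemma Ck_on_add:
  assumes "open S" "Ck_on k S f" "Ck_on k S g"
  shows "Ck_on k S (\<lambda>x. f x + g x)"
  using assms(2,3)
proof (induction k arbitrary: f g)
  case 0
  then show ?case by (auto intro: continuous_intros)
next
  case (Suc k)
  show ?case
    by (rule Ck_on_SucI[OF \<open>open S\<close> has_derivative_add[OF Ck_on_Suc_deriv Ck_on_Suc_deriv]])
       (use Suc in auto)
qed

lemma Ck_on_linear:
  assumes "open S" "bounded_linear h" "Ck_on k S f"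
  shows "Ck_on k S (\<lambda>x. h (f x))"
  using assms(3)
proof (induction k arbitrary: f)
  case 0
  then show ?case using assms(2) by (auto intro: bounded_linear.continuous_on)
next
  case (Suc k)
  show ?case
    by (rule Ck_on_SucI[OF \<open>open S\<close> bounded_linear.has_derivative[OF assms(2) Ck_on_Suc_deriv]])
       (use Suc in auto)
qed

lemma Ck_on_bilinear:
  assumes "open S" "bounded_bilinear h" "Ck_on k S f" "Ck_on k S g"
  shows "Ck_on k S (\<lambda>x. h (f x) (g x))"
  using assms(3,4)
proof (induction k arbitrary: f g)
  case 0
  then show ?case using assms(2) by (auto intro: bounded_bilinear.continuous_on)
next
  case (Suc k)
  \<comment> \<open>The product rule mixes the factors with their derivatives, so the factors
    themselves are needed at the lower order too.\<close>
  then have "Ck_on k S f" "Ck_on k S g" using Ck_on_SucD by blast+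
  with Suc show ?case
    by (intro Ck_on_SucI[OF \<open>open S\<close> bounded_bilinear.FDERIV[OF assms(2) Ck_on_Suc_deriv Ck_on_Suc_deriv]])
       (auto intro!: Ck_on_add[OF \<open>open S\<close>])
qed

lemma Ck_on_sum:
  assumes "open S" "\<And>i. i \<in> I \<Longrightarrow> Ck_on k S (f i)"
  shows "Ck_on k S (\<lambda>x. \<Sum>i\<in>I. f i x)"
proof (cases "finite I")
  case True
  then show ?thesis using assms(2)
    by (induction I) (auto intro!: Ck_on_add[OF \<open>open S\<close>])
qed auto

lemma Ck_on_componentwise:
  assumes "open S"
  shows "Ck_on k S f \<longleftrightarrow> (\<forall>b\<in>Basis. Ck_on k S (\<lambda>x. f x \<bullet> b))" (is "?L \<longleftrightarrow> ?R")
proof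
  assume ?L then show ?R
    by (blast intro: Ck_on_linear[OF assms bounded_linear_inner_left])
next
  assume ?R
  then have "Ck_on k S (\<lambda>x. \<Sum>b\<in>Basis. (f x \<bullet> b) *\<^sub>R b)"
    by (intro Ck_on_sum[OF assms] Ck_on_linear[OF assms bounded_linear_scaleR_left]) blast
  then show ?L by (simp add: euclidean_representation)
qed

lemma Ck_on_id: "open S \<Longrightarrow> Ck_on k S (\<lambda>x. x)"
  by (cases k) (auto intro: differentiable_ident)

text \<open>\<open>Ck_on\<close> controls derivatives in constant directions only. Expanding in the
  basis is what handles a direction that varies with the point.\<close>

lemma frechet_derivative_expand:
  assumes "f differentiable (at x)"
  shows "\<D> f x v = (\<Sum>b\<in>Basis. (v \<bullet> b) *\<^sub>R \<D> f x b)"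
proof -
  interpret linear "\<D> f x"
    using assms by (rule linear_frechet_derivative)
  have "\<D> f x v = \<D> f x (\<Sum>b\<in>Basis. (v \<bullet> b) *\<^sub>R b)"
    by (simp add: euclidean_representation)
  also have "\<dots> = (\<Sum>b\<in>Basis. (v \<bullet> b) *\<^sub>R \<D> f x b)"
    by (simp add: sum scale)
  finally show ?thesis .
qed

lemma Ck_on_compose:
  assumes "open S" "Ck_on k T f" "Ck_on k S g" "g ` S \<subseteq> T"
  shows "Ck_on k S (\<lambda>x. f (g x))"
  using assms(2,3)
proof (induction k arbitrary: f)
  case 0
  then show ?case using assms(4) by (auto intro: continuous_on_compose2)
next
  case (Suc k)
  \<comment> \<open>In the chain rule the direction of the outer derivative moves with
    \<open>x\<close>; expanded, every factor falls under the induction hypothesis or the assumptions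
    on \<open>g\<close>.\<close>
  let ?f' = "\<lambda>x v. \<Sum>b\<in>Basis. (\<D> g x v \<bullet> b) *\<^sub>R \<D> f (g x) b"
  have g: "Ck_on k S g" using Suc.prems Ck_on_SucD by blast
  show ?case
  proof (rule Ck_on_SucI[OF \<open>open S\<close>, where f'="?f'"])
    fix x assume x: "x \<in> S"
    then have gx: "g x \<in> T" using assms(4) by auto
    have "((\<lambda>x. f (g x)) has_derivative (\<lambda>v. \<D> f (g x) (\<D> g x v))) (at x)"
      by (rule has_derivative_compose[OF Ck_on_Suc_deriv[OF Suc.prems(2) x] Ck_on_Suc_deriv[OF Suc.prems(1) gx]])
    moreover have "(\<lambda>v. \<D> f (g x) (\<D> g x v)) = ?f' x"
      by (intro ext frechet_derivative_expand) (use Suc.prems(1) gx in auto)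
    ultimately show "((\<lambda>x. f (g x)) has_derivative ?f' x) (at x)" by simp
  next
    fix v
    show "Ck_on k S (\<lambda>x. ?f' x v)"
      using Suc.prems Suc.IH g
      by (intro Ck_on_sum[OF \<open>open S\<close>] Ck_on_bilinear[OF \<open>open S\<close> bounded_bilinear_scaleR]
          Ck_on_linear[OF \<open>open S\<close> bounded_linear_inner_left] Suc.IH) auto
  qed
qed

lemma Ck_on_inverse:
  fixes f :: "'e::euclidean_space \<Rightarrow> real"
  assumes "open S" "Ck_on k S f" "\<And>x. x \<in> S \<Longrightarrow> f x \<noteq> 0"
  shows "Ck_on k S (\<lambda>x. inverse (f x))"
  using assms(2)
proof (induction k)
  case 0
  then show ?case using assms(3) by (auto intro!: continuous_intros)
next
  case (Suc k)
  have i: "Ck_on k S (\<lambda>x. inverse (f x))" using Suc Ck_on_SucD by blast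
  let ?f' = "\<lambda>x v. - (inverse (f x) * \<D> f x v * inverse (f x))"
  show ?case
  proof (rule Ck_on_SucI[OF \<open>open S\<close>, where f'="?f'"])
    fix x assume "x \<in> S"
    then show "((\<lambda>x. inverse (f x)) has_derivative ?f' x) (at x)"
      using Deriv.has_derivative_inverse[OF _ Ck_on_Suc_deriv[OF Suc.prems]] assms(3) by blast
  next
    fix v show "Ck_on k S (\<lambda>x. ?f' x v)"
      using i Suc.prems by (intro Ck_on_bilinear[OF \<open>open S\<close> bounded_bilinear_mult]
        Ck_on_linear[OF \<open>open S\<close> bounded_linear_minus[OF bounded_linear_ident]]) auto
  qed
qed

section \<open>Closure properties of smooth functions\<close>

lemma smooth_on_cong:
  "open S \<Longrightarrow> (\<And>x. x \<in> S \<Longrightarrow> f x = g x) \<Longrightarrow> smooth_on S f \<longleftrightarrow> smooth_on S g"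
  unfolding smooth_on_def using Ck_on_cong by blast

lemma smooth_on_subset: "smooth_on S f \<Longrightarrow> T \<subseteq> S \<Longrightarrow> smooth_on T f"
  unfolding smooth_on_def using Ck_on_subset by blast

lemma smooth_on_local:
  "(\<And>x. x \<in> S \<Longrightarrow> \<exists>T. open T \<and> x \<in> T \<and> smooth_on T f) \<Longrightarrow> smooth_on S f"
  unfolding smooth_on_def by (metis Ck_on_local)

lemma smooth_on_const [simp]: "smooth_on S (\<lambda>x. c)"
  by (simp add: smooth_on_def)

lemma smooth_on_id: "open S \<Longrightarrow> smooth_on S (\<lambda>x. x)"
  by (simp add: smooth_on_def Ck_on_id)

lemma smooth_on_linear:
  "\<lbrakk>open S; bounded_linear h; smooth_on S f\<rbrakk> \<Longrightarrow>
      smooth_on S (\<lambda>x. h (f x))"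
  by (simp add: smooth_on_def Ck_on_linear)

lemma smooth_on_add:
  "\<lbrakk>open S; smooth_on S f; smooth_on S g\<rbrakk> \<Longrightarrow>
      smooth_on S (\<lambda>x. f x + g x)"
  by (simp add: smooth_on_def Ck_on_add)

lemma smooth_on_diff:
  assumes "open S" "smooth_on S f" "smooth_on S g"
  shows "smooth_on S (\<lambda>x. f x - g x)"
  using smooth_on_add[OF assms(1,2) smooth_on_linear[OF assms(1) bounded_linear_minus[OF bounded_linear_ident] assms(3)]]
  by simp

lemma smooth_on_bilinear:
  "\<lbrakk>open S; bounded_bilinear h; smooth_on S f; smooth_on S g\<rbrakk> \<Longrightarrow>
      smooth_on S (\<lambda>x. h (f x) (g x))"
  by (simp add: smooth_on_def Ck_on_bilinear)

lemmas smooth_on_scaleR = smooth_on_bilinear[OF _ bounded_bilinear_scaleR]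
lemmas smooth_on_mult = smooth_on_bilinear[OF _ bounded_bilinear_mult]
lemmas smooth_on_inner = smooth_on_linear[OF _ bounded_linear_inner_left]

lemma smooth_on_sum:
  "open S \<Longrightarrow> (\<And>i. i \<in> I \<Longrightarrow> smooth_on S (f i)) \<Longrightarrow> smooth_on S (\<lambda>x. \<Sum>i\<in>I. f i x)"
  by (simp add: smooth_on_def Ck_on_sum)

lemma smooth_on_componentwise:
  "open S \<Longrightarrow> smooth_on S f \<longleftrightarrow> (\<forall>b\<in>Basis. smooth_on S (\<lambda>x. f x \<bullet> b))"
  unfolding smooth_on_def using Ck_on_componentwise by blast

lemma smooth_on_compose:
  "\<lbrakk>open S; smooth_on T f; smooth_on S g; g ` S \<subseteq> T\<rbrakk> \<Longrightarrow>
      smooth_on S (\<lambda>x. f (g x))"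
  unfolding smooth_on_def using Ck_on_compose by blast

lemma smooth_on_Pair:
  assumes "open S" "smooth_on S f" "smooth_on S g"
  shows "smooth_on S (\<lambda>x. (f x, g x))"
proof -
  have "bounded_linear (\<lambda>x::'b. (x, 0::'c))" "bounded_linear (\<lambda>x::'c. (0::'b, x))"
    by (auto intro!: bounded_linear_Pair bounded_linear_zero bounded_linear_ident)
  from smooth_on_add[OF assms(1) smooth_on_linear[OF assms(1) this(1) assms(2)]
      smooth_on_linear[OF assms(1) this(2) assms(3)]]
  show ?thesis by simp
qed

lemma smooth_on_inverse:
  fixes f :: "'e::euclidean_space \<Rightarrow> real"
  shows "\<lbrakk>open S; smooth_on S f; (\<And>x. x \<in> S \<Longrightarrow> f x \<noteq> 0)\<rbrakk> \<Longrightarrow>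
      smooth_on S (\<lambda>x. inverse (f x))"
  unfolding smooth_on_def using Ck_on_inverse by blast

lemma smooth_on_differentiable: "smooth_on S f \<Longrightarrow> x \<in> S \<Longrightarrow> f differentiable (at x)"
  unfolding smooth_on_def by (metis Ck_on.simps(2))

lemma smooth_on_has_derivative:
  "smooth_on S f \<Longrightarrow> x \<in> S \<Longrightarrow> (f has_derivative \<D> f x) (at x)"
  using smooth_on_differentiable frechet_derivative_works by blast

lemma smooth_on_continuous: "smooth_on S f \<Longrightarrow> continuous_on S f"
  unfolding smooth_on_def by (metis Ck_on.simps(1))

lemma smooth_on_deriv: "smooth_on S f \<Longrightarrow> smooth_on S (\<lambda>x. \<D> f x v)"
  unfolding smooth_on_def by (metis Ck_on.simps(2))

section \<open>Derivatives along lines and symmetry of second derivatives\<close>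

lemma has_real_derivative_along_line:
  assumes "(g has_derivative g') (at (x + s *\<^sub>R v))"
  shows "((\<lambda>s. g (x + s *\<^sub>R v)) has_real_derivative g' v) (at s)"
proof -
  have "((\<lambda>s. x + s *\<^sub>R v) has_derivative (\<lambda>h. h *\<^sub>R v)) (at s)"
    by (auto intro!: derivative_eq_intros)
  from has_derivative_compose[OF this assms]
  have "((\<lambda>s. g (x + s *\<^sub>R v)) has_derivative (\<lambda>h. g' (h *\<^sub>R v))) (at s)" .
  moreover have "g' (h *\<^sub>R v) = h * g' v" for h
    using has_derivative_linear[OF assms] by (simp add: linear_scale)
  ultimately show ?thesis by (simp add: has_field_derivative_def mult.commute[of _ "g' v"])
qed

text \<open>By two applications of the mean value theorem the second difference is
  \<open>t\<^sup>2\<close> times the mixed derivative at a nearby point, and the mixed derivative is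
  continuous.\<close>

lemma second_difference_tendsto:
  fixes f :: "'e::euclidean_space \<Rightarrow> real"
  assumes "open S" "smooth_on S f" "x \<in> S"
  shows "((\<lambda>t. (f (x + t *\<^sub>R v + t *\<^sub>R w) - f (x + t *\<^sub>R v) - f (x + t *\<^sub>R w) + f x) / t\<^sup>2) \<longlongrightarrow>
    \<D> (\<lambda>z. \<D> f z v) x w) (at_right 0)"
proof (rule tendstoI)
  define F where "F z = \<D> (\<lambda>z. \<D> f z v) z w" for z
  fix e :: real assume "e > 0"
  have Dv: "smooth_on S (\<lambda>z. \<D> f z v)" by (rule smooth_on_deriv[OF assms(2)])
  then have "smooth_on S F" unfolding F_def by (rule smooth_on_deriv)
  then have "isCont F x" using assms smooth_on_continuous continuous_on_eq_continuous_at by blast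
  then obtain r1 where r1: "r1 > 0" "\<And>z. dist z x < r1 \<Longrightarrow> dist (F z) (F x) < e"
    using \<open>e > 0\<close> unfolding continuous_at_eps_delta by (metis dist_commute)
  obtain r2 where r2: "r2 > 0" "ball x r2 \<subseteq> S" using assms openE by blast
  define r where "r = min r1 r2"
  \<comment> \<open>The summand 1 keeps the denominator positive when \<open>v\<close> and
    \<open>w\<close> are both zero.\<close>
  define d where "d = r / (norm v + norm w + 1)"
  have pos: "norm v + norm w + 1 > 0" by (simp add: add_nonneg_pos)
  have "r > 0" using r1 r2 by (auto simp: r_def)
  then have "d > 0" using pos by (simp add: d_def)
  have near: "dist (x + a *\<^sub>R v + b *\<^sub>R w) x < r" if "0 \<le> a" "a \<le> t" "0 \<le> b" "b \<le> t" "t < d" for a b t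
  proof -
    have "dist (x + a *\<^sub>R v + b *\<^sub>R w) x = norm (a *\<^sub>R v + b *\<^sub>R w)" by (simp add: dist_norm add.assoc)
    also have "\<dots> \<le> a * norm v + b * norm w"
      using that by (intro order_trans[OF norm_triangle_ineq]) simp
    also have "\<dots> \<le> t * norm v + t * norm w" using that by (intro add_mono mult_right_mono) auto
    also have "\<dots> \<le> t * (norm v + norm w + 1)" using that by (simp add: algebra_simps)
    also have "\<dots> < r" using that pos by (simp add: d_def pos_less_divide_eq)
    finally show ?thesis .
  qed
  have "dist ((f (x + t *\<^sub>R v + t *\<^sub>R w) - f (x + t *\<^sub>R v) - f (x + t *\<^sub>R w) + f x) / t\<^sup>2) (F x) < e"
    if t: "0 < t" "t < d" for t
  proof -
    have inS: "x + a *\<^sub>R v + b *\<^sub>R w \<in> S" if "0 \<le> a" "a \<le> t" "0 \<le> b" "b \<le> t" for a b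
      using near[OF that \<open>t < d\<close>] r2 by (auto simp: r_def dist_commute)
    \<comment> \<open>The increment in direction \<open>w\<close>, as a function of the step in
      direction \<open>v\<close>: the mean value theorem is used first for this step and then in
      direction \<open>w\<close>.\<close>
    define \<phi> where "\<phi> s = f (x + t *\<^sub>R w + s *\<^sub>R v) - f (x + s *\<^sub>R v)" for s
    have "\<exists>s>0. s < t \<and> \<phi> t - \<phi> 0 = (t - 0) *
        (\<D> f (x + t *\<^sub>R w + s *\<^sub>R v) v - \<D> f (x + s *\<^sub>R v) v)"
    proof (rule MVT2[OF t(1)])
      fix s assume "0 \<le> s" "s \<le> t"
      then show "DERIV \<phi> s :> \<D> f (x + t *\<^sub>R w + s *\<^sub>R v) v - \<D> f (x + s *\<^sub>R v) v"
        unfolding \<phi>_def using inS[of s t] inS[of s 0] t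
        by (intro DERIV_diff has_real_derivative_along_line smooth_on_has_derivative[OF assms(2)])
           (auto simp: algebra_simps)
    qed
    then obtain s where s: "0 < s" "s < t" and 1: "\<phi> t - \<phi> 0 = t *
        (\<D> f (x + t *\<^sub>R w + s *\<^sub>R v) v - \<D> f (x + s *\<^sub>R v) v)"
      by auto
    have "\<exists>b>0. b < t \<and> \<D> f (x + s *\<^sub>R v + t *\<^sub>R w) v - \<D> f (x + s *\<^sub>R v + 0 *\<^sub>R w) v
        = (t - 0) * F (x + s *\<^sub>R v + b *\<^sub>R w)"
    proof (rule MVT2[OF t(1)])
      fix b assume "0 \<le> b" "b \<le> t"
      then show "DERIV (\<lambda>b. \<D> f (x + s *\<^sub>R v + b *\<^sub>R w) v) b :> F (x + s *\<^sub>R v + b *\<^sub>R w)"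
        unfolding F_def using inS[of s b] s
        by (intro has_real_derivative_along_line[where g="\<lambda>z. \<D> f z v"]
            smooth_on_has_derivative[OF Dv]) auto
    qed
    then obtain b where b: "0 < b" "b < t" and 2: "\<D> f (x + s *\<^sub>R v + t *\<^sub>R w) v - \<D> f (x + s *\<^sub>R v) v
        = t * F (x + s *\<^sub>R v + b *\<^sub>R w)" by auto
    have "f (x + t *\<^sub>R v + t *\<^sub>R w) - f (x + t *\<^sub>R v) - f (x + t *\<^sub>R w) + f x = \<phi> t - \<phi> 0"
      by (simp add: \<phi>_def algebra_simps)
    also have "\<dots> = t\<^sup>2 * F (x + s *\<^sub>R v + b *\<^sub>R w)"
      using 1 2 by (simp add: algebra_simps power2_eq_square)
    finally have "(f (x + t *\<^sub>R v + t *\<^sub>R w) - f (x + t *\<^sub>R v) - f (x + t *\<^sub>R w) + f x) / t\<^sup>2 = F (x + s *\<^sub>R v + b *\<^sub>R w)"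
      using t by simp
    then show ?thesis using r1(2) near[of s t b] s b t by (auto simp: r_def)
  qed
  then show "\<forall>\<^sub>F t in at_right 0. dist ((f (x + t *\<^sub>R v + t *\<^sub>R w) - f (x + t *\<^sub>R v) - f (x + t *\<^sub>R w) + f x) / t\<^sup>2) (\<D> (\<lambda>z. \<D> f z v) x w) < e"
    using \<open>d > 0\<close> unfolding eventually_at_right_field F_def by auto
qed

text \<open>The second difference does not change when \<open>v\<close> and \<open>w\<close> are
  exchanged, and limits are unique.\<close>

lemma second_derivative_symmetric:
  fixes f :: "'e::euclidean_space \<Rightarrow> real"
  assumes "open S" "smooth_on S f" "x \<in> S"
  shows "\<D> (\<lambda>z. \<D> f z v) x w =
    \<D> (\<lambda>z. \<D> f z w) x v"
proof (rule tendsto_unique[OF _ second_difference_tendsto[OF assms]])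
  show "((\<lambda>t. (f (x + t *\<^sub>R v + t *\<^sub>R w) - f (x + t *\<^sub>R v) - f (x + t *\<^sub>R w) + f x) / t\<^sup>2) \<longlongrightarrow>
    \<D> (\<lambda>z. \<D> f z w) x v) (at_right 0)"
    using second_difference_tendsto[OF assms, of w v]
    by (rule Lim_transform_eventually) (auto intro!: always_eventually simp: algebra_simps)
qed simp

section \<open>A function on the line that is smooth and flat at 0\<close>

text \<open>Each member of this family is flat at \<open>0\<close>, and the family is closed under differentiation.\<close>

definition flat_exp :: "nat \<Rightarrow> real \<Rightarrow> real" where
  "flat_exp n t = (if t > 0 then (1 / t) ^ n * exp (- (1 / t)) else 0)"

text \<open>With \<open>s = 1 / t\<close> this is the fact that the exponential dominates every
  power of \<open>s\<close>.\<close>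

lemma flat_exp_tendsto_0: "(flat_exp n \<longlongrightarrow> 0) (at_right 0)"
proof -
  have "((\<lambda>t. (1 / t) ^ n / exp (1 / t) :: real) \<longlongrightarrow> 0) (at_right 0)"
    using filterlim_compose[OF tendsto_power_div_exp_0[of n] filterlim_inverse_at_top_right]
    by (simp add: inverse_eq_divide)
  then show ?thesis
    by (rule Lim_transform_eventually)
       (auto simp: flat_exp_def exp_minus field_simps eventually_at_filter)
qed

lemma flat_exp_deriv:
  "(flat_exp n has_real_derivative (flat_exp (n + 2) t - real n * flat_exp (n + 1) t)) (at t)"
proof (cases t "0::real" rule: linorder_cases)
  case less
  have "((\<lambda>t. 0) has_real_derivative 0) (at t)" by simp
  then have "(flat_exp n has_real_derivative 0) (at t)"
    by (rule has_field_derivative_transform_within_open[where S="{..<0}"]) (use less in \<open>auto simp: flat_exp_def\<close>)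
  then show ?thesis using less by (simp add: flat_exp_def)
next
  case greater
  have "((\<lambda>t. (1 / t) ^ n * exp (- (1 / t))) has_real_derivative (flat_exp (n + 2) t - real n * flat_exp (n + 1) t)) (at t)"
    using greater
    \<comment> \<open>The power rule produces the exponent \<open>n - 1\<close>, which is only
      usable after a case distinction on \<open>n\<close>.\<close>
    apply (cases n)
     apply (auto intro!: derivative_eq_intros simp: flat_exp_def power2_eq_square)
    subgoal for m by (cases m) (auto simp: field_simps)
    done
  then show ?thesis
    by (rule has_field_derivative_transform_within_open[where S="{0<..}"]) (use greater in \<open>auto simp: flat_exp_def\<close>)
next
  case equal
  have q: "((\<lambda>h. flat_exp n h / h) \<longlongrightarrow> 0) (at 0)"
    unfolding filterlim_at_split
  proof
    \<comment> \<open>Division by \<open>h > 0\<close> raises the index by one, so the difference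
      quotient is again a member of the family.\<close>
    show "((\<lambda>h. flat_exp n h / h) \<longlongrightarrow> 0) (at_right 0)"
      using flat_exp_tendsto_0[of "Suc n"]
      by (rule Lim_transform_eventually) (auto simp: flat_exp_def eventually_at_filter)
    have "\<forall>\<^sub>F h in at_left 0. flat_exp n h / h = (0::real)"
      by (auto simp: flat_exp_def eventually_at_filter)
    then show "((\<lambda>h. flat_exp n h / h) \<longlongrightarrow> 0) (at_left 0)"
      by (rule tendsto_eventually)
  qed
  then show ?thesis using equal by (simp add: has_field_derivative_iff flat_exp_def)
qed

lemma smooth_on_flat_exp: "smooth_on UNIV (flat_exp n)"
proof -
  have "Ck_on k UNIV (flat_exp n)" for k
  proof (induction k arbitrary: n)
    case 0
    show ?case using flat_exp_deriv
      by (auto intro!: continuous_at_imp_continuous_on DERIV_isCont)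
  next
    case (Suc k)
    show ?case
    proof (rule Ck_on_SucI)
      fix t show "(flat_exp n has_derivative (\<lambda>v. v * (flat_exp (n + 2) t - real n * flat_exp (n + 1) t))) (at t)"
        using flat_exp_deriv[of n t] by (simp add: has_field_derivative_def mult_commute_abs)
    next
      fix v :: real
      have "Ck_on k UNIV (\<lambda>t. v * (flat_exp (n + 2) t + (- real n) * flat_exp (n + 1) t))"
        by (intro Ck_on_linear[OF open_UNIV bounded_linear_mult_right] Ck_on_add[OF open_UNIV] Suc.IH)
      then show "Ck_on k UNIV (\<lambda>t. v * (flat_exp (n + 2) t - real n * flat_exp (n + 1) t))"
        by simp
    qed simp
  qed
  then show ?thesis by (simp add: smooth_on_def)
qed

subsection \<open>Linear systems with smooth coefficients\<close>

text \<open>At a zero of \<open>g\<close> the product rule has no term with a derivative of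
  \<open>h\<close>, so continuity of \<open>h\<close> suffices. In
  \<open>linear_solution_derivative\<close> the factor \<open>h\<close> is a component of the
  solution, whose differentiability is yet to be proved.\<close>

lemma has_derivative_scaleR_vanishing:
  fixes g :: "'e::real_normed_vector \<Rightarrow> 'f::real_normed_vector" and h :: "'e \<Rightarrow> real"
  assumes "(g has_derivative g') (at x)" "g x = 0" "isCont h x"
  shows "((\<lambda>z. h z *\<^sub>R g z) has_derivative (\<lambda>v. h x *\<^sub>R g' v)) (at x)"
proof -
  obtain B where B: "\<And>v. norm (g' v) \<le> B * norm v" "B > 0"
    using bounded_linear.pos_bounded[OF has_derivative_bounded_linear[OF assms(1)]]
    by (metis mult.commute)
  have lim: "((\<lambda>z. norm (g z - g x - g' (z - x)) / norm (z - x)) \<longlongrightarrow> 0) (at x)"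
    using assms(1) by (simp add: has_derivative_iff_norm)
  have "((\<lambda>z. \<bar>h z\<bar> * (norm (g z - g x - g' (z - x)) / norm (z - x)) + \<bar>h z - h x\<bar> * B) \<longlongrightarrow> \<bar>h x\<bar> * 0 + \<bar>h x - h x\<bar> * B) (at x)"
    using assms(3) lim by (intro tendsto_intros) (auto simp: isCont_def)
  then have lim2: "((\<lambda>z. \<bar>h z\<bar> * (norm (g z - g x - g' (z - x)) / norm (z - x)) + \<bar>h z - h x\<bar> * B) \<longlongrightarrow> 0) (at x)" by simp
  show ?thesis unfolding has_derivative_iff_norm
  proof
    show "bounded_linear (\<lambda>v. h x *\<^sub>R g' v)"
      by (rule bounded_linear_const_scaleR[OF has_derivative_bounded_linear[OF assms(1)]])
    show "((\<lambda>z. norm (h z *\<^sub>R g z - h x *\<^sub>R g x - h x *\<^sub>R g' (z - x)) / norm (z - x)) \<longlongrightarrow> 0) (at x)"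
    proof (rule tendsto_sandwich[OF _ _ tendsto_const lim2])
      show "\<forall>\<^sub>F z in at x. norm (h z *\<^sub>R g z - h x *\<^sub>R g x - h x *\<^sub>R g' (z - x)) / norm (z - x)
          \<le> \<bar>h z\<bar> * (norm (g z - g x - g' (z - x)) / norm (z - x)) + \<bar>h z - h x\<bar> * B"
        unfolding eventually_at_filter
      proof (intro always_eventually allI impI)
        fix z assume "z \<noteq> x"
        \<comment> \<open>The remainder splits into \<open>h\<close> times the remainder of
          \<open>g\<close>, and the oscillation of \<open>h\<close> times a term linear in
          \<open>z - x\<close>.\<close>
        have "h z *\<^sub>R g z - h x *\<^sub>R g x - h x *\<^sub>R g' (z - x) = h z *\<^sub>R (g z - g x - g' (z - x)) + (h z - h x) *\<^sub>R g' (z - x)"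
          using assms(2) by (simp add: algebra_simps)
        then have "norm (h z *\<^sub>R g z - h x *\<^sub>R g x - h x *\<^sub>R g' (z - x)) \<le> \<bar>h z\<bar> * norm (g z - g x - g' (z - x)) + \<bar>h z - h x\<bar> * norm (g' (z - x))"
          by (metis norm_scaleR norm_triangle_ineq)
        also have "\<dots> \<le> \<bar>h z\<bar> * norm (g z - g x - g' (z - x)) + \<bar>h z - h x\<bar> * (B * norm (z - x))"
          using B by (intro add_left_mono mult_left_mono) auto
        finally show "norm (h z *\<^sub>R g z - h x *\<^sub>R g x - h x *\<^sub>R g' (z - x)) / norm (z - x)
          \<le> \<bar>h z\<bar> * (norm (g z - g x - g' (z - x)) / norm (z - x)) + \<bar>h z - h x\<bar> * B"
          using \<open>z \<noteq> x\<close> by (simp add: field_simps)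
      qed
    qed (auto intro!: always_eventually)
  qed
qed

context
  fixes S :: "'e::euclidean_space set" and P :: "'e \<Rightarrow> 'f::euclidean_space \<Rightarrow> 'f"
  assumes S: "open S" and lin: "\<And>z. z \<in> S \<Longrightarrow> linear (P z)" and inj: "\<And>z. z \<in> S \<Longrightarrow> inj (P z)"
    and sm: "\<And>c. smooth_on S (\<lambda>z. P z c)"
begin

text \<open>Subtracting the correction replaces \<open>P z\<close> by \<open>P x\<close>, whose
  inverse is \<open>A\<close>. The identity expresses a solution through itself with coefficients
  that vanish at \<open>z = x\<close>, so regularity can be bootstrapped with the inverse at the
  base point alone.\<close>

lemma linear_solution_perturbation:
  assumes "linear A" "\<And>v. A (P x v) = v" "x \<in> S" "z \<in> S"
  shows "v = A (P z v) - (\<Sum>c\<in>Basis. (v \<bullet> c) *\<^sub>R A (P z c - P x c))"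
proof -
  have e: "P y v = (\<Sum>c\<in>Basis. (v \<bullet> c) *\<^sub>R P y c)" if "y \<in> S" for y
  proof -
    have "P y v = P y (\<Sum>c\<in>Basis. (v \<bullet> c) *\<^sub>R c)" by (simp add: euclidean_representation)
    then show ?thesis by (simp only: linear_sum[OF lin[OF that]] linear_scale[OF lin[OF that]])
  qed
  have "(\<Sum>c\<in>Basis. (v \<bullet> c) *\<^sub>R A (P z c - P x c)) = A (P z v - P x v)"
    by (simp only: e[OF assms(3)] e[OF assms(4)] linear_sum[OF assms(1)] linear_scale[OF assms(1)]
        linear_diff[OF assms(1)] scaleR_diff_right sum_subtractf)
  then show ?thesis by (simp add: linear_diff[OF assms(1)] assms(2))
qed

text \<open>The correction term is at most \<open>norm (w z)\<close> times a quantity tending to 0.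
  This first bounds \<open>w\<close> near \<open>x\<close> and then shows that
  \<open>w z - A (b z)\<close> tends to 0.\<close>

lemma linear_solution_continuous:
  assumes "x \<in> S" "isCont b x" "\<And>z. z \<in> S \<Longrightarrow> P z (w z) = b z"
  shows "isCont w x"
proof -
  obtain A where A: "linear A" "\<And>v. A (P x v) = v"
    using linear_injective_isomorphism[OF lin inj] assms(1) by metis
  have blA: "bounded_linear A" using A(1) linear_conv_bounded_linear by blast
  define \<epsilon> where "\<epsilon> z = (\<Sum>c\<in>Basis. norm (A (P z c - P x c)))" for z
  have Pc: "((\<lambda>z. P z c) \<longlongrightarrow> P x c) (at x)" for c
    using smooth_on_continuous[OF sm] S assms(1) continuous_on_eq_continuous_at isCont_def by blast
  have "((\<lambda>z. \<epsilon> z) \<longlongrightarrow> (\<Sum>c\<in>(Basis::'f set). norm (A (P x c - P x c)))) (at x)"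
    unfolding \<epsilon>_def by (intro tendsto_intros bounded_linear.tendsto[OF blA] Pc)
  then have \<epsilon>0: "(\<epsilon> \<longlongrightarrow> 0) (at x)" by (simp add: linear_0[OF A(1)])
  have Ab: "((\<lambda>z. A (b z)) \<longlongrightarrow> A (b x)) (at x)"
    using assms(2) by (intro bounded_linear.tendsto[OF blA]) (simp add: isCont_def)
  have inS: "\<forall>\<^sub>F z in at x. z \<in> S" using S assms(1) by (auto simp: eventually_at_topological)
  have est: "norm (w z - A (b z)) \<le> norm (w z) * \<epsilon> z" if "z \<in> S" for z
  proof -
    have "w z - A (b z) = - (\<Sum>c\<in>Basis. (w z \<bullet> c) *\<^sub>R A (P z c - P x c))"
      using linear_solution_perturbation[OF A assms(1) that, of "w z"] assms(3)[OF that] by (simp add: algebra_simps)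
    then have "norm (w z - A (b z)) = norm (\<Sum>c\<in>Basis. (w z \<bullet> c) *\<^sub>R A (P z c - P x c))" by simp
    also have "\<dots> \<le> (\<Sum>c\<in>Basis. norm ((w z \<bullet> c) *\<^sub>R A (P z c - P x c)))" by (rule norm_sum)
    also have "\<dots> \<le> (\<Sum>c\<in>Basis. norm (w z) * norm (A (P z c - P x c)))"
      by (intro sum_mono) (auto intro!: mult_right_mono simp: Basis_le_norm)
    finally show ?thesis by (simp add: \<epsilon>_def sum_distrib_left)
  qed
  \<comment> \<open>Below 1/2, at most half of \<open>norm (w z)\<close> stands on the right of the
    estimate and can be absorbed on the left.\<close>
  have "\<forall>\<^sub>F z in at x. \<epsilon> z < 1/2" by (rule order_tendstoD(2)[OF \<epsilon>0]) simp
  with inS have "\<forall>\<^sub>F z in at x. norm (w z - A (b z)) \<le> 2 * norm (A (b z)) * \<epsilon> z"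
  proof eventually_elim
    case (elim z)
    have e0: "\<epsilon> z \<ge> 0" by (auto simp: \<epsilon>_def intro: sum_nonneg)
    have "norm (w z) \<le> norm (A (b z)) + norm (w z - A (b z))" by (metis norm_triangle_sub)
    also have "\<dots> \<le> norm (A (b z)) + norm (w z) * (1/2)"
      using est[OF elim(1)] elim(2) by (smt (verit) mult_left_mono norm_ge_zero)
    finally have "norm (w z) \<le> 2 * norm (A (b z))" by simp
    then show ?case using est[OF elim(1)] e0 by (meson mult_right_mono order_trans)
  qed
  moreover have "((\<lambda>z. 2 * norm (A (b z)) * \<epsilon> z) \<longlongrightarrow> 0) (at x)"
    using tendsto_mult[OF tendsto_mult[OF tendsto_const tendsto_norm[OF Ab]] \<epsilon>0, of 2] by simp
  ultimately have "((\<lambda>z. w z - A (b z)) \<longlongrightarrow> 0) (at x)"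
    by (rule Lim_null_comparison)
  from tendsto_add[OF this Ab] have "(w \<longlongrightarrow> A (b x)) (at x)" by simp
  moreover have "A (b x) = w x" using A(2) assms(1,3) by metis
  ultimately show ?thesis by (simp add: isCont_def)
qed

text \<open>Differentiate the perturbation identity at \<open>x\<close>: the components of
  \<open>w\<close> are continuous and multiply factors that vanish there. Applying
  \<open>P x\<close> shows that the derivative solves a system with the same coefficients.\<close>

lemma linear_solution_derivative:
  assumes x: "x \<in> S" and b: "(b has_derivative b') (at x)" and w: "\<And>z. z \<in> S \<Longrightarrow> P z (w z) = b z"
  obtains w' where "(w has_derivative w') (at x)"
    "\<And>v. P x (w' v) = b' v - (\<Sum>c\<in>Basis. (w x \<bullet> c) *\<^sub>R \<D> (\<lambda>z. P z c) x v)"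
proof -
  obtain A where A: "linear A" "\<And>v. A (P x v) = v" "\<And>v. P x (A v) = v"
    using linear_injective_isomorphism[OF lin inj] x by metis
  have blA: "bounded_linear A" using A(1) linear_conv_bounded_linear by blast
  have cw: "isCont (\<lambda>z. w z \<bullet> c) x" for c
    by (intro continuous_intros linear_solution_continuous[OF x has_derivative_continuous[OF b] w])
  define w' where "w' v = A (b' v) - (\<Sum>c\<in>Basis. (w x \<bullet> c) *\<^sub>R A (\<D> (\<lambda>z. P z c) x v))" for v
  have "((\<lambda>z. A (P z c - P x c)) has_derivative (\<lambda>v. A (\<D> (\<lambda>z. P z c) x v))) (at x)" for c
    using bounded_linear.has_derivative[OF blA has_derivative_diff[OF smooth_on_has_derivative[OF sm x] has_derivative_const]]
    by simp
  then have "((\<lambda>z. (w z \<bullet> c) *\<^sub>R A (P z c - P x c)) has_derivative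
      (\<lambda>v. (w x \<bullet> c) *\<^sub>R A (\<D> (\<lambda>z. P z c) x v))) (at x)" for c
    by (rule has_derivative_scaleR_vanishing) (simp_all add: linear_0[OF A(1)] cw)
  then have "((\<lambda>z. A (b z) - (\<Sum>c\<in>Basis. (w z \<bullet> c) *\<^sub>R A (P z c - P x c))) has_derivative w') (at x)"
    unfolding w'_def
    by (intro has_derivative_diff has_derivative_sum bounded_linear.has_derivative[OF blA b])
  moreover have "A (b z) - (\<Sum>c\<in>Basis. (w z \<bullet> c) *\<^sub>R A (P z c - P x c)) = w z" if "z \<in> S" for z
    using sym[OF linear_solution_perturbation[OF A(1,2) x that, of "w z"]] unfolding w[OF that] .
  ultimately have "(w has_derivative w') (at x)"
    by (rule has_derivative_transform_within_open[OF _ S x])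
  moreover have "P x (w' v) = b' v - (\<Sum>c\<in>Basis. (w x \<bullet> c) *\<^sub>R \<D> (\<lambda>z. P z c) x v)" for v
    by (simp only: w'_def linear_diff[OF lin[OF x]] linear_sum[OF lin[OF x]] linear_scale[OF lin[OF x]] A(3))
  ultimately show ?thesis by (rule that)
qed

text \<open>Each directional derivative of \<open>w\<close> solves the system with the same
  \<open>P\<close> and a new right-hand side built from \<open>w\<close> and the derivatives of
  \<open>b\<close> and \<open>P\<close>. Hence the induction on the order must leave
  \<open>b\<close> and \<open>w\<close> arbitrary.\<close>

lemma smooth_on_linear_solution:
  assumes "smooth_on S b" "\<And>z. z \<in> S \<Longrightarrow> P z (w z) = b z"
  shows "smooth_on S w"
proof -
  have "Ck_on k S w" if "Ck_on k S b" "\<And>z. z \<in> S \<Longrightarrow> P z (w z) = b z" for k b w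
    using that
  proof (induction k arbitrary: b w)
    case 0
    then show ?case
      using linear_solution_continuous[of _ b w] S
      by (auto intro!: continuous_at_imp_continuous_on simp: continuous_on_eq_continuous_at)
  next
    case (Suc k)
    have w: "Ck_on k S w" using Suc.IH[OF Ck_on_SucD[OF Suc.prems(1)]] Suc.prems(2) by blast
    have d: "(w has_derivative \<D> w x) (at x) \<and>
      (\<forall>v. P x (\<D> w x v) = \<D> b x v - (\<Sum>c\<in>Basis. (w x \<bullet> c) *\<^sub>R \<D> (\<lambda>z. P z c) x v))"
      if "x \<in> S" for x
      by (rule linear_solution_derivative[OF that Ck_on_Suc_deriv[OF Suc.prems(1) that] Suc.prems(2)])
         (auto dest: frechet_derivative_at)
    show ?case
    proof (rule Ck_on_SucI[OF S, where f'="\<lambda>x. \<D> w x"])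
      fix v
      have "Ck_on k S (\<lambda>x. \<D> b x v + (-1) *\<^sub>R (\<Sum>c\<in>Basis. (w x \<bullet> c) *\<^sub>R \<D> (\<lambda>z. P z c) x v))"
        using Suc.prems(1) w smooth_on_deriv[OF sm]
        by (intro Ck_on_add[OF S] Ck_on_linear[OF S bounded_linear_scaleR_right] Ck_on_sum[OF S]
            Ck_on_bilinear[OF S bounded_bilinear_scaleR] Ck_on_linear[OF S bounded_linear_inner_left])
           (auto simp: smooth_on_def)
      then show "Ck_on k S (\<lambda>x. \<D> w x v)"
        by (rule Suc.IH) (use d in auto)
    qed (use d in blast)
  qed
  then show ?thesis using assms unfolding smooth_on_def by blast
qed

end

text \<open>The coordinate form of applying two vector fields in succession: a second derivative of
  \<open>f\<close>, which will cancel in a commutator, plus a first derivative of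
  \<open>f\<close>.\<close>

lemma frechet_derivative_deriv_field:
  fixes f :: "'e::euclidean_space \<Rightarrow> real"
  assumes "open S" "smooth_on S f" "smooth_on S B" "x \<in> S"
  shows "\<D> (\<lambda>z. \<D> f z (B z)) x v =
    \<D> (\<lambda>z. \<D> f z v) x (B x) +
    \<D> f x (\<D> B x v)"
proof -
  let ?D = "\<lambda>v z. \<D> f z v"
  have D: "(?D v has_derivative \<D> (?D v) x) (at x)" for v
    by (rule smooth_on_has_derivative[OF smooth_on_deriv[OF assms(2)] assms(4)])
  have "((\<lambda>z. \<Sum>b\<in>Basis. (B z \<bullet> b) * ?D b z) has_derivative
     (\<lambda>v. \<Sum>b\<in>Basis. (B x \<bullet> b) * \<D> (?D b) x v + (\<D> B x v \<bullet> b) * ?D b x)) (at x)"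
    by (intro has_derivative_sum has_derivative_mult has_derivative_inner_left D
        smooth_on_has_derivative[OF assms(3,4)])
  then have "((\<lambda>z. ?D (B z) z) has_derivative
     (\<lambda>v. \<Sum>b\<in>Basis. (B x \<bullet> b) * \<D> (?D b) x v + (\<D> B x v \<bullet> b) * ?D b x)) (at x)"
    by (rule has_derivative_transform_within_open[OF _ assms(1,4)])
       (simp only: real_scaleR_def[symmetric],
        rule frechet_derivative_expand[symmetric], rule smooth_on_differentiable[OF assms(2)])
  from fun_cong[OF frechet_derivative_at[OF this], of v, symmetric]
  have "\<D> (\<lambda>z. ?D (B z) z) x v =
     (\<Sum>b\<in>Basis. (B x \<bullet> b) * \<D> (?D b) x v) + (\<Sum>b\<in>Basis. (\<D> B x v \<bullet> b) * ?D b x)"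
    by (simp only: sum.distrib)
  also have "(\<Sum>b\<in>Basis. (\<D> B x v \<bullet> b) * ?D b x) = ?D (\<D> B x v) x"
    using frechet_derivative_expand[OF smooth_on_differentiable[OF assms(2,4)], of "\<D> B x v"] by simp
  \<comment> \<open>Symmetry moves the basis vector to the outer derivative, where the sum can be
    collected into the direction \<open>B x\<close>.\<close>
  also have "(\<Sum>b\<in>Basis. (B x \<bullet> b) * \<D> (?D b) x v) = (\<Sum>b\<in>Basis. (B x \<bullet> b) * \<D> (?D v) x b)"
    by (intro sum.cong refl arg_cong2[where f="(*)"] second_derivative_symmetric[OF assms(1,2,4)])
  also have "\<dots> = \<D> (?D v) x (B x)"
    using frechet_derivative_expand[OF smooth_on_differentiable[OF smooth_on_deriv[OF assms(2)] assms(4)], of v "B x"] by simp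
  finally show ?thesis .
qed

lemma smooth_on_transform:
  "\<lbrakk>smooth_on S f; open S; (\<And>x. x \<in> S \<Longrightarrow> f x = g x)\<rbrakk> \<Longrightarrow>
      smooth_on S g"
  using smooth_on_cong[of S f g] by blast

subsection \<open>Tangent vectors in charts\<close>

text \<open>The fibre coordinate of the charts of \<open>tangent_bundle\<close>.\<close>

definition chart_components :: "('a \<Rightarrow> 'e::euclidean_space) \<Rightarrow> 'a tvec \<Rightarrow> 'e" where
  "chart_components \<phi> v = (\<Sum>b\<in>Basis. v (\<lambda>q. \<phi> q \<bullet> b) *\<^sub>R b)"

text \<open>The operator that occurs in \<open>tangent_space\<close>, for one chart and one
  component vector, including the default value 0 outside the germs that are smooth at
  \<open>p\<close>.\<close>

definition chart_vector :: "('a, 'e::euclidean_space) atlas \<Rightarrow> 'a set \<Rightarrow> ('a \<Rightarrow> 'e) \<Rightarrow> 'a \<Rightarrow> 'e \<Rightarrow> 'a tvec" where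
  "chart_vector M U \<phi> p w = (\<lambda>f. if f \<in> smooth_near M p
     then \<D> (\<lambda>x. f (inv_into U \<phi> x)) (\<phi> p) w else 0)"

lemma chart_components_inner: "b \<in> Basis \<Longrightarrow> chart_components \<phi> v \<bullet> b = v (\<lambda>q. \<phi> q \<bullet> b)"
  unfolding chart_components_def by simp

lemma chart_components_add [simp]: "chart_components \<phi> (v + w) = chart_components \<phi> v + chart_components \<phi> w"
  by (simp add: chart_components_def scaleR_add_left sum.distrib)

lemma chart_components_vscale [simp]: "chart_components \<phi> (vscale c v) = c *\<^sub>R chart_components \<phi> v"
  by (simp add: chart_components_def vscale_def scaleR_sum_right)

lemma chart_components_0 [simp]: "chart_components \<phi> 0 = 0"
  by (simp add: chart_components_def)

text \<open>Conditions on charts only, which pass to the slit bundle by computing its transition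
  maps; the results of this locale then serve \<open>M\<close> and \<open>slit M\<close>
  alike.\<close>

locale smooth_atlas =
  fixes M :: "('a, 'e::euclidean_space) atlas"
  assumes inj: "(U, \<phi>) \<in> M \<Longrightarrow> inj_on \<phi> U"
    and open_image: "(U, \<phi>) \<in> M \<Longrightarrow> open (\<phi> ` U)"
    and open_overlap: "(U, \<phi>) \<in> M \<Longrightarrow> (V, \<psi>) \<in> M \<Longrightarrow> open (\<phi> ` (U \<inter> V))"
    and smooth_transition: "(U, \<phi>) \<in> M \<Longrightarrow> (V, \<psi>) \<in> M \<Longrightarrow>
      smooth_on (\<phi> ` (U \<inter> V)) (\<lambda>x. \<psi> (inv_into U \<phi> x))"
begin

section \<open>Topology of the manifold and germs of smooth functions\<close>

lemma inv_chart [simp]: "(U, \<phi>) \<in> M \<Longrightarrow> p \<in> U \<Longrightarrow> inv_into U \<phi> (\<phi> p) = p"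
  using inj by simp

lemma carrierI: "(U, \<phi>) \<in> M \<Longrightarrow> p \<in> U \<Longrightarrow> p \<in> carrier M"
  by (force simp: carrier_def)

lemma carrierE:
  assumes "p \<in> carrier M" obtains U \<phi> where "(U, \<phi>) \<in> M" "p \<in> U"
  using assms by (force simp: carrier_def)

lemma openin_iff: "openin (mtop M) W \<longleftrightarrow> W \<subseteq> carrier M \<and> (\<forall>(U, \<phi>)\<in>M. open (\<phi> ` (U \<inter> W)))"
  by (rule openin_mtop) (rule inj)

text \<open>Seen from any other chart, the set is a preimage of \<open>O'\<close> under a transition
  map.\<close>

lemma openin_chart_nbhd:
  assumes "(U, \<phi>) \<in> M" "open O'" "O' \<subseteq> \<phi> ` U"
  shows "openin (mtop M) (inv_into U \<phi> ` O')"
  unfolding openin_iff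
proof (intro conjI ballI, goal_cases)
  case 1
  show ?case using assms inv_chart[OF assms(1)] by (auto simp: image_iff intro!: carrierI[OF assms(1)])
next
  case (2 c)
  obtain V \<psi> where c: "c = (V, \<psi>)" by (cases c)
  have V: "(V, \<psi>) \<in> M" using 2 c by simp
  have "\<psi> ` (V \<inter> inv_into U \<phi> ` O') = \<psi> ` (V \<inter> U) \<inter> (\<lambda>x. \<phi> (inv_into V \<psi> x)) -` O'" (is "?L = ?R")
  proof (intro equalityI subsetI)
    fix y assume "y \<in> ?L"
    then obtain x where "x \<in> O'" "inv_into U \<phi> x \<in> V" "y = \<psi> (inv_into U \<phi> x)" by auto
    moreover then obtain q where "q \<in> U" "x = \<phi> q" using assms(3) by auto
    ultimately show "y \<in> ?R" using assms(1) V by auto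
  next
    fix y assume "y \<in> ?R"
    then obtain q where "q \<in> V" "q \<in> U" "y = \<psi> q" "\<phi> (inv_into V \<psi> y) \<in> O'" by auto
    then show "y \<in> ?L" using assms(1) V by (auto intro!: imageI image_eqI[of q _ "\<phi> q"])
  qed
  moreover have "open ?R"
    using continuous_open_preimage[OF smooth_on_continuous[OF smooth_transition[OF V assms(1)]] open_overlap[OF V assms(1)] assms(2)] .
  ultimately show ?case using c by simp
qed

lemma topspace_mtop: "topspace (mtop M) = carrier M"
proof -
  have "openin (mtop M) (carrier M)" unfolding openin_iff
  proof (intro conjI ballI, goal_cases)
    case (2 c)
    obtain V \<psi> where c: "c = (V, \<psi>)" by (cases c)
    have "V \<inter> carrier M = V" using carrierI 2 c by blast
    then show ?case using 2 c open_image by auto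
  qed simp
  then show ?thesis using openin_subset openin_topspace openin_iff by (metis subset_antisym)
qed

lemma openin_chart: "(U, \<phi>) \<in> M \<Longrightarrow> openin (mtop M) U"
  using openin_chart_nbhd[OF _ open_image subset_refl, of U \<phi>] inj
  by (simp add: inv_into_image_cancel image_image)

text \<open>Translates statements about germs on the manifold into statements about germs in
  Euclidean space.\<close>

lemma eventually_chart:
  assumes "(U, \<phi>) \<in> M" "p \<in> U"
  shows "eventually P (nhdsin (mtop M) p) \<longleftrightarrow> (\<forall>\<^sub>F x in nhds (\<phi> p). P (inv_into U \<phi> x))"
proof
  have p: "p \<in> topspace (mtop M)" using assms carrierI topspace_mtop by blast
  {
    assume "eventually P (nhdsin (mtop M) p)"
    then obtain W where W: "openin (mtop M) W" "p \<in> W" "\<forall>x\<in>W. P x" using p by (auto simp: eventually_nhdsin)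
    have "open (\<phi> ` (U \<inter> W))" using W(1) assms(1) unfolding openin_iff by blast
    moreover have "\<phi> p \<in> \<phi> ` (U \<inter> W)" using assms W by auto
    ultimately show "\<forall>\<^sub>F x in nhds (\<phi> p). P (inv_into U \<phi> x)"
      unfolding eventually_nhds using W assms(1) by (intro exI[of _ "\<phi> ` (U \<inter> W)"]) auto
  next
    assume "\<forall>\<^sub>F x in nhds (\<phi> p). P (inv_into U \<phi> x)"
    then obtain S where S: "open S" "\<phi> p \<in> S" "\<forall>x\<in>S. P (inv_into U \<phi> x)" by (auto simp: eventually_nhds)
    have "openin (mtop M) (inv_into U \<phi> ` (S \<inter> \<phi> ` U))"
      using S assms(1) open_image by (intro openin_chart_nbhd) auto
    moreover have "p \<in> inv_into U \<phi> ` (S \<inter> \<phi> ` U)"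
      using S assms by (intro image_eqI[of _ _ "\<phi> p"]) auto
    ultimately show "eventually P (nhdsin (mtop M) p)"
      unfolding eventually_nhdsin using S(3) by blast
  }
qed

lemma eventually_in_chart: "(U, \<phi>) \<in> M \<Longrightarrow> p \<in> U \<Longrightarrow> \<forall>\<^sub>F q in nhdsin (mtop M) p. q \<in> U"
  using openin_chart by (auto simp: eventually_nhdsin)

lemma eventually_carrier: "\<forall>\<^sub>F q in nhdsin (mtop M) p. q \<in> carrier M"
  by (metis eventually_nhdsin openin_topspace topspace_mtop)

text \<open>Smoothness in one chart spreads to the others through the transition maps, so a single
  chart around \<open>p\<close> decides.\<close>

lemma smooth_near_iff:
  assumes "(U, \<phi>) \<in> M" "p \<in> U"
  shows "f \<in> smooth_near M p \<longleftrightarrow>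
    (\<exists>S. open S \<and> \<phi> p \<in> S \<and> S \<subseteq> \<phi> ` U \<and> smooth_on S (\<lambda>x. f (inv_into U \<phi> x)))"
proof
  assume "f \<in> smooth_near M p"
  then obtain W where W: "openin (mtop M) W" "p \<in> W" "smooth_fun (restrict_atlas M W) f"
    by (auto simp: smooth_near_def)
  have o: "open (\<phi> ` (U \<inter> W))" using W(1) assms(1) unfolding openin_iff by blast
  have "smooth_on (\<phi> ` (U \<inter> W)) (f \<circ> inv_into (U \<inter> W) \<phi>)"
    using W(3) assms(1) by (force simp: smooth_fun_def restrict_atlas_def)
  moreover have "(f \<circ> inv_into (U \<inter> W) \<phi>) x = f (inv_into U \<phi> x)" if "x \<in> \<phi> ` (U \<inter> W)" for x
    using that inj[OF assms(1)] by (auto simp: inj_on_Int)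
  ultimately have "smooth_on (\<phi> ` (U \<inter> W)) (\<lambda>x. f (inv_into U \<phi> x))"
    by (rule smooth_on_transform[OF _ o])
  then show "\<exists>S. open S \<and> \<phi> p \<in> S \<and> S \<subseteq> \<phi> ` U \<and> smooth_on S (\<lambda>x. f (inv_into U \<phi> x))"
    using o assms(2) W(2) by blast
next
  assume "\<exists>S. open S \<and> \<phi> p \<in> S \<and> S \<subseteq> \<phi> ` U \<and> smooth_on S (\<lambda>x. f (inv_into U \<phi> x))"
  then obtain S where S: "open S" "\<phi> p \<in> S" "S \<subseteq> \<phi> ` U" "smooth_on S (\<lambda>x. f (inv_into U \<phi> x))" by blast
  define W where "W = inv_into U \<phi> ` S"
  have W: "openin (mtop M) W" unfolding W_def by (rule openin_chart_nbhd[OF assms(1) S(1,3)])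
  have WU: "W \<subseteq> U" using S(3) assms(1) by (auto simp: W_def)
  have \<phi>W: "\<phi> q \<in> S" if q: "q \<in> W" for q
  proof -
    obtain x where "x \<in> S" "q = inv_into U \<phi> x" using q by (auto simp: W_def)
    moreover then have "\<phi> q = x" using S(3) f_inv_into_f[of x \<phi> U] by blast
    ultimately show ?thesis by simp
  qed
  have "smooth_fun (restrict_atlas M W) f" unfolding smooth_fun_def
  proof
    fix c assume "c \<in> restrict_atlas M W"
    then obtain V \<psi> where c: "c = (V \<inter> W, \<psi>)" "(V, \<psi>) \<in> M" by (auto simp: restrict_atlas_def)
    have o: "open (\<psi> ` (V \<inter> W))" using W c(2) unfolding openin_iff by blast
    have "smooth_on (\<psi> ` (V \<inter> W)) (\<lambda>y. f (inv_into U \<phi> (\<phi> (inv_into V \<psi> y))))"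
      by (rule smooth_on_compose[OF o S(4)])
         (use smooth_on_subset[OF smooth_transition[OF c(2) assms(1)], of "\<psi> ` (V \<inter> W)"] WU \<phi>W c(2) in auto)
    moreover have "f (inv_into U \<phi> (\<phi> (inv_into V \<psi> y))) = (f \<circ> inv_into (V \<inter> W) \<psi>) y" if y: "y \<in> \<psi> ` (V \<inter> W)" for y
    proof -
      obtain q where q: "q \<in> V" "q \<in> W" "y = \<psi> q" using y by blast
      have "inv_into (V \<inter> W) \<psi> y = q" using q inj[OF c(2)] by (simp add: inj_on_Int)
      then show ?thesis using q c(2) assms(1) WU by auto
    qed
    ultimately have "smooth_on (\<psi> ` (V \<inter> W)) (f \<circ> inv_into (V \<inter> W) \<psi>)"
      by (rule smooth_on_transform[OF _ o])
    then show "case c of (U, \<phi>) \<Rightarrow> smooth_on (\<phi> ` U) (f \<circ> inv_into U \<phi>)"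
      using c(1) by simp
  qed
  moreover have "p \<in> W" using S(2) assms by (auto simp: W_def intro!: image_eqI[of _ _ "\<phi> p"])
  ultimately show "f \<in> smooth_near M p" using W by (auto simp: smooth_near_def)
qed

lemma smooth_near_cong:
  assumes "\<forall>\<^sub>F q in nhdsin (mtop M) p. f q = g q" "p \<in> carrier M"
  shows "f \<in> smooth_near M p \<longleftrightarrow> g \<in> smooth_near M p"
proof -
  have "g \<in> smooth_near M p" if ev: "\<forall>\<^sub>F q in nhdsin (mtop M) p. f q = g q" and f: "f \<in> smooth_near M p" for f g
  proof -
    obtain U \<phi> where U: "(U, \<phi>) \<in> M" "p \<in> U" using assms(2) carrierE by blast
    obtain S where S: "open S" "\<phi> p \<in> S" "S \<subseteq> \<phi> ` U" "smooth_on S (\<lambda>x. f (inv_into U \<phi> x))"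
      using f smooth_near_iff[OF U] by blast
    obtain S' where S': "open S'" "\<phi> p \<in> S'" "\<forall>x\<in>S'. f (inv_into U \<phi> x) = g (inv_into U \<phi> x)"
      using ev eventually_chart[OF U] by (auto simp: eventually_nhds)
    have "smooth_on (S \<inter> S') (\<lambda>x. f (inv_into U \<phi> x))" using S smooth_on_subset by blast
    then have "smooth_on (S \<inter> S') (\<lambda>x. g (inv_into U \<phi> x))"
      by (rule smooth_on_transform) (use S S' in auto)
    then show ?thesis using S S' smooth_near_iff[OF U] by (metis IntI le_infI1 open_Int)
  qed
  from this[OF assms(1)] this[of g f] show ?thesis using assms(1) by (auto simp: eq_commute)
qed

lemma smooth_near_eventually:
  assumes "f \<in> smooth_near M p"
  shows "\<forall>\<^sub>F q in nhdsin (mtop M) p. f \<in> smooth_near M q"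
  using assms by (auto simp: smooth_near_def eventually_nhdsin)

lemma smooth_near_carrier: "f \<in> smooth_near M p \<Longrightarrow> p \<in> carrier M"
  unfolding smooth_near_def using openin_subset topspace_mtop by blast

text \<open>\<open>smooth_near\<close> is about real functions only; this is its version for
  functions with values in a Euclidean space.\<close>

definition snear :: "'a \<Rightarrow> ('a \<Rightarrow> 'f::euclidean_space) \<Rightarrow> bool" where
  "snear p h \<longleftrightarrow> (\<forall>b\<in>Basis. (\<lambda>q. h q \<bullet> b) \<in> smooth_near M p)"

lemma snear_iff:
  assumes "(U, \<phi>) \<in> M" "p \<in> U"
  shows "snear p h \<longleftrightarrow>
    (\<exists>S. open S \<and> \<phi> p \<in> S \<and> S \<subseteq> \<phi> ` U \<and> smooth_on S (\<lambda>x. h (inv_into U \<phi> x)))"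
proof
  assume "snear p h"
  then have "\<forall>b\<in>Basis. \<exists>S. open S \<and> \<phi> p \<in> S \<and> S \<subseteq> \<phi> ` U \<and> smooth_on S (\<lambda>x. h (inv_into U \<phi> x) \<bullet> b)"
    by (simp add: snear_def smooth_near_iff[OF assms])
  then obtain S where S: "\<And>b. b \<in> Basis \<Longrightarrow> open (S b) \<and> \<phi> p \<in> S b \<and> S b \<subseteq> \<phi> ` U \<and> smooth_on (S b) (\<lambda>x. h (inv_into U \<phi> x) \<bullet> b)"
    by metis
  let ?S = "\<Inter>b\<in>Basis. S b"
  have o: "open ?S" using S by (intro open_INT) auto
  have "smooth_on ?S (\<lambda>x. h (inv_into U \<phi> x) \<bullet> b)" if "b \<in> Basis" for b
    by (rule smooth_on_subset[of "S b"]) (use S that in auto)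
  then have "smooth_on ?S (\<lambda>x. h (inv_into U \<phi> x))" by (subst smooth_on_componentwise[OF o]) blast
  moreover have "?S \<subseteq> \<phi> ` U" using S SOME_Basis by blast
  ultimately show "\<exists>S. open S \<and> \<phi> p \<in> S \<and> S \<subseteq> \<phi> ` U \<and> smooth_on S (\<lambda>x. h (inv_into U \<phi> x))"
    using o S by (intro exI[of _ ?S]) auto
next
  assume "\<exists>S. open S \<and> \<phi> p \<in> S \<and> S \<subseteq> \<phi> ` U \<and> smooth_on S (\<lambda>x. h (inv_into U \<phi> x))"
  then show "snear p h" unfolding snear_def smooth_near_iff[OF assms] using smooth_on_inner by blast
qed

lemma snear_real [simp]: "snear p f \<longleftrightarrow> f \<in> smooth_near M p" for f :: "'a \<Rightarrow> real"
  by (simp add: snear_def)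

text \<open>Together with \<open>snear_Pair\<close> this yields sums, products and reciprocals of
  smooth germs.\<close>

lemma snear_compose:
  assumes "snear p h" "smooth_on T G" "open T" "h p \<in> T" "p \<in> carrier M"
  shows "snear p (\<lambda>q. G (h q))"
proof -
  obtain U \<phi> where U: "(U, \<phi>) \<in> M" "p \<in> U" using assms(5) carrierE by blast
  obtain S where S: "open S" "\<phi> p \<in> S" "S \<subseteq> \<phi> ` U" "smooth_on S (\<lambda>x. h (inv_into U \<phi> x))"
    using assms(1) snear_iff[OF U] by blast
  define S' where "S' = S \<inter> (\<lambda>x. h (inv_into U \<phi> x)) -` T"
  have o: "open S'" unfolding S'_def
    by (rule continuous_open_preimage[OF smooth_on_continuous[OF S(4)] S(1) assms(3)])
  have "smooth_on S' (\<lambda>x. G (h (inv_into U \<phi> x)))"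
    by (rule smooth_on_compose[OF o assms(2) smooth_on_subset[OF S(4)]]) (auto simp: S'_def)
  moreover have "\<phi> p \<in> S'" using S U assms(4) by (auto simp: S'_def)
  ultimately show ?thesis using o S unfolding snear_iff[OF U] S'_def by blast
qed

lemma snear_carrier: "snear p h \<Longrightarrow> p \<in> carrier M"
  unfolding snear_def using SOME_Basis smooth_near_carrier by blast

lemma snear_chart: "(U, \<phi>) \<in> M \<Longrightarrow> p \<in> U \<Longrightarrow> snear p \<phi>"
  by (subst snear_iff, assumption+, rule exI[of _ "\<phi> ` U"])
     (auto simp: open_image intro!: smooth_on_transform[OF smooth_on_id])

lemma chart_coordinate: "\<lbrakk>(U, \<phi>) \<in> M; p \<in> U; b \<in> Basis\<rbrakk> \<Longrightarrow>
      (\<lambda>q. \<phi> q \<bullet> b) \<in> smooth_near M p"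
  using snear_chart by (auto simp: snear_def)

lemma snear_Pair:
  assumes "snear p h" "snear p k" shows "snear p (\<lambda>q. (h q, k q))"
proof -
  obtain U \<phi> where U: "(U, \<phi>) \<in> M" "p \<in> U" using assms(1) snear_carrier carrierE by blast
  obtain S T where S: "open S" "\<phi> p \<in> S" "S \<subseteq> \<phi> ` U" "smooth_on S (\<lambda>x. h (inv_into U \<phi> x))"
    and T: "open T" "\<phi> p \<in> T" "T \<subseteq> \<phi> ` U" "smooth_on T (\<lambda>x. k (inv_into U \<phi> x))"
    using assms snear_iff[OF U] by metis
  have "smooth_on (S \<inter> T) (\<lambda>x. (h (inv_into U \<phi> x), k (inv_into U \<phi> x)))"
    using S T by (intro smooth_on_Pair) (auto intro: smooth_on_subset)
  then show ?thesis using S T unfolding snear_iff[OF U] by (intro exI[of _ "S \<inter> T"]) auto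
qed

lemma smooth_near_const [simp]: "p \<in> carrier M \<Longrightarrow> (\<lambda>q. c) \<in> smooth_near M p"
  by (erule carrierE, subst smooth_near_iff, assumption+) (use open_image in auto)

lemma smooth_near_add:
  assumes "f \<in> smooth_near M p" "g \<in> smooth_near M p" shows "(\<lambda>q. f q + g q) \<in> smooth_near M p"
proof -
  have "smooth_on UNIV (\<lambda>x. fst x + snd x :: real)"
    by (intro smooth_on_linear[OF _ _ smooth_on_id]) (auto intro!: bounded_linear_add bounded_linear_fst bounded_linear_snd)
  from snear_compose[OF snear_Pair[of p f g] this] show ?thesis using assms smooth_near_carrier by auto
qed

lemma smooth_near_mult:
  assumes "f \<in> smooth_near M p" "g \<in> smooth_near M p" shows "(\<lambda>q. f q * g q) \<in> smooth_near M p"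
proof -
  have "smooth_on UNIV (\<lambda>x. fst x * snd x :: real)"
    by (intro smooth_on_mult smooth_on_linear[OF _ _ smooth_on_id] bounded_linear_fst bounded_linear_snd open_UNIV)
  from snear_compose[OF snear_Pair[of p f g] this] show ?thesis using assms smooth_near_carrier by auto
qed

lemma smooth_near_cmult: "f \<in> smooth_near M p \<Longrightarrow> (\<lambda>q. c * f q) \<in> smooth_near M p"
  using smooth_near_mult[OF smooth_near_const] smooth_near_carrier by blast

lemma smooth_near_diff:
  "f \<in> smooth_near M p \<Longrightarrow> g \<in> smooth_near M p \<Longrightarrow> (\<lambda>q. f q - g q) \<in> smooth_near M p"
  using smooth_near_add[OF _ smooth_near_cmult, of f p g "-1"] by simp

lemma smooth_near_sum:
  "p \<in> carrier M \<Longrightarrow> (\<And>i. i \<in> I \<Longrightarrow> f i \<in> smooth_near M p) \<Longrightarrow> (\<lambda>q. \<Sum>i\<in>I. f i q) \<in> smooth_near M p"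
  by (induction I rule: infinite_finite_induct) (auto intro: smooth_near_add)

lemma smooth_fun_iff: "smooth_fun M f \<longleftrightarrow> (\<forall>p\<in>carrier M. f \<in> smooth_near M p)"
proof
  assume f: "smooth_fun M f"
  show "\<forall>p\<in>carrier M. f \<in> smooth_near M p"
  proof
    fix p assume "p \<in> carrier M"
    then obtain U \<phi> where U: "(U, \<phi>) \<in> M" "p \<in> U" using carrierE by blast
    then have "smooth_on (\<phi> ` U) (\<lambda>x. f (inv_into U \<phi> x))" using f by (auto simp: smooth_fun_def o_def)
    then show "f \<in> smooth_near M p" using U open_image unfolding smooth_near_iff[OF U] by auto
  qed
next
  assume R: "\<forall>p\<in>carrier M. f \<in> smooth_near M p"
  have "smooth_on (\<phi> ` U) (f \<circ> inv_into U \<phi>)" if U: "(U, \<phi>) \<in> M" for U \<phi>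
  proof (rule smooth_on_local)
    fix x assume "x \<in> \<phi> ` U"
    then obtain p where p: "p \<in> U" "x = \<phi> p" by auto
    then have "f \<in> smooth_near M p" using R U carrierI by blast
    then show "\<exists>T. open T \<and> x \<in> T \<and> smooth_on T (f \<circ> inv_into U \<phi>)"
      using smooth_near_iff[OF U p(1)] p(2) unfolding o_def by blast
  qed
  then show "smooth_fun M f" by (auto simp: smooth_fun_def)
qed

end

context smooth_atlas
begin

section \<open>Tangent vectors in coordinates and their action on germs\<close>

lemma smooth_near_transform:
  "f \<in> smooth_near M p \<Longrightarrow> \<forall>\<^sub>F q in nhdsin (mtop M) p. f q = g q \<Longrightarrow> g \<in> smooth_near M p"
  using smooth_near_cong[of f g p] smooth_near_carrier[of f p] by blast

lemma smooth_near_differentiable: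
  assumes "(U, \<phi>) \<in> M" "p \<in> U" "f \<in> smooth_near M p"
  shows "(\<lambda>x. f (inv_into U \<phi> x)) differentiable (at (\<phi> p))"
  using assms smooth_near_iff smooth_on_differentiable by metis

lemma chart_vector_add:
  assumes "(U, \<phi>) \<in> M" "p \<in> U"
  shows "chart_vector M U \<phi> p (v + w) = chart_vector M U \<phi> p v + chart_vector M U \<phi> p w"
  using linear_add[OF linear_frechet_derivative[OF smooth_near_differentiable[OF assms]]]
  by (auto simp: chart_vector_def fun_eq_iff)

lemma chart_vector_scale:
  assumes "(U, \<phi>) \<in> M" "p \<in> U"
  shows "chart_vector M U \<phi> p (c *\<^sub>R v) = vscale c (chart_vector M U \<phi> p v)"
  using linear_scale[OF linear_frechet_derivative[OF smooth_near_differentiable[OF assms]]]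
  by (auto simp: chart_vector_def fun_eq_iff vscale_def)

lemma chart_vector_coordinate:
  assumes "(U, \<phi>) \<in> M" "p \<in> U" "b \<in> Basis"
  shows "chart_vector M U \<phi> p w (\<lambda>q. \<phi> q \<bullet> b) = w \<bullet> b"
proof -
  have "((\<lambda>x. x \<bullet> b) has_derivative (\<lambda>v. v \<bullet> b)) (at (\<phi> p))" by (auto intro!: derivative_eq_intros)
  then have "((\<lambda>x. \<phi> (inv_into U \<phi> x) \<bullet> b) has_derivative (\<lambda>v. v \<bullet> b)) (at (\<phi> p))"
    by (rule has_derivative_transform_within_open[OF _ open_image[OF assms(1)]]) (use assms in auto)
  from fun_cong[OF frechet_derivative_at[OF this], of w] show ?thesis
    using chart_coordinate[OF assms] by (simp add: chart_vector_def)
qed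

lemma components_chart_vector:
  assumes "(U, \<phi>) \<in> M" "p \<in> U"
  shows "chart_components \<phi> (chart_vector M U \<phi> p w) = w"
  using chart_vector_coordinate[OF assms] by (simp add: chart_components_def euclidean_representation)

text \<open>The chain rule for the transition map: its derivative transforms the components.\<close>

lemma chart_vector_change:
  assumes U: "(U, \<phi>) \<in> M" "p \<in> U" and V: "(V, \<psi>) \<in> M" "p \<in> V"
  shows "chart_vector M V \<psi> p w =
    chart_vector M U \<phi> p (\<D> (\<lambda>y. \<phi> (inv_into V \<psi> y)) (\<psi> p) w)"
proof (rule ext)
  fix f
  show "chart_vector M V \<psi> p w f =
    chart_vector M U \<phi> p (\<D> (\<lambda>y. \<phi> (inv_into V \<psi> y)) (\<psi> p) w) f"
  proof (cases "f \<in> smooth_near M p")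
    case True
    let ?\<tau> = "\<lambda>y. \<phi> (inv_into V \<psi> y)"
    have O: "open (\<psi> ` (V \<inter> U))" "\<psi> p \<in> \<psi> ` (V \<inter> U)" using open_overlap U V by auto
    have \<tau>: "(?\<tau> has_derivative \<D> ?\<tau> (\<psi> p)) (at (\<psi> p))"
      by (rule smooth_on_has_derivative[OF smooth_transition[OF V(1) U(1)] O(2)])
    have "((\<lambda>x. f (inv_into U \<phi> x)) has_derivative \<D> (\<lambda>x. f (inv_into U \<phi> x)) (\<phi> p)) (at (?\<tau> (\<psi> p)))"
      using iffD1[OF frechet_derivative_works smooth_near_differentiable[OF U True]] V by simp
    from has_derivative_compose[OF \<tau> this]
    have "((\<lambda>y. f (inv_into V \<psi> y)) has_derivative (\<lambda>w. \<D> (\<lambda>x. f (inv_into U \<phi> x)) (\<phi> p) (\<D> ?\<tau> (\<psi> p) w))) (at (\<psi> p))"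
      by (rule has_derivative_transform_within_open[OF _ O]) (use U V in auto)
    from fun_cong[OF frechet_derivative_at[OF this], of w] True show ?thesis by (simp add: chart_vector_def)
  qed (simp add: chart_vector_def)
qed

text \<open>In \<open>tangent_space\<close> the chart may vary with the vector. By the change of
  charts one fixed chart at \<open>p\<close> already produces all tangent vectors.\<close>

lemma tangent_space_chart:
  assumes "(U, \<phi>) \<in> M" "p \<in> U"
  shows "tangent_space M p = range (chart_vector M U \<phi> p)"
proof -
  have "v \<in> tangent_space M p \<longleftrightarrow> (\<exists>(V, \<psi>)\<in>M. p \<in> V \<and> (\<exists>w. v = chart_vector M V \<psi> p w))" for v
    unfolding tangent_space_def chart_vector_def o_def by simp
  moreover have "chart_vector M V \<psi> p w \<in> range (chart_vector M U \<phi> p)" if "(V, \<psi>) \<in> M" "p \<in> V" for V \<psi> w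
    unfolding chart_vector_change[OF assms that] by blast
  ultimately have "v \<in> tangent_space M p \<longleftrightarrow> v \<in> range (chart_vector M U \<phi> p)" for v
    using assms by fastforce
  then show ?thesis by blast
qed

lemma chart_vector_in: "(U, \<phi>) \<in> M \<Longrightarrow> p \<in> U \<Longrightarrow> chart_vector M U \<phi> p w \<in> tangent_space M p"
  using tangent_space_chart by blast

lemma chart_vector_components:
  "\<lbrakk>(U, \<phi>) \<in> M; p \<in> U; v \<in> tangent_space M p\<rbrakk> \<Longrightarrow>
      chart_vector M U \<phi> p (chart_components \<phi> v) = v"
  using tangent_space_chart components_chart_vector by fastforce

lemma tangent_apply:
  "\<lbrakk>(U, \<phi>) \<in> M; p \<in> U; v \<in> tangent_space M p; f \<in> smooth_near M p\<rbrakk> \<Longrightarrow>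
      v f = \<D> (\<lambda>x. f (inv_into U \<phi> x)) (\<phi> p) (chart_components \<phi> v)"
  using chart_vector_components[of U \<phi> p v] by (metis chart_vector_def)

lemma tangent_apply_eq0: "\<lbrakk>p \<in> carrier M; v \<in> tangent_space M p; f \<notin> smooth_near M p\<rbrakk> \<Longrightarrow>
      v f = 0"
  by (erule carrierE) (metis chart_vector_components chart_vector_def)

lemma tangent_eqI:
  assumes "(U, \<phi>) \<in> M" "p \<in> U" "v \<in> tangent_space M p" "w \<in> tangent_space M p"
    and "\<And>b. b \<in> Basis \<Longrightarrow> v (\<lambda>q. \<phi> q \<bullet> b) = w (\<lambda>q. \<phi> q \<bullet> b)"
  shows "v = w"
proof -
  have "chart_components \<phi> v = chart_components \<phi> w" using assms(5) by (simp add: chart_components_def)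
  then show ?thesis using chart_vector_components[OF assms(1,2)] assms(3,4) by metis
qed

context
  fixes p assumes p: "p \<in> carrier M"
begin

lemma tangent_0 [simp]: "0 \<in> tangent_space M p"
proof -
  obtain U \<phi> where U: "(U, \<phi>) \<in> M" "p \<in> U" using p carrierE by blast
  have "chart_vector M U \<phi> p (0 *\<^sub>R 0) = 0"
    unfolding chart_vector_scale[OF U] by (simp add: vscale_def fun_eq_iff)
  then show ?thesis using chart_vector_in[OF U] by metis
qed

lemma tangent_add [intro]: "v \<in> tangent_space M p \<Longrightarrow> w \<in> tangent_space M p \<Longrightarrow> v + w \<in> tangent_space M p"
  using p by (elim carrierE) (metis chart_vector_add chart_vector_components chart_vector_in)

lemma tangent_vscale [intro]: "v \<in> tangent_space M p \<Longrightarrow> vscale c v \<in> tangent_space M p"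
  using p by (elim carrierE) (metis chart_vector_scale chart_vector_components chart_vector_in)

lemma tangent_apply_add:
  assumes "v \<in> tangent_space M p" "f \<in> smooth_near M p" "g \<in> smooth_near M p"
  shows "v (\<lambda>q. f q + g q) = v f + v g"
proof -
  obtain U \<phi> where U: "(U, \<phi>) \<in> M" "p \<in> U" using p carrierE by blast
  note [simp] = tangent_apply[OF U assms(1)]
  show ?thesis using assms(2,3) smooth_near_add[OF assms(2,3)]
    fun_cong[OF frechet_derivative_at[OF has_derivative_add[OF
      smooth_near_differentiable[OF U assms(2), unfolded frechet_derivative_works]
      smooth_near_differentiable[OF U assms(3), unfolded frechet_derivative_works]]],
      of "chart_components \<phi> v"]
    by simp
qed

lemma tangent_apply_mult:
  assumes "v \<in> tangent_space M p" "f \<in> smooth_near M p" "g \<in> smooth_near M p"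
  shows "v (\<lambda>q. f q * g q) = f p * v g + v f * g p"
proof -
  obtain U \<phi> where U: "(U, \<phi>) \<in> M" "p \<in> U" using p carrierE by blast
  note [simp] = tangent_apply[OF U assms(1)]
  show ?thesis using assms(2,3) smooth_near_mult[OF assms(2,3)] U
    fun_cong[OF frechet_derivative_at[OF has_derivative_mult[OF
      smooth_near_differentiable[OF U assms(2), unfolded frechet_derivative_works]
      smooth_near_differentiable[OF U assms(3), unfolded frechet_derivative_works]]],
      of "chart_components \<phi> v"]
    by simp
qed

lemma tangent_apply_const [simp]: "v \<in> tangent_space M p \<Longrightarrow> v (\<lambda>q. c) = 0"
  using p by (elim carrierE) (simp add: tangent_apply[OF _ _ _ smooth_near_const[OF p]])

lemma tangent_apply_cmult:
  "v \<in> tangent_space M p \<Longrightarrow> f \<in> smooth_near M p \<Longrightarrow> v (\<lambda>q. c * f q) = c * v f"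
  using tangent_apply_mult[of v "\<lambda>q. c" f] p by simp

lemma tangent_apply_diff:
  "\<lbrakk>v \<in> tangent_space M p; f \<in> smooth_near M p; g \<in> smooth_near M p\<rbrakk> \<Longrightarrow>
      v (\<lambda>q. f q - g q) = v f - v g"
  using tangent_apply_add[of v f "\<lambda>q. -1 * g q"] tangent_apply_cmult[of v g "-1"]
    smooth_near_cmult[of g p "-1"] by simp

lemma tangent_apply_sum:
  "v \<in> tangent_space M p \<Longrightarrow> (\<And>i. i \<in> I \<Longrightarrow> f i \<in> smooth_near M p) \<Longrightarrow>
    v (\<lambda>q. \<Sum>i\<in>I. f i q) = (\<Sum>i\<in>I. v (f i))"
  by (induction I rule: infinite_finite_induct)
     (simp_all add: tangent_apply_add[of v "f _" "\<lambda>q. \<Sum>i\<in>_. f i q"] smooth_near_sum p)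

text \<open>Used whenever an operator expression agrees with another only near \<open>p\<close>, in
  particular to discard default values away from \<open>p\<close>.\<close>

lemma tangent_apply_cong:
  assumes "v \<in> tangent_space M p" "\<forall>\<^sub>F q in nhdsin (mtop M) p. f q = g q"
  shows "v f = v g"
proof (cases "f \<in> smooth_near M p")
  case True
  obtain U \<phi> where U: "(U, \<phi>) \<in> M" "p \<in> U" using p carrierE by blast
  obtain S where S: "open S" "\<phi> p \<in> S" "\<And>x. x \<in> S \<Longrightarrow> f (inv_into U \<phi> x) = g (inv_into U \<phi> x)"
    using assms(2) eventually_chart[OF U] by (auto simp: eventually_nhds)
  have "\<D> (\<lambda>x. f (inv_into U \<phi> x)) (\<phi> p) = \<D> (\<lambda>x. g (inv_into U \<phi> x)) (\<phi> p)"
    by (rule frechet_derivative_transform_within_open[OF smooth_near_differentiable[OF U True] S(1,2)]) (rule S(3))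
  moreover have "g \<in> smooth_near M p" using True smooth_near_cong[OF assms(2) p] by blast
  ultimately show ?thesis using True by (simp add: tangent_apply[OF U assms(1)])
next
  \<comment> \<open>Smoothness at \<open>p\<close> depends on the germ as well, so here both sides
    take the default value 0.\<close>
  case False
  then show ?thesis using smooth_near_cong[OF assms(2) p] assms(1) p tangent_apply_eq0 by metis
qed

text \<open>The chain rule through a vector-valued \<open>h\<close>. With \<open>h\<close> a
  coordinate map it computes how a tangent vector acts on a function known in coordinates.\<close>

lemma tangent_apply_compose:
  fixes h :: "'a \<Rightarrow> 'f::euclidean_space" and G :: "'f \<Rightarrow> real"
  assumes "v \<in> tangent_space M p" "snear p h" "G differentiable (at (h p))" "(\<lambda>q. G (h q)) \<in> smooth_near M p"
  shows "v (\<lambda>q. G (h q)) = \<D> G (h p) (\<Sum>b\<in>Basis. v (\<lambda>q. h q \<bullet> b) *\<^sub>R b)"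
proof -
  obtain U \<phi> where U: "(U, \<phi>) \<in> M" "p \<in> U" using p carrierE by blast
  obtain S where S: "open S" "\<phi> p \<in> S" "S \<subseteq> \<phi> ` U" "smooth_on S (\<lambda>x. h (inv_into U \<phi> x))"
    using assms(2) snear_iff[OF U] by blast
  note h' = smooth_on_has_derivative[OF S(4,2)]
  let ?h' = "\<D> (\<lambda>x. h (inv_into U \<phi> x)) (\<phi> p)"
  let ?w = "chart_components \<phi> v"
  have "(\<Sum>b\<in>Basis. v (\<lambda>q. h q \<bullet> b) *\<^sub>R b) = (\<Sum>b\<in>Basis. (?h' ?w \<bullet> b) *\<^sub>R b)"
  proof (intro sum.cong refl arg_cong2[where f="(*\<^sub>R)"])
    fix b :: 'f assume "b \<in> Basis"
    then have "v (\<lambda>q. h q \<bullet> b) = \<D> (\<lambda>x. h (inv_into U \<phi> x) \<bullet> b) (\<phi> p) ?w"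
      using assms(2) by (intro tangent_apply[OF U assms(1)]) (auto simp: snear_def)
    then show "v (\<lambda>q. h q \<bullet> b) = ?h' ?w \<bullet> b"
      using fun_cong[OF frechet_derivative_at[OF has_derivative_inner_left[OF h', of b]], of ?w] by simp
  qed
  then have c: "(\<Sum>b\<in>Basis. v (\<lambda>q. h q \<bullet> b) *\<^sub>R b) = ?h' ?w" by (simp add: euclidean_representation)
  have "(G has_derivative \<D> G (h p)) (at (h (inv_into U \<phi> (\<phi> p))))"
    using iffD1[OF frechet_derivative_works assms(3)] U by simp
  from has_derivative_compose[OF h' this] tangent_apply[OF U assms(1,4)]
  show ?thesis unfolding c using frechet_derivative_at by metis
qed

end

lemma tangent_apply_smooth_compose:
  fixes h :: "'a \<Rightarrow> 'f::euclidean_space" and G :: "'f \<Rightarrow> real"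
  assumes "p \<in> carrier M" "v \<in> tangent_space M p" "snear p h" "smooth_on T G" "open T" "h p \<in> T"
  shows "v (\<lambda>q. G (h q)) = \<D> G (h p) (\<Sum>b\<in>Basis. v (\<lambda>q. h q \<bullet> b) *\<^sub>R b)"
  using snear_compose[OF assms(3-6,1)] assms
  by (intro tangent_apply_compose) (auto intro: smooth_on_differentiable)

end

subsection \<open>Vector fields along maps\<close>

text \<open>The fields along the identity are the vector fields, and those along the projection of the slit
  bundle are the \<open>\<pi>\<close>-vector fields.\<close>

locale smooth_atlas_map = N: smooth_atlas N + M: smooth_atlas M
  for N :: "('b, 'd::euclidean_space) atlas" and M :: "('a, 'e::euclidean_space) atlas" +
  fixes F :: "'b \<Rightarrow> 'a"
  assumes F_carrier: "u \<in> carrier N \<Longrightarrow> F u \<in> carrier M"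
    and F_continuous: "u \<in> carrier N \<Longrightarrow> eventually P (nhdsin (mtop M) (F u)) \<Longrightarrow>
      \<forall>\<^sub>F u' in nhdsin (mtop N) u. P (F u')"
    and F_smooth: "u \<in> carrier N \<Longrightarrow> f \<in> smooth_near M (F u) \<Longrightarrow> (\<lambda>u. f (F u)) \<in> smooth_near N u"
begin

text \<open>Smoothness is tested on germs of functions, which suits sums, multiples and brackets;
  \<open>smooth_map_tangent_bundle_iff\<close> identifies it with smoothness as a map into the
  tangent bundle.\<close>

definition field_along :: "('b \<Rightarrow> 'a tvec) \<Rightarrow> bool" where
  "field_along Y \<longleftrightarrow> (\<forall>u\<in>carrier N. Y u \<in> tangent_space M (F u) \<and>
     (\<forall>f\<in>smooth_near M (F u). (\<lambda>u. Y u f) \<in> smooth_near N u))"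

lemma F_chart: "\<lbrakk>u \<in> carrier N; (V, \<psi>) \<in> M; F u \<in> V\<rbrakk> \<Longrightarrow>
      N.snear u (\<lambda>u. \<psi> (F u))"
  unfolding N.snear_def using F_smooth M.chart_coordinate by blast

lemma eventually_F_chart: "\<lbrakk>u \<in> carrier N; (V, \<psi>) \<in> M; F u \<in> V\<rbrakk> \<Longrightarrow>
      \<forall>\<^sub>F u in nhdsin (mtop N) u. F u \<in> V"
  by (rule F_continuous[OF _ M.eventually_in_chart])

text \<open>Near \<open>u\<close> the value \<open>Y u f\<close> is the derivative of
  \<open>f\<close> in the chart, and this is a jointly smooth function of base point and direction,
  evaluated at smooth arguments.\<close>

lemma apply_smooth_near:
  assumes u: "u \<in> carrier N" and V: "(V, \<psi>) \<in> M" "F u \<in> V"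
    and Y: "\<And>u. u \<in> carrier N \<Longrightarrow> Y u \<in> tangent_space M (F u)"
    and sm: "N.snear u (\<lambda>u. chart_components \<psi> (Y u))"
    and f: "f \<in> smooth_near M (F u)"
  shows "(\<lambda>u. Y u f) \<in> smooth_near N u"
proof -
  let ?f = "\<lambda>x. f (inv_into V \<psi> x)"
  obtain S where S: "open S" "\<psi> (F u) \<in> S" "S \<subseteq> \<psi> ` V" "smooth_on S ?f"
    using f M.smooth_near_iff[OF V] by blast
  have "smooth_on (S \<times> UNIV) (\<lambda>z. \<D> ?f (fst z) (snd z))"
  proof -
    have o: "open (S \<times> (UNIV :: 'e set))" using S(1) by (intro open_Times) auto
    have i: "smooth_on (S \<times> (UNIV :: 'e set)) (\<lambda>z. z)" by (rule smooth_on_id[OF o])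
    have "smooth_on (S \<times> UNIV) (\<lambda>z. \<Sum>b\<in>Basis. (snd z \<bullet> b) *\<^sub>R \<D> ?f (fst z) b)"
      by (intro smooth_on_sum[OF o] smooth_on_scaleR[OF o] smooth_on_inner[OF o]
          smooth_on_linear[OF o bounded_linear_snd i]
          smooth_on_compose[OF o smooth_on_deriv[OF S(4)] smooth_on_linear[OF o bounded_linear_fst i]]) auto
    then show ?thesis
    proof (rule smooth_on_transform[OF _ o])
      fix z :: "'e \<times> 'e" assume "z \<in> S \<times> UNIV"
      then show "(\<Sum>b\<in>Basis. (snd z \<bullet> b) *\<^sub>R \<D> ?f (fst z) b) = \<D> ?f (fst z) (snd z)"
        by (intro frechet_derivative_expand[symmetric] smooth_on_differentiable[OF S(4)]) auto
    qed
  qed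
  from N.snear_compose[OF N.snear_Pair[OF F_chart[OF u V] sm] this]
  have "(\<lambda>u. \<D> ?f (\<psi> (F u)) (chart_components \<psi> (Y u))) \<in> smooth_near N u"
    using S(1,2) u by (auto simp: open_Times)
  moreover have "\<forall>\<^sub>F u in nhdsin (mtop N) u. \<D> ?f (\<psi> (F u)) (chart_components \<psi> (Y u)) = Y u f"
    using N.eventually_carrier[of u] eventually_F_chart[OF u V] F_continuous[OF u M.smooth_near_eventually[OF f]]
  proof eventually_elim
    case (elim u)
    then show ?case using M.tangent_apply[OF V(1) _ Y] by simp
  qed
  ultimately show ?thesis by (rule N.smooth_near_transform)
qed

lemma field_alongI:
  assumes "\<And>u. u \<in> carrier N \<Longrightarrow> Y u \<in> tangent_space M (F u)"
    and "\<And>u. u \<in> carrier N \<Longrightarrow> \<exists>V \<psi>. (V, \<psi>) \<in> M \<and> F u \<in> V \<and> (\<forall>b\<in>Basis. (\<lambda>u. Y u (\<lambda>q. \<psi> q \<bullet> b)) \<in> smooth_near N u)"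
  shows "field_along Y"
  unfolding field_along_def
proof (intro ballI conjI)
  fix u f assume u: "u \<in> carrier N" and f: "f \<in> smooth_near M (F u)"
  obtain V \<psi> where V: "(V, \<psi>) \<in> M" "F u \<in> V" and b: "\<forall>b\<in>Basis. (\<lambda>u. Y u (\<lambda>q. \<psi> q \<bullet> b)) \<in> smooth_near N u"
    using assms(2)[OF u] by blast
  have "N.snear u (\<lambda>u. chart_components \<psi> (Y u))" using b by (simp add: N.snear_def chart_components_inner)
  from apply_smooth_near[OF u V assms(1) this f] show "(\<lambda>u. Y u f) \<in> smooth_near N u" .
qed (rule assms(1))

lemma field_along_components:
  assumes "field_along Y" "u \<in> carrier N" "(V, \<psi>) \<in> M" "F u \<in> V"
  shows "N.snear u (\<lambda>u. chart_components \<psi> (Y u))"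
  using assms M.chart_coordinate by (fastforce simp: N.snear_def chart_components_inner field_along_def)

lemma smooth_map_tangent_bundle_iff:
  "smooth_map N (tangent_bundle M) (\<lambda>u. (F u, Y u)) \<longleftrightarrow> field_along Y"
proof
  assume L: "smooth_map N (tangent_bundle M) (\<lambda>u. (F u, Y u))"
  have Yt: "Y u \<in> tangent_space M (F u)" if "u \<in> carrier N" for u
    using L that by (fastforce simp: smooth_map_def tangent_bundle_def carrier_def)
  show "field_along Y"
  proof (rule field_alongI)
    fix u assume u: "u \<in> carrier N"
    obtain U \<phi> where U: "(U, \<phi>) \<in> N" "u \<in> U" using u N.carrierE by blast
    obtain V \<psi> where V: "(V, \<psi>) \<in> M" "F u \<in> V" using F_carrier[OF u] M.carrierE by blast
    let ?\<Psi> = "\<lambda>(p, v). (\<psi> p, chart_components \<psi> v)"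
    let ?S = "\<phi> ` (U \<inter> (\<lambda>u. (F u, Y u)) -` Sigma V (tangent_space M))"
    have "(Sigma V (tangent_space M), ?\<Psi>) \<in> tangent_bundle M"
      using V(1) by (auto simp: tangent_bundle_def chart_components_def intro!: image_eqI[of _ _ "(V, \<psi>)"])
    then have S: "open ?S" "smooth_on ?S (?\<Psi> \<circ> (\<lambda>u. (F u, Y u)) \<circ> inv_into U \<phi>)"
      using L U(1) by (auto simp: smooth_map_def)
    then have "smooth_on ?S (\<lambda>x. snd (\<psi> (F (inv_into U \<phi> x)), chart_components \<psi> (Y (inv_into U \<phi> x))))"
      by (intro smooth_on_linear[OF S(1) bounded_linear_snd]) (simp add: o_def)
    moreover have "\<phi> u \<in> ?S" using U V Yt[OF u] by auto
    ultimately have "N.snear u (\<lambda>u. chart_components \<psi> (Y u))"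
      using S(1) unfolding N.snear_iff[OF U] by (intro exI[of _ ?S]) auto
    then show "\<exists>V \<psi>. (V, \<psi>) \<in> M \<and> F u \<in> V \<and> (\<forall>b\<in>Basis. (\<lambda>u. Y u (\<lambda>q. \<psi> q \<bullet> b)) \<in> smooth_near N u)"
      using V by (intro exI[of _ V] exI[of _ \<psi>]) (simp add: N.snear_def chart_components_inner)
  qed (rule Yt)
next
  assume R: "field_along Y"
  have "open (\<phi> ` (U \<inter> (\<lambda>u. (F u, Y u)) -` W)) \<and> smooth_on (\<phi> ` (U \<inter> (\<lambda>u. (F u, Y u)) -` W)) (\<Psi> \<circ> (\<lambda>u. (F u, Y u)) \<circ> inv_into U \<phi>)"
    if U: "(U, \<phi>) \<in> N" and W: "(W, \<Psi>) \<in> tangent_bundle M" for U \<phi> W \<Psi>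
  proof -
    obtain V \<psi> where V: "(V, \<psi>) \<in> M" "W = Sigma V (tangent_space M)" "\<Psi> = (\<lambda>(p, v). (\<psi> p, chart_components \<psi> v))"
      using W by (auto simp: tangent_bundle_def chart_components_def)
    let ?S = "\<phi> ` (U \<inter> (\<lambda>u. (F u, Y u)) -` W)"
    \<comment> \<open>\<open>smooth_map\<close> also demands an open domain for each pair of charts.
      Openness and smoothness are both local, and one neighbourhood serves for both.\<close>
    have loc: "\<exists>S. open S \<and> x \<in> S \<and> S \<subseteq> ?S \<and> smooth_on S (\<Psi> \<circ> (\<lambda>u. (F u, Y u)) \<circ> inv_into U \<phi>)" if x: "x \<in> ?S" for x
    proof -
      obtain u where u: "u \<in> U" "F u \<in> V" "x = \<phi> u" using x V(2) by blast
      have uN: "u \<in> carrier N" using u U N.carrierI by blast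
      have "N.snear u (\<lambda>u. (\<psi> (F u), chart_components \<psi> (Y u)))"
        by (intro N.snear_Pair F_chart[OF uN V(1) u(2)] field_along_components[OF R uN V(1) u(2)])
      then obtain S where S: "open S" "\<phi> u \<in> S" "S \<subseteq> \<phi> ` U" "smooth_on S (\<lambda>x. (\<psi> (F (inv_into U \<phi> x)), chart_components \<psi> (Y (inv_into U \<phi> x))))"
        unfolding N.snear_iff[OF U u(1)] by blast
      obtain S' where S': "open S'" "\<phi> u \<in> S'" "\<forall>x\<in>S'. F (inv_into U \<phi> x) \<in> V"
        using eventually_F_chart[OF uN V(1) u(2)] unfolding N.eventually_chart[OF U u(1)] eventually_nhds by blast
      have "S \<inter> S' \<subseteq> ?S"
      proof
        fix y assume y: "y \<in> S \<inter> S'"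
        then obtain q where q: "q \<in> U" "y = \<phi> q" using S(3) by blast
        then have "F q \<in> V" "Y q \<in> tangent_space M (F q)" using S'(3) y U R N.carrierI by (fastforce simp: field_along_def)+
        then show "y \<in> ?S" using q V(2) by auto
      qed
      moreover have "smooth_on (S \<inter> S') (\<Psi> \<circ> (\<lambda>u. (F u, Y u)) \<circ> inv_into U \<phi>)"
        using smooth_on_subset[OF S(4), of "S \<inter> S'"] by (simp add: V(3) o_def)
      ultimately show ?thesis using S(1,2) S'(1,2) unfolding u(3)
        by (intro exI[of _ "S \<inter> S'"] conjI open_Int IntI)
    qed
    have "open ?S" by (subst open_subopen) (use loc in meson)
    moreover have "smooth_on ?S (\<Psi> \<circ> (\<lambda>u. (F u, Y u)) \<circ> inv_into U \<phi>)"
      by (rule smooth_on_local) (use loc in blast)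
    ultimately show ?thesis by blast
  qed
  moreover have "(F u, Y u) \<in> carrier (tangent_bundle M)" if u: "u \<in> carrier N" for u
  proof -
    obtain V \<psi> where V: "(V, \<psi>) \<in> M" "F u \<in> V" using F_carrier[OF u] M.carrierE by blast
    then show ?thesis using R u
      by (auto simp: carrier_def tangent_bundle_def field_along_def intro!: bexI[of _ "(V, \<psi>)"])
  qed
  ultimately show "smooth_map N (tangent_bundle M) (\<lambda>u. (F u, Y u))"
    unfolding smooth_map_def by auto
qed

lemma field_along_add:
  assumes "field_along Y" "field_along Z" shows "field_along (Y + Z)"
  using assms F_carrier by (auto simp: field_along_def intro: N.smooth_near_add)

lemma field_along_fscale:
  assumes "field_along Y" "\<And>u. u \<in> carrier N \<Longrightarrow> f \<in> smooth_near N u"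
  shows "field_along (\<lambda>u. vscale (f u) (Y u))"
  using assms F_carrier by (auto simp: field_along_def intro: N.smooth_near_mult) (simp add: vscale_def N.smooth_near_mult)

lemma field_along_uminus:
  assumes "field_along Y" shows "field_along (- Y)"
  using field_along_fscale[OF assms, of "\<lambda>_. -1"] by (simp add: vscale_def fun_Compl_def)

lemma field_along_diff:
  assumes "field_along Y" "field_along Z" shows "field_along (Y - Z)"
  using field_along_add[OF assms(1) field_along_uminus[OF assms(2)]] by simp

text \<open>The carrier is open, so changing values outside it changes no germ at its
  points.\<close>

lemma field_along_cong:
  assumes "field_along Y" "\<And>u. u \<in> carrier N \<Longrightarrow> Y u = Z u" shows "field_along Z"
  unfolding field_along_def
proof (intro ballI conjI)
  fix u assume u: "u \<in> carrier N"
  then show "Z u \<in> tangent_space M (F u)" using assms(1) unfolding field_along_def assms(2)[OF u, symmetric] by blast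
  fix f assume "f \<in> smooth_near M (F u)"
  then have "(\<lambda>u. Y u f) \<in> smooth_near N u" using assms(1) u by (auto simp: field_along_def)
  moreover have "\<forall>\<^sub>F u in nhdsin (mtop N) u. Y u f = Z u f"
    using N.eventually_carrier[of u] by eventually_elim (simp add: assms(2))
  ultimately show "(\<lambda>u. Z u f) \<in> smooth_near N u" by (rule N.smooth_near_transform)
qed

end

subsection \<open>The Lie bracket and the slit tangent bundle\<close>

context smooth_atlas
begin

section \<open>Vector fields and their brackets\<close>

lemma smooth_atlas_map_id: "smooth_atlas_map M M (\<lambda>p. p)"
  by unfold_locales auto

lemma vector_field_iff:
  "vector_field M A \<longleftrightarrow> (\<forall>p\<in>carrier M. A p \<in> tangent_space M p \<and>
     (\<forall>f\<in>smooth_near M p. (\<lambda>q. A q f) \<in> smooth_near M p))"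
  using smooth_atlas_map.smooth_map_tangent_bundle_iff[OF smooth_atlas_map_id]
    smooth_atlas_map.field_along_def[OF smooth_atlas_map_id]
  by (simp add: vector_field_def)

lemma vector_field_tangent: "vector_field M A \<Longrightarrow> p \<in> carrier M \<Longrightarrow> A p \<in> tangent_space M p"
  by (simp add: vector_field_iff)

lemma vector_field_smooth: "vector_field M A \<Longrightarrow> f \<in> smooth_near M p \<Longrightarrow> (\<lambda>q. A q f) \<in> smooth_near M p"
  using smooth_near_carrier by (auto simp: vector_field_iff)

lemma vector_field_components:
  "\<lbrakk>vector_field M A; (U, \<phi>) \<in> M; p \<in> U\<rbrakk> \<Longrightarrow>
      snear p (\<lambda>q. chart_components \<phi> (A q))"
  using chart_coordinate vector_field_smooth by (auto simp: snear_def chart_components_inner)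

text \<open>Near \<open>p\<close> the function \<open>B q f\<close> is the derivative of
  \<open>f\<close> along the components of \<open>B\<close>, to which
  \<open>frechet_derivative_deriv_field\<close> applies.\<close>

lemma apply_apply:
  assumes A: "vector_field M A" and B: "vector_field M B" and U: "(U, \<phi>) \<in> M" "p \<in> U"
    and f: "f \<in> smooth_near M p"
  defines "f' \<equiv> \<lambda>x. f (inv_into U \<phi> x)"
  shows "A p (\<lambda>q. B q f) =
    \<D> (\<lambda>x. \<D> f' x (chart_components \<phi> (A p))) (\<phi> p) (chart_components \<phi> (B p)) +
    \<D> f' (\<phi> p) (\<D> (\<lambda>x. chart_components \<phi> (B (inv_into U \<phi> x))) (\<phi> p) (chart_components \<phi> (A p)))"
proof -
  let ?B = "\<lambda>x. chart_components \<phi> (B (inv_into U \<phi> x))"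
  have p: "p \<in> carrier M" using U carrierI by blast
  obtain S where S: "open S" "\<phi> p \<in> S" "S \<subseteq> \<phi> ` U" "smooth_on S f'"
    using f smooth_near_iff[OF U] unfolding f'_def by blast
  obtain T where T: "open T" "\<phi> p \<in> T" "smooth_on T ?B"
    using vector_field_components[OF B U] snear_iff[OF U, of "\<lambda>q. chart_components \<phi> (B q)"] by blast
  \<comment> \<open>\<open>f\<close> has to be smooth around the neighbouring points too, since
    otherwise \<open>B q f\<close> could be the default value.\<close>
  obtain R where R: "open R" "\<phi> p \<in> R" "\<forall>x\<in>R. f \<in> smooth_near M (inv_into U \<phi> x)"
    using smooth_near_eventually[OF f] unfolding eventually_chart[OF U] eventually_nhds by blast
  let ?S = "S \<inter> T \<inter> R"
  have o: "open ?S" "\<phi> p \<in> ?S" using S T R by auto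
  have Bf: "B (inv_into U \<phi> x) f = \<D> f' x (?B x)" if x: "x \<in> ?S" for x
  proof -
    obtain q where q: "q \<in> U" "x = \<phi> q" using x S(3) by blast
    then have "q \<in> carrier M" using U(1) carrierI by blast
    moreover have "f \<in> smooth_near M q" using R(3) x q U(1) by fastforce
    ultimately show ?thesis
      using tangent_apply[OF U(1) q(1) vector_field_tangent[OF B], of f] q U(1) by (simp add: f'_def)
  qed
  have "A p (\<lambda>q. B q f) = \<D> (\<lambda>x. B (inv_into U \<phi> x) f) (\<phi> p) (chart_components \<phi> (A p))"
    by (rule tangent_apply[OF U vector_field_tangent[OF A p] vector_field_smooth[OF B f]])
  also have "\<D> (\<lambda>x. B (inv_into U \<phi> x) f) (\<phi> p) = \<D> (\<lambda>x. \<D> f' x (?B x)) (\<phi> p)"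
    by (rule frechet_derivative_transform_within_open[OF smooth_near_differentiable[OF U vector_field_smooth[OF B f]] o Bf])
  also have "\<dots> (chart_components \<phi> (A p)) =
    \<D> (\<lambda>x. \<D> f' x (chart_components \<phi> (A p))) (\<phi> p) (?B (\<phi> p)) +
    \<D> f' (\<phi> p) (\<D> ?B (\<phi> p) (chart_components \<phi> (A p)))"
    by (rule frechet_derivative_deriv_field[OF o(1) smooth_on_subset[OF S(4)] smooth_on_subset[OF T(3)] o(2)]) auto
  finally show ?thesis using U by simp
qed

text \<open>The second derivatives of \<open>f\<close> cancel in the commutator. What is left is
  first order, with components \<open>DB(A) - DA(B)\<close>.\<close>

lemma lie_bracket_tangent:
  assumes A: "vector_field M A" and B: "vector_field M B" and p: "p \<in> carrier M"
  shows "lie_bracket M A B p \<in> tangent_space M p"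
proof -
  obtain U \<phi> where U: "(U, \<phi>) \<in> M" "p \<in> U" using p carrierE by blast
  let ?c = "\<lambda>A x. chart_components \<phi> (A (inv_into U \<phi> x))"
  let ?w = "\<D> (?c B) (\<phi> p) (chart_components \<phi> (A p)) - \<D> (?c A) (\<phi> p) (chart_components \<phi> (B p))"
  have "lie_bracket M A B p = chart_vector M U \<phi> p ?w"
  proof
    fix f
    show "lie_bracket M A B p f = chart_vector M U \<phi> p ?w f"
    proof (cases "f \<in> smooth_near M p")
      case True
      let ?f = "\<lambda>x. f (inv_into U \<phi> x)"
      obtain S where S: "open S" "\<phi> p \<in> S" "smooth_on S ?f"
        using True smooth_near_iff[OF U] by blast
      show ?thesis using True
        linear_diff[OF linear_frechet_derivative[OF smooth_near_differentiable[OF U True]]]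
        by (simp add: lie_bracket_def chart_vector_def apply_apply[OF A B U True] apply_apply[OF B A U True]
            second_derivative_symmetric[OF S(1,3,2), of "chart_components \<phi> (A p)" "chart_components \<phi> (B p)"])
    qed (simp add: lie_bracket_def chart_vector_def)
  qed
  then show ?thesis using chart_vector_in[OF U] by simp
qed

lemma lie_bracket_apply:
  "f \<in> smooth_near M p \<Longrightarrow> lie_bracket M A B p f = A p (\<lambda>q. B q f) - B p (\<lambda>q. A q f)"
  by (simp add: lie_bracket_def)

lemma lie_bracket_eventually:
  "f \<in> smooth_near M p \<Longrightarrow>
    \<forall>\<^sub>F q in nhdsin (mtop M) p. A q (\<lambda>q. B q f) - B q (\<lambda>q. A q f) = lie_bracket M A B q f"
  using smooth_near_eventually by (rule eventually_mono) (auto simp: lie_bracket_apply)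

lemma vector_field_lie_bracket:
  assumes A: "vector_field M A" and B: "vector_field M B"
  shows "vector_field M (lie_bracket M A B)"
  unfolding vector_field_iff
proof (intro ballI conjI)
  fix p f assume "p \<in> carrier M" and f: "f \<in> smooth_near M p"
  have "(\<lambda>q. A q (\<lambda>q. B q f) - B q (\<lambda>q. A q f)) \<in> smooth_near M p"
    by (rule smooth_near_diff[OF vector_field_smooth[OF A vector_field_smooth[OF B f]]
        vector_field_smooth[OF B vector_field_smooth[OF A f]]])
  then show "(\<lambda>q. lie_bracket M A B q f) \<in> smooth_near M p"
    by (rule smooth_near_transform[OF _ lie_bracket_eventually[OF f]])
qed (rule lie_bracket_tangent[OF A B])

text \<open>For commutators of operators the identity is formal. The inner bracket equals a
  commutator only on germs smooth at the point in question, which holds throughout a neighbourhood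
  of \<open>p\<close>.\<close>

lemma lie_bracket_jacobi:
  assumes "vector_field M A" "vector_field M B" "vector_field M C" "p \<in> carrier M"
  shows "lie_bracket M A (lie_bracket M B C) p + lie_bracket M B (lie_bracket M C A) p
    + lie_bracket M C (lie_bracket M A B) p = 0"
proof
  fix f
  show "(lie_bracket M A (lie_bracket M B C) p + lie_bracket M B (lie_bracket M C A) p
    + lie_bracket M C (lie_bracket M A B) p) f = 0 f"
  proof (cases "f \<in> smooth_near M p")
    case True
    have *: "lie_bracket M A (lie_bracket M B C) p f =
        A p (\<lambda>q. B q (\<lambda>q. C q f)) - A p (\<lambda>q. C q (\<lambda>q. B q f)) - (B p (\<lambda>q. C q (\<lambda>q. A q f)) - C p (\<lambda>q. B q (\<lambda>q. A q f)))"
      if "vector_field M A" "vector_field M B" "vector_field M C" for A B C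
    proof -
      have "A p (\<lambda>q. lie_bracket M B C q f) = A p (\<lambda>q. B q (\<lambda>q. C q f) - C q (\<lambda>q. B q f))"
        by (rule tangent_apply_cong[OF assms(4) vector_field_tangent[OF that(1) assms(4)], symmetric])
           (rule lie_bracket_eventually[OF True])
      also have "\<dots> = A p (\<lambda>q. B q (\<lambda>q. C q f)) - A p (\<lambda>q. C q (\<lambda>q. B q f))"
        by (rule tangent_apply_diff[OF assms(4) vector_field_tangent[OF that(1) assms(4)]
            vector_field_smooth[OF that(2) vector_field_smooth[OF that(3) True]]
            vector_field_smooth[OF that(3) vector_field_smooth[OF that(2) True]]])
      finally show ?thesis using that True by (simp add: lie_bracket_apply vector_field_smooth)
    qed
    show ?thesis using assms * by simp
  qed (simp add: lie_bracket_def)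
qed

lemma lie_bracket_anti: "lie_bracket M A B p = - lie_bracket M B A p"
  by (rule ext) (simp add: lie_bracket_def)

lemma lie_bracket_add:
  assumes "vector_field M A" "vector_field M B" "vector_field M C" "p \<in> carrier M"
  shows "lie_bracket M A (B + C) p = lie_bracket M A B p + lie_bracket M A C p"
proof
  fix f
  show "lie_bracket M A (B + C) p f = (lie_bracket M A B p + lie_bracket M A C p) f"
    using assms tangent_apply_add[OF assms(4) vector_field_tangent[OF assms(1,4)], of "\<lambda>q. B q f" "\<lambda>q. C q f"]
    by (simp add: lie_bracket_def vector_field_smooth)
qed

lemma lie_bracket_cong:
  assumes "\<And>q. q \<in> carrier M \<Longrightarrow> A q = A' q" "\<And>q. q \<in> carrier M \<Longrightarrow> B q = B' q"
    and "vector_field M A" "vector_field M B" "p \<in> carrier M"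
  shows "lie_bracket M A B p = lie_bracket M A' B' p"
proof
  fix f
  have ev: "\<forall>\<^sub>F q in nhdsin (mtop M) p. A q f = A' q f" "\<forall>\<^sub>F q in nhdsin (mtop M) p. B q f = B' q f"
    by (rule eventually_mono[OF eventually_carrier], simp add: assms(1,2))+
  have "A p (\<lambda>q. B q f) = A p (\<lambda>q. B' q f)" "B p (\<lambda>q. A q f) = B p (\<lambda>q. A' q f)"
    by (rule tangent_apply_cong[OF assms(5) vector_field_tangent[OF assms(3,5)] ev(2)],
        rule tangent_apply_cong[OF assms(5) vector_field_tangent[OF assms(4,5)] ev(1)])
  then show "lie_bracket M A B p f = lie_bracket M A' B' p f"
    using assms(1,2,5) by (simp add: lie_bracket_def)
qed

section \<open>The atlas of the slit tangent bundle\<close>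

definition slit_dom :: "'a set \<Rightarrow> 'a tpoint set" where
  "slit_dom U = Sigma U (tangent_space M) \<inter> {(p, v). v \<noteq> 0}"

definition slit_chart :: "('a \<Rightarrow> 'e) \<Rightarrow> 'a tpoint \<Rightarrow> 'e \<times> 'e" where
  "slit_chart \<phi> = (\<lambda>(p, v). (\<phi> p, chart_components \<phi> v))"

lemma slit_eq: "slit M = (\<lambda>(U, \<phi>). (slit_dom U, slit_chart \<phi>)) ` M"
  unfolding slit_def tangent_bundle_def restrict_atlas_def slit_dom_def slit_chart_def chart_components_def
  by (simp add: image_image case_prod_beta)

lemma slit_chart_in: "(U, \<phi>) \<in> M \<Longrightarrow> (slit_dom U, slit_chart \<phi>) \<in> slit M"
  by (force simp: slit_eq)

lemma slit_dom_iff: "u \<in> slit_dom U \<longleftrightarrow> fst u \<in> U \<and> snd u \<in> tangent_space M (fst u) \<and> snd u \<noteq> 0"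
  by (cases u) (auto simp: slit_dom_def)

lemma carrier_slit: "u \<in> carrier (slit M) \<longleftrightarrow> fst u \<in> carrier M \<and> snd u \<in> tangent_space M (fst u) \<and> snd u \<noteq> 0"
  by (force simp: carrier_def slit_eq slit_dom_iff)

lemma components_nonzero:
  "(U, \<phi>) \<in> M \<Longrightarrow> u \<in> slit_dom U \<Longrightarrow> chart_components \<phi> (snd u) \<noteq> 0"
  using chart_vector_components[of U \<phi> "fst u" "snd u"] chart_vector_components[of U \<phi> "fst u" 0] carrierI
  by (fastforce simp: slit_dom_iff)

lemma chart_vector_nonzero: "\<lbrakk>(U, \<phi>) \<in> M; p \<in> U; y \<noteq> 0\<rbrakk> \<Longrightarrow>
      chart_vector M U \<phi> p y \<noteq> 0"
  by (metis components_chart_vector chart_components_0)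

lemma slit_chart_inj: "(U, \<phi>) \<in> M \<Longrightarrow> inj_on (slit_chart \<phi>) (slit_dom U)"
proof (rule inj_onI)
  fix u w assume U: "(U, \<phi>) \<in> M" and uw: "u \<in> slit_dom U" "w \<in> slit_dom U" "slit_chart \<phi> u = slit_chart \<phi> w"
  then have "\<phi> (fst u) = \<phi> (fst w)" "chart_components \<phi> (snd u) = chart_components \<phi> (snd w)"
    by (auto simp: slit_chart_def case_prod_beta)
  moreover from this have "fst u = fst w" using inj[OF U] uw by (auto simp: slit_dom_iff inj_on_def)
  ultimately show "u = w" using chart_vector_components[OF U] uw by (metis slit_dom_iff prod_eqI)
qed

lemma slit_point:
  assumes "(U, \<phi>) \<in> M" "p \<in> U" "y \<noteq> 0"
  shows "(p, chart_vector M U \<phi> p y) \<in> slit_dom U" "slit_chart \<phi> (p, chart_vector M U \<phi> p y) = (\<phi> p, y)"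
  using assms chart_vector_in chart_vector_nonzero components_chart_vector by (auto simp: slit_dom_iff slit_chart_def)

lemma slit_chart_image_Int:
  assumes "(U, \<phi>) \<in> M"
  shows "slit_chart \<phi> ` (slit_dom U \<inter> slit_dom V) = \<phi> ` (U \<inter> V) \<times> (- {0 :: 'e})"
proof (intro equalityI subsetI)
  fix z assume "z \<in> slit_chart \<phi> ` (slit_dom U \<inter> slit_dom V)"
  then show "z \<in> \<phi> ` (U \<inter> V) \<times> (- {0 :: 'e})"
    using components_nonzero[OF assms] by (fastforce simp: slit_dom_iff slit_chart_def)
next
  fix z assume "z \<in> \<phi> ` (U \<inter> V) \<times> (- {0 :: 'e})"
  then obtain p y where z: "z = (\<phi> p, y)" "p \<in> U" "p \<in> V" "y \<noteq> 0" by auto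
  show "z \<in> slit_chart \<phi> ` (slit_dom U \<inter> slit_dom V)"
    unfolding z(1) slit_point(2)[OF assms z(2,4), symmetric]
    using slit_point(1)[OF assms z(2,4)] z(3) by (intro imageI) (auto simp: slit_dom_iff)
qed

lemma slit_chart_image: "(U, \<phi>) \<in> M \<Longrightarrow> slit_chart \<phi> ` slit_dom U = \<phi> ` U \<times> (- {0 :: 'e})"
  using slit_chart_image_Int[of U \<phi> U] by simp

lemma inv_slit_chart:
  assumes "(U, \<phi>) \<in> M" "x \<in> \<phi> ` U" "y \<noteq> 0"
  shows "inv_into (slit_dom U) (slit_chart \<phi>) (x, y) =
    (inv_into U \<phi> x, chart_vector M U \<phi> (inv_into U \<phi> x) y)"
proof -
  obtain p where p: "p \<in> U" "x = \<phi> p" using assms(2) by blast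
  then show ?thesis using slit_point[OF assms(1) p(1) assms(3)] slit_chart_inj[OF assms(1)] assms(1)
    by (metis inv_chart inv_into_f_f)
qed

text \<open>A transition map \<open>\<tau>\<close> of \<open>M\<close> induces \<open>(x, y)\<close>
  to \<open>(\<tau> x, D\<tau>(x) y)\<close> on the bundle; it is smooth because its fibre part is a
  sum of products over the basis.\<close>

lemma smooth_atlas_slit: "smooth_atlas (slit M)"
proof
  fix U' V' :: "'a tpoint set" and \<phi>' \<psi>' assume "(U', \<phi>') \<in> slit M" "(V', \<psi>') \<in> slit M"
  then obtain U \<phi> V \<psi> where U: "(U, \<phi>) \<in> M" "U' = slit_dom U" "\<phi>' = slit_chart \<phi>"
    and V: "(V, \<psi>) \<in> M" "V' = slit_dom V" "\<psi>' = slit_chart \<psi>" by (auto simp: slit_eq)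
  let ?S = "\<phi> ` (U \<inter> V) \<times> (- {0 :: 'e})"
  have o: "open ?S" using open_overlap[OF U(1) V(1)] by (intro open_Times) auto
  then show "open (\<phi>' ` (U' \<inter> V'))" using slit_chart_image_Int[OF U(1)] U V by simp
  let ?\<tau> = "\<lambda>x. \<psi> (inv_into U \<phi> x)"
  have \<tau>: "smooth_on (\<phi> ` (U \<inter> V)) ?\<tau>" by (rule smooth_transition[OF U(1) V(1)])
  have i: "smooth_on ?S (\<lambda>z. fst z)" "smooth_on ?S (\<lambda>z. snd z)"
    by (rule smooth_on_linear[OF o _ smooth_on_id[OF o]], rule bounded_linear_fst bounded_linear_snd)+
  have "smooth_on ?S (\<lambda>z. (?\<tau> (fst z), \<Sum>b\<in>Basis. (snd z \<bullet> b) *\<^sub>R \<D> ?\<tau> (fst z) b))"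
    by (intro smooth_on_Pair[OF o] smooth_on_sum[OF o] smooth_on_scaleR[OF o] smooth_on_inner[OF o] i
        smooth_on_compose[OF o \<tau> i(1)] smooth_on_compose[OF o smooth_on_deriv[OF \<tau>] i(1)]) auto
  then have "smooth_on ?S (\<lambda>z. \<psi>' (inv_into U' \<phi>' z))"
  proof (rule smooth_on_transform[OF _ o])
    fix z assume "z \<in> ?S"
    then obtain p y where z: "z = (\<phi> p, y)" "p \<in> U" "p \<in> V" "y \<noteq> 0" by auto
    have "chart_vector M U \<phi> p y = chart_vector M V \<psi> p (\<D> ?\<tau> (\<phi> p) y)"
      by (rule chart_vector_change) (use U V z in auto)
    then have "\<psi>' (inv_into U' \<phi>' z) = (\<psi> p, \<D> ?\<tau> (\<phi> p) y)"
      using z U V inv_slit_chart[OF U(1), of "\<phi> p" y] components_chart_vector[OF V(1) z(3)]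
      by (simp add: slit_chart_def)
    moreover have "\<D> ?\<tau> (\<phi> p) y = (\<Sum>b\<in>Basis. (y \<bullet> b) *\<^sub>R \<D> ?\<tau> (\<phi> p) b)"
      by (intro frechet_derivative_expand smooth_on_differentiable[OF \<tau>]) (use z in blast)
    ultimately show "(?\<tau> (fst z), \<Sum>b\<in>Basis. (snd z \<bullet> b) *\<^sub>R \<D> ?\<tau> (fst z) b) = \<psi>' (inv_into U' \<phi>' z)"
      using z U(1) by simp
  qed
  then show "smooth_on (\<phi>' ` (U' \<inter> V')) (\<lambda>x. \<psi>' (inv_into U' \<phi>' x))"
    using slit_chart_image_Int[OF U(1)] U V by simp
next
  fix U' \<phi>' assume "(U', \<phi>') \<in> slit M"
  then obtain U \<phi> where U: "(U, \<phi>) \<in> M" "U' = slit_dom U" "\<phi>' = slit_chart \<phi>" by (auto simp: slit_eq)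
  then show "inj_on \<phi>' U'" using slit_chart_inj by simp
  show "open (\<phi>' ` U')" using slit_chart_image[OF U(1)] U open_image[OF U(1)] by (auto intro!: open_Times)
qed

end

locale slit_bundle = smooth_atlas M for M :: "('a, 'e::euclidean_space) atlas"

text \<open>From here on, facts with prefix \<open>N\<close> concern the slit bundle and those
  without prefix its base.\<close>

sublocale slit_bundle \<subseteq> N: smooth_atlas "slit M"
  by (rule smooth_atlas_slit)

context slit_bundle
begin

abbreviation (input) "TM0 \<equiv> carrier (slit M)"
abbreviation (input) "vfield \<equiv> vector_field (slit M)"
abbreviation (input) "pfield \<equiv> pi_vector_field M"

lemma slit_carrierE:
  assumes "u \<in> TM0"
  obtains U \<phi> where "(U, \<phi>) \<in> M" "u \<in> slit_dom U"
  using assms carrierE by (metis carrier_slit slit_dom_iff)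

text \<open>In bundle charts the projection is the first projection of a product, hence
  continuous.\<close>

lemma eventually_fst:
  assumes u: "u \<in> TM0" and P: "eventually P (nhdsin (mtop M) (fst u))"
  shows "\<forall>\<^sub>F u in nhdsin (mtop (slit M)) u. P (fst u)"
proof -
  obtain U \<phi> where U: "(U, \<phi>) \<in> M" "u \<in> slit_dom U" using u slit_carrierE by blast
  have p: "fst u \<in> U" using U by (simp add: slit_dom_iff)
  have "\<forall>\<^sub>F x in nhds (fst (slit_chart \<phi> u)). P (inv_into U \<phi> x)"
    using P unfolding eventually_chart[OF U(1) p] by (simp add: slit_chart_def case_prod_beta)
  moreover have "filterlim fst (nhds (fst (slit_chart \<phi> u))) (nhds (slit_chart \<phi> u))"
    by (intro tendsto_fst filterlim_ident)
  ultimately have 1: "\<forall>\<^sub>F z in nhds (slit_chart \<phi> u). P (inv_into U \<phi> (fst z))"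
    by (auto simp: filterlim_iff)
  have 2: "\<forall>\<^sub>F z in nhds (slit_chart \<phi> u). z \<in> slit_chart \<phi> ` slit_dom U"
    using N.open_image[OF slit_chart_in[OF U(1)]] U(2) by (auto intro: eventually_nhds_in_open)
  show ?thesis unfolding N.eventually_chart[OF slit_chart_in[OF U(1)] U(2)]
    using 1 2
  proof eventually_elim
    case (elim z)
    then show ?case
      using inv_slit_chart[OF U(1), of "fst z" "snd z"] slit_chart_image[OF U(1)] by (auto simp: mem_Times_iff)
  qed
qed

lemma smooth_near_fst:
  assumes u: "u \<in> TM0" and f: "f \<in> smooth_near M (fst u)"
  shows "(\<lambda>u. f (fst u)) \<in> smooth_near (slit M) u"
proof -
  obtain U \<phi> where U: "(U, \<phi>) \<in> M" "u \<in> slit_dom U" using u slit_carrierE by blast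
  have p: "fst u \<in> U" using U by (simp add: slit_dom_iff)
  obtain S where S: "open S" "\<phi> (fst u) \<in> S" "S \<subseteq> \<phi> ` U" "smooth_on S (\<lambda>x. f (inv_into U \<phi> x))"
    using f smooth_near_iff[OF U(1) p] by blast
  let ?S = "S \<times> (- {0 :: 'e})"
  have o: "open ?S" using S(1) by (auto intro!: open_Times)
  have "smooth_on ?S (\<lambda>z. f (inv_into U \<phi> (fst z)))"
    by (rule smooth_on_compose[OF o S(4) smooth_on_linear[OF o bounded_linear_fst smooth_on_id[OF o]]]) auto
  then have "smooth_on ?S (\<lambda>z. f (fst (inv_into (slit_dom U) (slit_chart \<phi>) z)))"
  proof (rule smooth_on_transform[OF _ o])
    fix z assume "z \<in> ?S"
    then have "fst z \<in> \<phi> ` U" "snd z \<noteq> 0" using S(3) by (auto simp: mem_Times_iff)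
    then show "f (inv_into U \<phi> (fst z)) = f (fst (inv_into (slit_dom U) (slit_chart \<phi>) z))"
      using inv_slit_chart[OF U(1), of "fst z" "snd z"] by simp
  qed
  moreover have "slit_chart \<phi> u \<in> ?S"
    using S(2) components_nonzero[OF U] by (simp add: slit_chart_def case_prod_beta)
  moreover have "?S \<subseteq> slit_chart \<phi> ` slit_dom U" using S(3) slit_chart_image[OF U(1)] by auto
  ultimately show ?thesis
    unfolding N.smooth_near_iff[OF slit_chart_in[OF U(1)] U(2)] using o by (intro exI[of _ ?S] conjI)
qed

end

sublocale slit_bundle \<subseteq> pull: smooth_atlas_map "slit M" M fst
  by unfold_locales (simp_all add: carrier_slit eventually_fst smooth_near_fst)

context slit_bundle
begin

section \<open>Pi-vector fields, the vertical lift and the projection of vector fields\<close>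

lemma pi_vector_field_iff: "pfield Y \<longleftrightarrow> pull.field_along Y"
  unfolding pi_vector_field_def by (rule pull.smooth_map_tangent_bundle_iff)

lemma pi_tangent: "pfield Y \<Longrightarrow> u \<in> TM0 \<Longrightarrow> Y u \<in> tangent_space M (fst u)"
  by (simp add: pi_vector_field_iff pull.field_along_def)

lemma pi_smooth: "\<lbrakk>pfield Y; u \<in> TM0; f \<in> smooth_near M (fst u)\<rbrakk> \<Longrightarrow>
      (\<lambda>u. Y u f) \<in> smooth_near (slit M) u"
  by (simp add: pi_vector_field_iff pull.field_along_def)

text \<open>The components of \<open>eta\<close> are the fibre coordinates of the bundle
  chart.\<close>

lemma pi_field_eta [simp]: "pfield eta"
  unfolding pi_vector_field_iff
proof (rule pull.field_alongI)
  fix u assume u: "u \<in> TM0"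
  show "eta u \<in> tangent_space M (fst u)" using u by (simp add: carrier_slit eta_def)
  obtain U \<phi> where U: "(U, \<phi>) \<in> M" "u \<in> slit_dom U" using u slit_carrierE by blast
  have "(\<lambda>u. eta u (\<lambda>q. \<phi> q \<bullet> b)) \<in> smooth_near (slit M) u" if "b \<in> Basis" for b
    using N.chart_coordinate[OF slit_chart_in[OF U(1)] U(2), of "(0, b)"] that
    by (simp add: Basis_prod_def slit_chart_def case_prod_beta chart_components_inner eta_def)
  then show "\<exists>V \<psi>. (V, \<psi>) \<in> M \<and> fst u \<in> V \<and> (\<forall>b\<in>Basis. (\<lambda>u. eta u (\<lambda>q. \<psi> q \<bullet> b)) \<in> smooth_near (slit M) u)"
    using U by (auto simp: slit_dom_iff)
qed

lemma smooth_near_snd: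
  "u \<in> TM0 \<Longrightarrow> f \<in> smooth_near M (fst u) \<Longrightarrow> (\<lambda>u. snd u f) \<in> smooth_near (slit M) u"
  using pi_smooth[OF pi_field_eta] by (simp add: eta_def)

lemma slit_coordinate:
  assumes "b \<in> Basis"
  shows "(\<lambda>u. slit_chart \<phi> u \<bullet> (b, 0)) = (\<lambda>u. \<phi> (fst u) \<bullet> b)"
    and "(\<lambda>u. slit_chart \<phi> u \<bullet> (0, b)) = (\<lambda>u. snd u (\<lambda>q. \<phi> q \<bullet> b))"
  using assms by (auto simp: slit_chart_def case_prod_beta chart_components_inner)

text \<open>The functions \<open>f (fst u)\<close> and \<open>snd u f\<close> include all base and
  fibre coordinates of a bundle chart, hence they separate tangent vectors.\<close>

lemma slit_tangent_eqI:
  assumes u: "u \<in> TM0" and a: "a \<in> tangent_space (slit M) u" "a' \<in> tangent_space (slit M) u"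
    and "\<And>f. f \<in> smooth_near M (fst u) \<Longrightarrow> a (\<lambda>u. f (fst u)) = a' (\<lambda>u. f (fst u))"
    and "\<And>f. f \<in> smooth_near M (fst u) \<Longrightarrow> a (\<lambda>u. snd u f) = a' (\<lambda>u. snd u f)"
  shows "a = a'"
proof -
  obtain U \<phi> where U: "(U, \<phi>) \<in> M" "u \<in> slit_dom U" using u slit_carrierE by blast
  have p: "fst u \<in> U" using U by (simp add: slit_dom_iff)
  show ?thesis
  proof (rule N.tangent_eqI[OF slit_chart_in[OF U(1)] U(2) a])
    fix b :: "'e \<times> 'e" assume "b \<in> Basis"
    then consider i where "i \<in> Basis" "b = (i, 0)" | i where "i \<in> Basis" "b = (0, i)"
      by (auto simp: Basis_prod_def)
    then show "a (\<lambda>u. slit_chart \<phi> u \<bullet> b) = a' (\<lambda>u. slit_chart \<phi> u \<bullet> b)"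
    proof cases
      case 1
      show ?thesis unfolding 1(2) slit_coordinate(1)[OF 1(1)]
        using assms(4)[OF chart_coordinate[OF U(1) p 1(1)]] .
    next
      case 2
      show ?thesis unfolding 2(2) slit_coordinate(2)[OF 2(1)]
        using assms(5)[OF chart_coordinate[OF U(1) p 2(1)]] .
    qed
  qed
qed

text \<open>In bundle coordinates the curve defining the vertical lift is a straight line with
  constant base point.\<close>

lemma gamma_chart:
  assumes U: "(U, \<phi>) \<in> M" "u \<in> slit_dom U" and X: "X u \<in> tangent_space M (fst u)"
  shows "gamma M X u = chart_vector (slit M) (slit_dom U) (slit_chart \<phi>) u (0, chart_components \<phi> (X u))"
proof
  fix f
  let ?i = "inv_into (slit_dom U) (slit_chart \<phi>)" and ?v = "(0 :: 'e, chart_components \<phi> (X u))"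
  note U' = slit_chart_in[OF U(1)] U(2)
  have p: "fst u \<in> U" "snd u \<in> tangent_space M (fst u)" using U by (simp_all add: slit_dom_iff)
  show "gamma M X u f = chart_vector (slit M) (slit_dom U) (slit_chart \<phi>) u ?v f"
  proof (cases "f \<in> smooth_near (slit M) u")
    case True
    have "((\<lambda>z. f (?i z)) has_derivative \<D> (\<lambda>z. f (?i z)) (slit_chart \<phi> u)) (at (slit_chart \<phi> u + 0 *\<^sub>R ?v))"
      using iffD1[OF frechet_derivative_works N.smooth_near_differentiable[OF U' True]]
      by (simp only: scaleR_zero_left add_0_right)
    from has_real_derivative_along_line[OF this]
    have "((\<lambda>t. f (?i (slit_chart \<phi> u + t *\<^sub>R ?v))) has_real_derivative \<D> (\<lambda>z. f (?i z)) (slit_chart \<phi> u) ?v) (at 0)" .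
    \<comment> \<open>For parameters outside \<open>R\<close> the line meets the zero section, where
      the inverse chart has no meaning; \<open>R\<close> is a neighbourhood of 0.\<close>
    moreover define R where "R = {t. chart_components \<phi> (snd u) + t *\<^sub>R chart_components \<phi> (X u) \<noteq> 0}"
    have "open R" unfolding R_def by (intro open_Collect_neq continuous_intros)
    moreover have "0 \<in> R" using components_nonzero[OF U] by (simp add: R_def)
    moreover have "f (?i (slit_chart \<phi> u + t *\<^sub>R ?v)) = f (fst u, snd u + vscale t (X u))" if "t \<in> R" for t
    proof -
      have "?i (slit_chart \<phi> u + t *\<^sub>R ?v) = (fst u, chart_vector M U \<phi> (fst u) (chart_components \<phi> (snd u) + t *\<^sub>R chart_components \<phi> (X u)))"
        using that inv_slit_chart[OF U(1), of "\<phi> (fst u)"] p U(1) by (simp add: R_def slit_chart_def case_prod_beta)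
      also have "\<dots> = (fst u, snd u + vscale t (X u))"
        using chart_vector_components[OF U(1) p(1)] p(2) X
        by (simp add: chart_vector_add[OF U(1) p(1)] chart_vector_scale[OF U(1) p(1)])
      finally show ?thesis by simp
    qed
    ultimately have "((\<lambda>t. f (fst u, snd u + vscale t (X u))) has_real_derivative \<D> (\<lambda>z. f (?i z)) (slit_chart \<phi> u) ?v) (at 0)"
      by (rule has_field_derivative_transform_within_open)
    then show ?thesis using True by (simp add: gamma_def chart_vector_def DERIV_imp_deriv)
  qed (simp add: gamma_def chart_vector_def)
qed

lemma gamma_tangent:
  assumes "u \<in> TM0" "X u \<in> tangent_space M (fst u)"
  shows "gamma M X u \<in> tangent_space (slit M) u"
proof -
  obtain U \<phi> where U: "(U, \<phi>) \<in> M" "u \<in> slit_dom U" using assms(1) slit_carrierE by blast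
  then show ?thesis
    unfolding gamma_chart[where X=X, OF U assms(2)] by (intro N.chart_vector_in slit_chart_in)
qed

lemma gamma_fst: "gamma M X u (\<lambda>u. f (fst u)) = 0"
  by (simp add: gamma_def)

lemma gamma_snd:
  assumes "u \<in> TM0" "f \<in> smooth_near M (fst u)"
  shows "gamma M X u (\<lambda>u. snd u f) = X u f"
proof -
  have "((\<lambda>t. snd u f + t * X u f) has_real_derivative X u f) (at 0)"
    by (auto intro!: derivative_eq_intros)
  then show ?thesis using smooth_near_snd[OF assms] by (simp add: gamma_def vscale_def DERIV_imp_deriv)
qed

lemma gamma_add:
  assumes "u \<in> TM0" "X u \<in> tangent_space M (fst u)" "Y u \<in> tangent_space M (fst u)"
  shows "gamma M (X + Y) u = gamma M X u + gamma M Y u"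
  using assms
  by (intro slit_tangent_eqI[OF assms(1)] N.tangent_add gamma_tangent)
     (auto simp: gamma_fst gamma_snd carrier_slit intro: tangent_add)

lemma vector_field_gamma:
  assumes "pfield X" shows "vfield (gamma M X)"
  unfolding vector_field_def smooth_atlas_map.smooth_map_tangent_bundle_iff[OF N.smooth_atlas_map_id]
proof (rule smooth_atlas_map.field_alongI[OF N.smooth_atlas_map_id])
  fix u assume u: "u \<in> TM0"
  show "gamma M X u \<in> tangent_space (slit M) u" by (rule gamma_tangent[where X=X, OF u pi_tangent[OF assms u]])
  obtain U \<phi> where U: "(U, \<phi>) \<in> M" "u \<in> slit_dom U" using u slit_carrierE by blast
  note U' = slit_chart_in[OF U(1)] U(2)
  have "(\<lambda>u. gamma M X u (\<lambda>q. slit_chart \<phi> q \<bullet> b)) \<in> smooth_near (slit M) u" if b: "b \<in> Basis" for b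
  proof -
    consider i where "i \<in> Basis" "b = (i, 0)" | i where "i \<in> Basis" "b = (0, i)"
      using b by (auto simp: Basis_prod_def)
    then show ?thesis
    proof cases
      case 1
      then show ?thesis unfolding 1(2) slit_coordinate(1)[OF 1(1)]
        by (simp add: gamma_fst[of _ _ "\<lambda>p. \<phi> p \<bullet> i"] u)
    next
      case 2
      have p: "fst u \<in> U" using U by (simp add: slit_dom_iff)
      show ?thesis unfolding 2(2) slit_coordinate(2)[OF 2(1)]
      proof (rule N.smooth_near_transform[OF pi_smooth[OF assms u chart_coordinate[OF U(1) p 2(1)]]])
        show "\<forall>\<^sub>F u in nhdsin (mtop (slit M)) u. X u (\<lambda>q. \<phi> q \<bullet> i) = gamma M X u (\<lambda>u. snd u (\<lambda>q. \<phi> q \<bullet> i))"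
          using N.eventually_in_chart[OF U']
        proof eventually_elim
          case (elim w)
          then show ?case using N.carrierI[OF U'(1) elim] chart_coordinate[OF U(1) _ 2(1), of "fst w"]
            by (simp add: gamma_snd slit_dom_iff)
        qed
      qed
    qed
  qed
  then show "\<exists>V \<psi>. (V, \<psi>) \<in> slit M \<and> u \<in> V \<and> (\<forall>b\<in>Basis. (\<lambda>u. gamma M X u (\<lambda>q. \<psi> q \<bullet> b)) \<in> smooth_near (slit M) u)"
    using U' by blast
qed

lemma differential_apply:
  "f \<in> smooth_near M (fst u) \<Longrightarrow> differential M fst u a f = a (\<lambda>u. f (fst u))"
  by (simp add: differential_def o_def)

lemma differential_chart:
  assumes U: "(U, \<phi>) \<in> M" "u \<in> slit_dom U" and a: "a \<in> tangent_space (slit M) u"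
  shows "differential M fst u a = chart_vector M U \<phi> (fst u) (\<Sum>b\<in>Basis. a (\<lambda>u. \<phi> (fst u) \<bullet> b) *\<^sub>R b)"
proof
  fix f
  have u: "u \<in> TM0" by (rule N.carrierI[OF slit_chart_in[OF U(1)] U(2)])
  have p: "fst u \<in> U" using U by (simp add: slit_dom_iff)
  show "differential M fst u a f = chart_vector M U \<phi> (fst u) (\<Sum>b\<in>Basis. a (\<lambda>u. \<phi> (fst u) \<bullet> b) *\<^sub>R b) f"
  proof (cases "f \<in> smooth_near M (fst u)")
    case True
    obtain S where S: "open S" "\<phi> (fst u) \<in> S" "S \<subseteq> \<phi> ` U" "smooth_on S (\<lambda>x. f (inv_into U \<phi> x))"
      using True smooth_near_iff[OF U(1) p] by blast
    have "\<forall>\<^sub>F w in nhdsin (mtop (slit M)) u. f (fst w) = f (inv_into U \<phi> (\<phi> (fst w)))"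
      using pull.eventually_F_chart[OF u U(1) p] by eventually_elim (simp add: U(1))
    then have "a (\<lambda>u. f (fst u)) = a (\<lambda>w. f (inv_into U \<phi> (\<phi> (fst w))))"
      by (rule N.tangent_apply_cong[OF u a])
    also have "\<dots> = \<D> (\<lambda>x. f (inv_into U \<phi> x)) (\<phi> (fst u)) (\<Sum>b\<in>Basis. a (\<lambda>u. \<phi> (fst u) \<bullet> b) *\<^sub>R b)"
      by (rule N.tangent_apply_smooth_compose[OF u a pull.F_chart[OF u U(1) p] S(4,1,2)])
    finally show ?thesis using True by (simp add: differential_apply chart_vector_def)
  qed (simp add: differential_def chart_vector_def)
qed

lemma differential_tangent:
  assumes "u \<in> TM0" "a \<in> tangent_space (slit M) u"
  shows "differential M fst u a \<in> tangent_space M (fst u)"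
proof -
  obtain U \<phi> where U: "(U, \<phi>) \<in> M" "u \<in> slit_dom U" using assms(1) slit_carrierE by blast
  then show ?thesis
    unfolding differential_chart[OF U assms(2)] by (intro chart_vector_in) (auto simp: slit_dom_iff)
qed

lemma differential_chart_vector:
  assumes U: "(U, \<phi>) \<in> M" "u \<in> slit_dom U"
  shows "differential M fst u (chart_vector (slit M) (slit_dom U) (slit_chart \<phi>) u w) = chart_vector M U \<phi> (fst u) (fst w)"
proof -
  note U' = slit_chart_in[OF U(1)] U(2)
  have "chart_vector (slit M) (slit_dom U) (slit_chart \<phi>) u w (\<lambda>u. \<phi> (fst u) \<bullet> b) = fst w \<bullet> b" if "b \<in> Basis" for b
    using N.chart_vector_coordinate[OF U', of "(b, 0)" w] that
    unfolding slit_coordinate(1)[OF that] by (simp add: Basis_prod_def inner_prod_def)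
  then show ?thesis
    unfolding differential_chart[OF U N.chart_vector_in[OF U']] by (simp add: euclidean_representation)
qed

lemma differential_add: "differential M fst u (a + b) = differential M fst u a + differential M fst u b"
  by (rule ext) (simp add: differential_def)

lemma rho_apply: "f \<in> smooth_near M (fst u) \<Longrightarrow> rho M A u f = A u (\<lambda>u. f (fst u))"
  by (simp add: rho_def differential_apply)

lemma pi_vector_field_rho:
  assumes "vfield A" shows "pfield (rho M A)"
  unfolding pi_vector_field_iff pull.field_along_def
proof (intro ballI conjI)
  fix u assume u: "u \<in> TM0"
  then show "rho M A u \<in> tangent_space M (fst u)"
    unfolding rho_def using N.vector_field_tangent[OF assms u] by (rule differential_tangent)
  fix f assume f: "f \<in> smooth_near M (fst u)"
  have "\<forall>\<^sub>F u in nhdsin (mtop (slit M)) u. A u (\<lambda>u. f (fst u)) = rho M A u f"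
    using eventually_fst[OF u smooth_near_eventually[OF f]] by eventually_elim (simp add: rho_apply)
  then show "(\<lambda>u. rho M A u f) \<in> smooth_near (slit M) u"
    by (rule N.smooth_near_transform[OF N.vector_field_smooth[OF assms smooth_near_fst[OF u f]]])
qed

lemma rho_add: "rho M (A + B) u = rho M A u + rho M B u"
  by (simp add: rho_def differential_add)

lemma rho_gamma: "rho M (gamma M X) u = 0"
  by (rule ext) (simp add: rho_def differential_def o_def gamma_fst)

text \<open>A vertical field kills functions pulled back from \<open>M\<close>, so one term of the
  commutator disappears. The remaining one differentiates the components of \<open>rho M A\<close>
  along the fibre: this is D0 in coordinates.\<close>

lemma rho_bracket_gamma:
  assumes X: "pfield X" and A: "vfield A" and u: "u \<in> TM0"
    and f: "f \<in> smooth_near M (fst u)"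
  shows "rho M (lie_bracket (slit M) (gamma M X) A) u f = gamma M X u (\<lambda>u. rho M A u f)"
proof -
  have 1: "\<forall>\<^sub>F u in nhdsin (mtop (slit M)) u. A u (\<lambda>u. f (fst u)) = rho M A u f"
    using eventually_fst[OF u smooth_near_eventually[OF f]] by eventually_elim (simp add: rho_apply)
  have "gamma M X u (\<lambda>u. A u (\<lambda>u. f (fst u))) = gamma M X u (\<lambda>u. rho M A u f)"
    by (rule N.tangent_apply_cong[OF u N.vector_field_tangent[OF vector_field_gamma[OF X] u] 1])
  then show ?thesis
    using N.vector_field_tangent[OF A u] smooth_near_fst[OF u f] f u
    by (simp add: rho_apply lie_bracket_def gamma_fst)
qed

lemma rho_bracket_gamma_gamma:
  assumes "pfield X" "pfield Y" "u \<in> TM0"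
  shows "rho M (lie_bracket (slit M) (gamma M X) (gamma M Y)) u = 0"
proof
  fix f
  show "rho M (lie_bracket (slit M) (gamma M X) (gamma M Y)) u f = 0 f"
  proof (cases "f \<in> smooth_near M (fst u)")
    case True
    then show ?thesis
      using rho_bracket_gamma[OF assms(1) vector_field_gamma[OF assms(2)] assms(3) True]
        N.vector_field_tangent[OF vector_field_gamma[OF assms(1)] assms(3)] assms(3)
      by (simp add: rho_gamma)
  qed (simp add: rho_def differential_def)
qed

end

subsection \<open>Smoothness of the horizontal lift\<close>

context smooth_atlas
begin

text \<open>The axioms of a connection give smoothness for global fields, so coordinate fields must
  be cut off. A closed set \<open>C\<close> inside the chart makes the extension by zero smooth at
  all points outside \<open>U\<close>.\<close>

lemma smooth_bump:
  assumes "Hausdorff_space (mtop M)" and U: "(U, \<phi>) \<in> M" "p \<in> U"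
  obtains f C where "smooth_fun M f" "f p > 0" "closedin (mtop M) C" "C \<subseteq> U" "\<And>q. q \<notin> C \<Longrightarrow> f q = 0"
proof -
  obtain r where r: "r > 0" "cball (\<phi> p) r \<subseteq> \<phi> ` U"
    using open_image[OF U(1)] U(2) by (meson image_eqI open_contains_cball)
  define C where "C = inv_into U \<phi> ` cball (\<phi> p) r"
  have "continuous_map (top_of_set (\<phi> ` U)) (mtop M) (inv_into U \<phi>)"
    unfolding continuous_map
  proof (intro conjI allI impI)
    show "inv_into U \<phi> ` topspace (top_of_set (\<phi> ` U)) \<subseteq> topspace (mtop M)"
      using U(1) by (auto simp: topspace_mtop intro: carrierI)
    fix W assume "openin (mtop M) W"
    then have "open (\<phi> ` (U \<inter> W))" using U(1) unfolding openin_iff by blast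
    moreover have "{x \<in> topspace (top_of_set (\<phi> ` U)). inv_into U \<phi> x \<in> W} = \<phi> ` (U \<inter> W)"
      using U(1) by auto
    ultimately show "openin (top_of_set (\<phi> ` U)) {x \<in> topspace (top_of_set (\<phi> ` U)). inv_into U \<phi> x \<in> W}"
      by (auto intro: open_subset)
  qed
  then have "compactin (mtop M) C" unfolding C_def using r(2)
    by (intro image_compactin[of "top_of_set (\<phi> ` U)"]) (simp_all add: compactin_subtopology)
  \<comment> \<open>The Hausdorff property makes the compact set closed; its complement is then a
    neighbourhood of every point outside the chart.\<close>
  then have C: "closedin (mtop M) C" using assms(1) compactin_imp_closedin by blast
  have CU: "C \<subseteq> U" using r(2) U(1) by (auto simp: C_def subset_iff intro: inv_into_into)
  \<comment> \<open>Positive exactly on the open ball of radius \<open>r\<close> around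
    \<open>\<phi> p\<close>, and flat at its boundary.\<close>
  let ?G = "\<lambda>x. flat_exp 0 (r\<^sup>2 - (x - \<phi> p) \<bullet> (x - \<phi> p))"
  define f where "f q = (if q \<in> U then ?G (\<phi> q) else 0)" for q
  have fC: "f q = 0" if "q \<notin> C" for q
  proof (cases "q \<in> U")
    case True
    then have "\<phi> q \<notin> cball (\<phi> p) r" using that U(1) by (force simp: C_def)
    then have "r < norm (\<phi> q - \<phi> p)" by (simp add: dist_norm norm_minus_commute)
    then have "r\<^sup>2 < (\<phi> q - \<phi> p) \<bullet> (\<phi> q - \<phi> p)"
      using r(1) by (simp add: dot_square_norm power_strict_mono)
    then show ?thesis by (simp add: f_def flat_exp_def)
  qed (simp add: f_def)
  have "smooth_fun M f" unfolding smooth_fun_iff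
  proof
    fix q assume q: "q \<in> carrier M"
    show "f \<in> smooth_near M q"
    proof (cases "q \<in> U")
      case True
      have "smooth_on UNIV (\<lambda>x. r\<^sup>2 - (x - \<phi> p) \<bullet> (x - \<phi> p))"
        by (intro smooth_on_diff smooth_on_bilinear[OF _ bounded_bilinear_inner] smooth_on_id smooth_on_const open_UNIV)
      then have "smooth_on UNIV ?G"
        using smooth_on_compose[OF open_UNIV smooth_on_flat_exp] by blast
      from snear_compose[OF snear_chart[OF U(1) True] this open_UNIV UNIV_I q]
      have "(\<lambda>q. ?G (\<phi> q)) \<in> smooth_near M q" by simp
      moreover have "\<forall>\<^sub>F q in nhdsin (mtop M) q. ?G (\<phi> q) = f q"
        using eventually_in_chart[OF U(1) True] by eventually_elim (simp add: f_def)
      ultimately show ?thesis by (rule smooth_near_transform)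
    next
      case False
      then have "q \<in> topspace (mtop M) - C" using q CU topspace_mtop by auto
      then have "\<forall>\<^sub>F q in nhdsin (mtop M) q. 0 = f q"
        using C fC unfolding closedin_def eventually_nhdsin by (metis DiffD2)
      then show ?thesis by (rule smooth_near_transform[OF smooth_near_const[OF q]])
    qed
  qed
  moreover have "f p > 0" using U(2) r(1) by (simp add: f_def flat_exp_def)
  ultimately show ?thesis using that C CU fC by blast
qed

lemma smooth_near_chart_vector:
  assumes U: "(U, \<phi>) \<in> M" "p \<in> U" and f: "f \<in> smooth_near M p"
  shows "(\<lambda>q. chart_vector M U \<phi> q w f) \<in> smooth_near M p"
proof -
  have p: "p \<in> carrier M" using U carrierI by blast
  obtain S where S: "open S" "\<phi> p \<in> S" "smooth_on S (\<lambda>x. f (inv_into U \<phi> x))"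
    using f smooth_near_iff[OF U] by blast
  from snear_compose[OF snear_chart[OF U] smooth_on_deriv[OF S(3)] S(1,2) p, of w]
  have "(\<lambda>q. \<D> (\<lambda>x. f (inv_into U \<phi> x)) (\<phi> q) w) \<in> smooth_near M p" by simp
  moreover have "\<forall>\<^sub>F q in nhdsin (mtop M) p. \<D> (\<lambda>x. f (inv_into U \<phi> x)) (\<phi> q) w = chart_vector M U \<phi> q w f"
    using smooth_near_eventually[OF f] by eventually_elim (simp add: chart_vector_def)
  ultimately show ?thesis by (rule smooth_near_transform)
qed

lemma tangent_0_iff_components:
  "\<lbrakk>(U, \<phi>) \<in> M; p \<in> U; v \<in> tangent_space M p\<rbrakk> \<Longrightarrow>
      v = 0 \<longleftrightarrow> chart_components \<phi> v = 0"
  using chart_vector_components[of U \<phi> p v] chart_vector_components[of U \<phi> p 0] carrierI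
  by (metis chart_components_0 tangent_0)

end

context slit_bundle
begin

text \<open>\<open>slit_dom U\<close> consists of all points of the slit bundle over
  \<open>U\<close>, so a cut-off function on \<open>M\<close>, pulled back, is enough and none is
  required in the fibre directions.\<close>

lemma extend_chart_vector:
  assumes "Hausdorff_space (mtop M)" and U: "(U, \<phi>) \<in> M" "u \<in> slit_dom U"
  obtains f E where "smooth_fun M f" "f (fst u) > 0" "vfield E"
    "\<And>w. w \<in> slit_dom U \<Longrightarrow> E w = vscale (f (fst w)) (chart_vector (slit M) (slit_dom U) (slit_chart \<phi>) w a)"
proof -
  note U' = slit_chart_in[OF U(1)] U(2)
  have p: "fst u \<in> U" using U by (simp add: slit_dom_iff)
  obtain f C where f: "smooth_fun M f" "f (fst u) > 0" and C: "closedin (mtop M) C" "C \<subseteq> U" "\<And>q. q \<notin> C \<Longrightarrow> f q = 0"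
    using smooth_bump[OF assms(1) U(1) p] by metis
  let ?c = "\<lambda>w. chart_vector (slit M) (slit_dom U) (slit_chart \<phi>) w a"
  define E where "E w = (if w \<in> slit_dom U then vscale (f (fst w)) (?c w) else 0)" for w
  have "vfield E" unfolding N.vector_field_iff
  proof (intro ballI conjI)
    fix w assume w: "w \<in> TM0"
    then show "E w \<in> tangent_space (slit M) w"
      using N.tangent_vscale[OF w N.chart_vector_in[OF U'(1)]] by (simp add: E_def)
    fix h assume h: "h \<in> smooth_near (slit M) w"
    show "(\<lambda>w. E w h) \<in> smooth_near (slit M) w"
    proof (cases "w \<in> slit_dom U")
      case True
      have "(\<lambda>w. f (fst w)) \<in> smooth_near (slit M) w"
        using smooth_near_fst[OF w] f(1) w unfolding smooth_fun_iff by (simp add: carrier_slit)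
      from N.smooth_near_mult[OF this N.smooth_near_chart_vector[OF U'(1) True h, of a]]
      show ?thesis
        by (rule N.smooth_near_transform)
           (use N.eventually_in_chart[OF U'(1) True] in eventually_elim, simp add: E_def vscale_def)
    next
      case False
      \<comment> \<open>A point outside \<open>slit_dom U\<close> lies over the open complement of
        \<open>C\<close>, and over that set the field vanishes.\<close>
      have "fst w \<in> topspace (mtop M) - C" using False w C(2) by (auto simp: topspace_mtop carrier_slit slit_dom_iff)
      then have "\<forall>\<^sub>F q in nhdsin (mtop M) (fst w). q \<notin> C"
        using C(1) unfolding closedin_def eventually_nhdsin by (metis DiffD2)
      from eventually_fst[OF w this] have "\<forall>\<^sub>F w in nhdsin (mtop (slit M)) w. 0 = E w h"
        by eventually_elim (simp add: E_def C(3) vscale_def)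
      then show ?thesis by (rule N.smooth_near_transform[OF N.smooth_near_const[OF w]])
    qed
  qed
  then show ?thesis using that f E_def by auto
qed

end

section \<open>Regular connections and their horizontal lift\<close>

locale regular_slit_bundle = slit_bundle M for M :: "('a, 'e::euclidean_space) atlas" +
  fixes D :: "'a conn"
  assumes hausdorff: "Hausdorff_space (mtop M)" and regular: "regular_connection M D"
begin

lemma linear: "linear_connection M D"
  using regular by (simp add: regular_connection_def)

lemma pi_field_cov: "vfield A \<Longrightarrow> pfield Y \<Longrightarrow> pfield (cov D A Y)"
  using linear by (simp add: linear_connection_def)

context
  fixes u a assumes ua: "u \<in> TM0" "a \<in> tangent_space (slit M) u"
begin

lemma D_tangent: "pfield Y \<Longrightarrow> D u a Y \<in> tangent_space M (fst u)"
  using linear ua by (simp add: linear_connection_def)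

lemma D_add_left: "pfield Y \<Longrightarrow> b \<in> tangent_space (slit M) u \<Longrightarrow> D u (a + b) Y = D u a Y + D u b Y"
  using linear ua by (simp add: linear_connection_def)

lemma D_vscale_left: "pfield Y \<Longrightarrow> D u (vscale c a) Y = vscale c (D u a Y)"
  using linear ua by (simp add: linear_connection_def)

lemma D_add: "pfield Y \<Longrightarrow> pfield Z \<Longrightarrow> D u a (Y + Z) = D u a Y + D u a Z"
  using linear ua by (simp add: linear_connection_def)

text \<open>A field that vanishes on the slit bundle is its own product with the function that is \<open>0\<close> there
  and \<open>1\<close> elsewhere.\<close>

lemma D_vanishing:
  assumes Z: "pfield Z" "\<And>w. w \<in> TM0 \<Longrightarrow> Z w = 0"
  shows "D u a Z = 0"
proof -
  define f where "f w = (if w \<in> TM0 then 0 else 1 :: real)" for w :: "'a tpoint"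
  have "f \<in> smooth_near (slit M) w" if w: "w \<in> TM0" for w
    by (rule N.smooth_near_transform[OF N.smooth_near_const[OF w, of 0] eventually_mono[OF N.eventually_carrier]])
       (simp add: f_def)
  then have "smooth_fun (slit M) f" by (simp add: N.smooth_fun_iff)
  then have "D u a (\<lambda>x. vscale (f x) (Z x)) = vscale (a f) (Z u) + vscale (f u) (D u a Z)"
    using linear ua Z(1) by (simp add: linear_connection_def)
  moreover have "(\<lambda>x. vscale (f x) (Z x)) = Z"
    using Z(2) by (auto simp: fun_eq_iff f_def vscale_def)
  ultimately show ?thesis using Z(2) ua(1) by (simp add: f_def vscale_def zero_fun_def plus_fun_def)
qed

lemma D_cong:
  assumes Y: "pfield Y" and Z: "pfield Z"
    and eq: "\<And>w. w \<in> TM0 \<Longrightarrow> Y w = Z w"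
  shows "D u a Y = D u a Z"
proof -
  have d: "pfield (Y - Z)" using Y Z unfolding pi_vector_field_iff by (rule pull.field_along_diff)
  have "D u a Y = D u a ((Y - Z) + Z)" by simp
  also have "\<dots> = D u a (Y - Z) + D u a Z" by (rule D_add[OF d Z])
  also have "D u a (Y - Z) = 0" by (rule D_vanishing[OF d]) (simp add: eq)
  finally show ?thesis by simp
qed

end

lemma horizontal_vertical_0:
  assumes "u \<in> TM0" "a \<in> horizontal M D u" "differential M fst u a = 0" shows "a = 0"
proof -
  have "a \<in> vertical M u \<inter> horizontal M D u" using assms(2,3) by (simp add: vertical_def horizontal_def)
  moreover have "vertical M u \<inter> horizontal M D u = {0}"
    using regular assms(1) by (simp add: regular_connection_def)
  ultimately show ?thesis by blast
qed

text \<open>Removing the vertical part of any lift of \<open>v\<close> leaves its projection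
  unchanged. Thus the \<open>inv_into\<close> in \<open>beta\<close> picks a genuine
  preimage.\<close>

lemma horizontal_surj:
  assumes u: "u \<in> TM0" and v: "v \<in> tangent_space M (fst u)"
  shows "v \<in> differential M fst u ` horizontal M D u"
proof -
  obtain U \<phi> where U: "(U, \<phi>) \<in> M" "u \<in> slit_dom U" using u slit_carrierE by blast
  have p: "fst u \<in> U" using U by (simp add: slit_dom_iff)
  let ?a = "chart_vector (slit M) (slit_dom U) (slit_chart \<phi>) u (chart_components \<phi> v, 0)"
  have a: "differential M fst u ?a = v"
    using differential_chart_vector[OF U] chart_vector_components[OF U(1) p v] by simp
  have "?a \<in> tangent_space (slit M) u" by (rule N.chart_vector_in[OF slit_chart_in[OF U(1)] U(2)])
  then obtain b h where "?a = b + h" "b \<in> vertical M u" "h \<in> horizontal M D u"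
    using regular u by (auto simp: regular_connection_def)
  then have "differential M fst u h = v" using a by (simp add: differential_add vertical_def)
  then show ?thesis using \<open>h \<in> horizontal M D u\<close> by blast
qed

lemma beta_horizontal:
  assumes "u \<in> TM0" "X u \<in> tangent_space M (fst u)"
  shows "beta M D X u \<in> horizontal M D u" "differential M fst u (beta M D X u) = X u"
  using inv_into_into[OF horizontal_surj[OF assms]] f_inv_into_f[OF horizontal_surj[OF assms]]
  by (simp_all add: beta_def)

lemma beta_tangent:
  "u \<in> TM0 \<Longrightarrow> X u \<in> tangent_space M (fst u) \<Longrightarrow> beta M D X u \<in> tangent_space (slit M) u"
  using beta_horizontal(1) by (simp add: horizontal_def)

lemma rho_beta: "u \<in> TM0 \<Longrightarrow> X u \<in> tangent_space M (fst u) \<Longrightarrow> rho M (beta M D X) u = X u"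
  by (simp add: rho_def beta_horizontal)

lemma cov_beta_eta: "u \<in> TM0 \<Longrightarrow> X u \<in> tangent_space M (fst u) \<Longrightarrow> cov D (beta M D X) eta u = 0"
  using beta_horizontal(1)[of u X] by (simp add: cov_def horizontal_def zero_fun_def)

text \<open>The global field \<open>E\<close> is a positive multiple of the coordinate vector near
  \<open>u\<close>. By linearity of \<open>D\<close> in the tangent vector the factor can be divided
  out.\<close>

lemma smooth_near_D_chart_vector:
  assumes U: "(U, \<phi>) \<in> M" "u \<in> slit_dom U"
  shows "N.snear u (\<lambda>w. chart_components \<phi> (D w (chart_vector (slit M) (slit_dom U) (slit_chart \<phi>) w a) eta))"
proof -
  note U' = slit_chart_in[OF U(1)] U(2)
  let ?c = "\<lambda>w. chart_vector (slit M) (slit_dom U) (slit_chart \<phi>) w a"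
  have u: "u \<in> TM0" by (rule N.carrierI[OF U'])
  have p: "fst u \<in> U" "fst u \<in> carrier M" using U carrierI by (auto simp: slit_dom_iff)
  obtain f E where f: "smooth_fun M f" "f (fst u) > 0" and E: "vfield E"
    "\<And>w. w \<in> slit_dom U \<Longrightarrow> E w = vscale (f (fst w)) (?c w)"
    using extend_chart_vector[OF hausdorff U] by metis
  have f': "(\<lambda>w. f (fst w)) \<in> smooth_near (slit M) u"
    using smooth_near_fst[OF u] f(1) p(2) unfolding smooth_fun_iff by blast
  have "smooth_on {0<..} (\<lambda>x::real. inverse x)"
    by (intro smooth_on_inverse smooth_on_id) auto
  from N.snear_compose[OF _ this _ _ u, of "\<lambda>w. f (fst w)"]
  have i: "(\<lambda>w. inverse (f (fst w))) \<in> smooth_near (slit M) u" using f' f(2) by simp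
  let ?g = "\<lambda>x. f (fst (inv_into (slit_dom U) (slit_chart \<phi>) x))"
  have "isCont ?g (slit_chart \<phi> u)"
    using differentiable_imp_continuous_within[OF N.smooth_near_differentiable[OF U' f']] by simp
  then have "(?g \<longlongrightarrow> ?g (slit_chart \<phi> u)) (nhds (slit_chart \<phi> u))"
    using tendsto_at_iff_tendsto_nhds[of ?g "slit_chart \<phi> u"] by (simp add: isCont_def)
  then have S: "\<forall>\<^sub>F w in nhdsin (mtop (slit M)) u. f (fst w) > 0"
    unfolding N.eventually_chart[OF U'] using f(2) U' by (intro order_tendstoD(1)) simp_all
  show ?thesis unfolding N.snear_def
  proof
    fix b :: 'e assume b: "b \<in> Basis"
    let ?x = "\<lambda>q. \<phi> q \<bullet> b"
    have "(\<lambda>w. inverse (f (fst w)) * cov D E eta w ?x) \<in> smooth_near (slit M) u"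
      by (rule N.smooth_near_mult[OF i pi_smooth[OF pi_field_cov[OF E(1) pi_field_eta] u chart_coordinate[OF U(1) p(1) b]]])
    moreover have "\<forall>\<^sub>F w in nhdsin (mtop (slit M)) u. inverse (f (fst w)) * cov D E eta w ?x = chart_components \<phi> (D w (?c w) eta) \<bullet> b"
      using S N.eventually_in_chart[OF U']
    proof eventually_elim
      case (elim w)
      have w: "w \<in> TM0" "?c w \<in> tangent_space (slit M) w"
        using N.carrierI[OF U'(1) elim(2)] N.chart_vector_in[OF U'(1) elim(2)] .
      show ?case using elim(1) D_vscale_left[OF w pi_field_eta]
        by (simp add: cov_def E(2)[OF elim(2)] chart_components_inner[OF b] vscale_def)
    qed
    ultimately show "(\<lambda>w. chart_components \<phi> (D w (?c w) eta) \<bullet> b) \<in> smooth_near (slit M) u"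
      by (rule N.smooth_near_transform)
  qed
qed

text \<open>At each point the horizontal lift is determined by the two conditions that its
  projection is \<open>X\<close> and that \<open>eta\<close> has derivative 0 along it: as many
  linear equations as unknown components.\<close>

lemma vector_field_beta:
  assumes X: "pfield X" shows "vfield (beta M D X)"
  unfolding vector_field_def smooth_atlas_map.smooth_map_tangent_bundle_iff[OF N.smooth_atlas_map_id]
proof (rule smooth_atlas_map.field_alongI[OF N.smooth_atlas_map_id])
  fix u assume u: "u \<in> TM0"
  show "beta M D X u \<in> tangent_space (slit M) u" by (rule beta_tangent[where X=X, OF u pi_tangent[OF X u]])
  obtain U \<phi> where U: "(U, \<phi>) \<in> M" "u \<in> slit_dom U" using u slit_carrierE by blast
  note U' = slit_chart_in[OF U(1)] U(2)
  let ?i = "inv_into (slit_dom U) (slit_chart \<phi>)"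
  let ?c = "\<lambda>z. chart_vector (slit M) (slit_dom U) (slit_chart \<phi>) (?i z)"
  have p: "fst u \<in> U" using U by (simp add: slit_dom_iff)
  \<comment> \<open>The first half takes the base components of a vector, the second the components
    of the derivative of \<open>eta\<close> along it.\<close>
  define P where "P z a = (fst a, chart_components \<phi> (D (?i z) (?c z a) eta))" for z a
  define w where "w z = chart_components (slit_chart \<phi>) (beta M D X (?i z))" for z
  define b where "b z = (chart_components \<phi> (X (?i z)), 0 :: 'e)" for z
  let ?S = "slit_chart \<phi> ` slit_dom U"
  have o: "open ?S" by (rule N.open_image[OF U'(1)])
  have pt: "?i z \<in> slit_dom U" "?i z \<in> TM0" "fst (?i z) \<in> U" if "z \<in> ?S" for z
    using that N.carrierI[OF U'(1)] U'(1) by (auto simp: slit_dom_iff)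
  have ct: "?c z a \<in> tangent_space (slit M) (?i z)" if "z \<in> ?S" for z a
    by (rule N.chart_vector_in[OF U'(1) pt(1)[OF that]])
  have smP: "smooth_on ?S (\<lambda>z. P z a)" for a
    unfolding P_def
  proof (rule smooth_on_Pair[OF o])
    show "smooth_on ?S (\<lambda>z. chart_components \<phi> (D (?i z) (?c z a) eta))"
    proof (rule smooth_on_local)
      fix z assume z: "z \<in> ?S"
      show "\<exists>T. open T \<and> z \<in> T \<and> smooth_on T (\<lambda>z. chart_components \<phi> (D (?i z) (?c z a) eta))"
        using smooth_near_D_chart_vector[OF U(1) pt(1)[OF z], of a]
        unfolding N.snear_iff[OF U'(1) pt(1)[OF z]] using f_inv_into_f[OF z] by auto
    qed
  qed simp
  have smb: "smooth_on ?S b"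
    unfolding b_def
  proof (rule smooth_on_Pair[OF o _ smooth_on_const])
    show "smooth_on ?S (\<lambda>z. chart_components \<phi> (X (?i z)))"
    proof (rule smooth_on_local)
      fix z assume z: "z \<in> ?S"
      show "\<exists>T. open T \<and> z \<in> T \<and> smooth_on T (\<lambda>z. chart_components \<phi> (X (?i z)))"
        using pull.field_along_components[OF X[unfolded pi_vector_field_iff] pt(2)[OF z] U(1) pt(3)[OF z]]
        unfolding N.snear_iff[OF U'(1) pt(1)[OF z]] using f_inv_into_f[OF z] by auto
    qed
  qed
  have lin: "linear (P z)" if z: "z \<in> ?S" for z
  proof (rule linearI)
    fix a a' show "P z (a + a') = P z a + P z a'"
      using D_add_left[OF pt(2)[OF z] ct[OF z] pi_field_eta ct[OF z]] N.chart_vector_add[OF U'(1) pt(1)[OF z]]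
      by (simp add: P_def)
  next
    fix r a show "P z (r *\<^sub>R a) = r *\<^sub>R P z a"
      using D_vscale_left[OF pt(2)[OF z] ct[OF z] pi_field_eta] N.chart_vector_scale[OF U'(1) pt(1)[OF z]]
      by (simp add: P_def)
  qed
  \<comment> \<open>The kernel of \<open>P z\<close> is the intersection of vertical and horizontal
    space, which is zero by regularity.\<close>
  have inj: "inj (P z)" if z: "z \<in> ?S" for z
    unfolding linear_injective_0[OF lin[OF z]]
  proof (intro allI impI)
    fix a assume a: "P z a = 0"
    have "D (?i z) (?c z a) eta = 0"
      using a tangent_0_iff_components[OF U(1) pt(3)[OF z] D_tangent[OF pt(2)[OF z] ct[OF z] pi_field_eta]]
      by (simp add: P_def zero_prod_def)
    then have "?c z a \<in> horizontal M D (?i z)" using ct[OF z] by (simp add: horizontal_def)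
    moreover have "differential M fst (?i z) (?c z a) = 0"
      unfolding differential_chart_vector[OF U(1) pt(1)[OF z]]
      using a components_chart_vector[OF U(1) pt(3)[OF z], of "0"] tangent_0_iff_components[OF U(1) pt(3)[OF z] chart_vector_in[OF U(1) pt(3)[OF z]]]
      by (simp add: P_def zero_prod_def)
    ultimately have "?c z a = 0" by (rule horizontal_vertical_0[OF pt(2)[OF z]])
    then show "a = 0" using N.components_chart_vector[OF U'(1) pt(1)[OF z], of a] by simp
  qed
  have sol: "P z (w z) = b z" if z: "z \<in> ?S" for z
  proof -
    note Xt = pi_tangent[OF X pt(2)[OF z]]
    have c: "?c z (w z) = beta M D X (?i z)"
      unfolding w_def by (rule N.chart_vector_components[OF U'(1) pt(1)[OF z] beta_tangent[where X=X, OF pt(2)[OF z] Xt]])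
    have "chart_vector M U \<phi> (fst (?i z)) (fst (w z)) = X (?i z)"
      using differential_chart_vector[OF U(1) pt(1)[OF z], of "w z"] beta_horizontal(2)[where X=X, OF pt(2)[OF z] Xt] by (simp add: c)
    then have "fst (w z) = chart_components \<phi> (X (?i z))"
      using components_chart_vector[OF U(1) pt(3)[OF z]] by metis
    then show ?thesis using c cov_beta_eta[where X=X, OF pt(2)[OF z] Xt] by (simp add: P_def b_def cov_def)
  qed
  have "smooth_on ?S w" by (rule smooth_on_linear_solution[OF o lin inj smP smb sol])
  then have "N.snear u (\<lambda>u. chart_components (slit_chart \<phi>) (beta M D X u))"
    unfolding N.snear_iff[OF U'] w_def using o U(2) by (intro exI[of _ ?S]) auto
  then show "\<exists>V \<psi>. (V, \<psi>) \<in> slit M \<and> u \<in> V \<and> (\<forall>b\<in>Basis. (\<lambda>u. beta M D X u (\<lambda>q. \<psi> q \<bullet> b)) \<in> smooth_near (slit M) u)"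
    using U' by (intro exI[of _ "slit_dom U"] exI[of _ "slit_chart \<phi>"]) (simp add: N.snear_def chart_components_inner)
qed

end

subsection \<open>The Finsler metric\<close>

text \<open>Both sides of the homogeneity relation are differentiated in direction
  \<open>(0, w)\<close>; the scaling inside contributes one factor \<open>c\<close>, which
  cancels.\<close>

lemma homogeneous_fibre_derivative:
  fixes F :: "'e::euclidean_space \<times> 'e \<Rightarrow> real"
  assumes S: "open S" and F: "smooth_on (S \<times> - {0}) F"
    and hom: "\<And>x y c. \<lbrakk>x \<in> S; y \<noteq> 0; c > 0\<rbrakk> \<Longrightarrow>
      F (x, c *\<^sub>R y) = c ^ Suc m * F (x, y)"
    and xy: "x \<in> S" "y \<noteq> 0" "c > 0"
  shows "\<D> F (x, c *\<^sub>R y) (0, w) = c ^ m * \<D> F (x, y) (0, w)"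
proof -
  let ?S = "S \<times> - {0 :: 'e}"
  have o: "open ?S" using S by (auto intro!: open_Times)
  have d: "(F has_derivative \<D> F z) (at z)" if "z \<in> ?S" for z
    by (rule smooth_on_has_derivative[OF F that])
  have "((\<lambda>z. (fst z, c *\<^sub>R snd z)) has_derivative (\<lambda>z. (fst z, c *\<^sub>R snd z))) (at (x, y))"
    by (auto intro!: derivative_eq_intros)
  moreover have "(F has_derivative \<D> F (x, c *\<^sub>R y)) (at (fst (x, y), c *\<^sub>R snd (x, y)))"
    using d[of "(x, c *\<^sub>R y)"] xy by simp
  ultimately have 1: "((\<lambda>z. F (fst z, c *\<^sub>R snd z)) has_derivative (\<lambda>z. \<D> F (x, c *\<^sub>R y) (fst z, c *\<^sub>R snd z))) (at (x, y))"
    by (rule has_derivative_compose)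
  have "((\<lambda>z. c ^ Suc m * F z) has_derivative (\<lambda>z. c ^ Suc m * \<D> F (x, y) z)) (at (x, y))"
    by (rule has_derivative_mult_right[OF d]) (use xy in simp)
  then have "((\<lambda>z. F (fst z, c *\<^sub>R snd z)) has_derivative (\<lambda>z. c ^ Suc m * \<D> F (x, y) z)) (at (x, y))"
  proof (rule has_derivative_transform_within_open[OF _ o])
    fix z assume "z \<in> ?S"
    then have "fst z \<in> S" "snd z \<noteq> 0" by (auto simp: mem_Times_iff)
    then show "c ^ Suc m * F z = F (fst z, c *\<^sub>R snd z)"
      using hom[of "fst z" "snd z" c] xy(3) by simp
  qed (use xy in simp)
  from fun_cong[OF has_derivative_unique[OF 1 this], of "(0, w)"]
  have "\<D> F (x, c *\<^sub>R y) (c *\<^sub>R (0, w)) = c ^ Suc m * \<D> F (x, y) (0, w)" by simp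
  moreover have "linear (\<D> F (x, c *\<^sub>R y))"
    using d[of "(x, c *\<^sub>R y)"] xy by (auto intro: has_derivative_linear)
  ultimately show ?thesis using xy(3) by (simp add: linear_scale del: scaleR_Pair)
qed

locale finsler_bundle = slit_bundle M for M :: "('a, 'e::euclidean_space) atlas" +
  fixes L :: "'a tpoint \<Rightarrow> real"
  assumes finsler: "finsler_manifold M L"
begin

definition energy :: "'a set \<Rightarrow> ('a \<Rightarrow> 'e) \<Rightarrow> 'e \<times> 'e \<Rightarrow> real" where
  "energy U \<phi> z = (1/2) * (L (inv_into U \<phi> (fst z), chart_vector M U \<phi> (inv_into U \<phi> (fst z)) (snd z)))\<^sup>2"

text \<open>The order of differentiation is that of \<open>fibre_hessian\<close>: the inner
  derivative belongs to the second argument.\<close>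

definition hessian :: "'a set \<Rightarrow> ('a \<Rightarrow> 'e) \<Rightarrow> 'e \<Rightarrow> 'e \<Rightarrow> 'e \<times> 'e \<Rightarrow> real" where
  "hessian U \<phi> v w z = \<D> (\<lambda>z. \<D> (energy U \<phi>) z (0, w)) z (0, v)"

text \<open>The fibre derivative of the metric coefficients, that is, twice the Cartan tensor in its
  usual normalisation \<open>C_ijk = (1/2) dg_ij/dy^k\<close>.\<close>

definition cartan_tensor :: "'a set \<Rightarrow> ('a \<Rightarrow> 'e) \<Rightarrow> 'e \<times> 'e \<Rightarrow> 'e \<Rightarrow> 'e \<Rightarrow> 'e \<Rightarrow> real" where
  "cartan_tensor U \<phi> z x v w = \<D> (hessian U \<phi> v w) z (0, x)"

context
  fixes U \<phi> assumes U: "(U, \<phi>) \<in> M"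
begin

abbreviation (input) "\<Omega> \<equiv> \<phi> ` U \<times> - {0 :: 'e}"

lemma open_\<Omega>: "open \<Omega>" using open_image[OF U] by (auto intro!: open_Times)

lemma slit_chart_\<Omega>: "u \<in> slit_dom U \<Longrightarrow> slit_chart \<phi> u \<in> \<Omega>"
  using slit_chart_image[OF U] by blast

lemma smooth_energy: "smooth_on \<Omega> (energy U \<phi>)"
proof -
  have "smooth_on \<Omega> (L \<circ> inv_into (slit_dom U) (slit_chart \<phi>))"
    using finsler slit_chart_in[OF U] slit_chart_image[OF U] by (auto simp: finsler_manifold_def smooth_fun_def)
  then have "smooth_on \<Omega> (\<lambda>z. L (inv_into U \<phi> (fst z), chart_vector M U \<phi> (inv_into U \<phi> (fst z)) (snd z)))"
  proof (rule smooth_on_transform[OF _ open_\<Omega>])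
    fix z assume "z \<in> \<Omega>"
    then have "fst z \<in> \<phi> ` U" "snd z \<noteq> 0" by (auto simp: mem_Times_iff)
    then show "(L \<circ> inv_into (slit_dom U) (slit_chart \<phi>)) z = L (inv_into U \<phi> (fst z), chart_vector M U \<phi> (inv_into U \<phi> (fst z)) (snd z))"
      using inv_slit_chart[OF U, of "fst z" "snd z"] by simp
  qed
  from smooth_on_mult[OF open_\<Omega> smooth_on_const[of _ "1/2"] smooth_on_mult[OF open_\<Omega> this this]]
  show ?thesis by (rule smooth_on_transform[OF _ open_\<Omega>]) (simp add: energy_def power2_eq_square)
qed

lemma smooth_energy_deriv: "smooth_on \<Omega> (\<lambda>z. \<D> (energy U \<phi>) z (0, w))"
  by (rule smooth_on_deriv[OF smooth_energy])

lemma smooth_hessian: "smooth_on \<Omega> (hessian U \<phi> v w)"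
  using smooth_on_deriv[OF smooth_energy_deriv] unfolding hessian_def[abs_def] by blast

lemma hessian_sym: "z \<in> \<Omega> \<Longrightarrow> hessian U \<phi> v w z = hessian U \<phi> w v z"
  unfolding hessian_def by (rule second_derivative_symmetric[OF open_\<Omega> smooth_energy])

lemma hessian_linear: "z \<in> \<Omega> \<Longrightarrow> linear (\<lambda>v. hessian U \<phi> v w z)"
proof -
  assume "z \<in> \<Omega>"
  then have "linear (\<D> (\<lambda>z. \<D> (energy U \<phi>) z (0, w)) z)"
    by (intro linear_frechet_derivative smooth_on_differentiable[OF smooth_energy_deriv])
  then have "linear (\<D> (\<lambda>z. \<D> (energy U \<phi>) z (0, w)) z \<circ> (\<lambda>v. (0, v)))"
    by (intro linear_compose) (auto intro!: linearI)
  then show ?thesis by (simp add: hessian_def o_def)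
qed

lemma hessian_expand:
  assumes z: "z \<in> \<Omega>"
  shows "hessian U \<phi> v w z = (\<Sum>i\<in>Basis. \<Sum>j\<in>Basis. (v \<bullet> i) * (w \<bullet> j) * hessian U \<phi> i j z)"
proof -
  have e: "hessian U \<phi> v w z = (\<Sum>i\<in>Basis. (v \<bullet> i) * hessian U \<phi> i w z)" for v w
  proof -
    have "hessian U \<phi> v w z = hessian U \<phi> (\<Sum>i\<in>Basis. (v \<bullet> i) *\<^sub>R i) w z" by (simp add: euclidean_representation)
    then show ?thesis by (simp only: linear_sum[OF hessian_linear[OF z]] linear_scale[OF hessian_linear[OF z]] real_scaleR_def)
  qed
  have "hessian U \<phi> i w z = (\<Sum>j\<in>Basis. (w \<bullet> j) * hessian U \<phi> i j z)" for i
    unfolding hessian_sym[OF z, of i] by (rule e)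
  then show ?thesis unfolding e[of v w] by (simp add: sum_distrib_left mult.assoc)
qed

text \<open>The exponent is written as \<open>Suc 1\<close> because two applications of
  \<open>homogeneous_fibre_derivative\<close> lower it to 0.\<close>

lemma energy_homogeneous:
  assumes "x \<in> \<phi> ` U" "c > 0" shows "energy U \<phi> (x, c *\<^sub>R y) = c ^ Suc 1 * energy U \<phi> (x, y)"
proof -
  have p: "inv_into U \<phi> x \<in> U" using assms(1) by (rule inv_into_into)
  have "(inv_into U \<phi> x, chart_vector M U \<phi> (inv_into U \<phi> x) y) \<in> carrier (tangent_bundle M)"
    using chart_vector_in[OF U p] U p
    by (auto simp: carrier_def tangent_bundle_def intro!: bexI[of _ "(U, \<phi>)"])
  then have "L (inv_into U \<phi> x, vscale c (chart_vector M U \<phi> (inv_into U \<phi> x) y)) = c * L (inv_into U \<phi> x, chart_vector M U \<phi> (inv_into U \<phi> x) y)"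
    using finsler assms(2) unfolding finsler_manifold_def by blast
  then show ?thesis by (simp add: energy_def chart_vector_scale[OF U p] power_mult_distrib power2_eq_square)
qed

lemma hessian_homogeneous:
  assumes "x \<in> \<phi> ` U" "y \<noteq> 0" "c > 0" shows "hessian U \<phi> v w (x, c *\<^sub>R y) = hessian U \<phi> v w (x, y)"
proof -
  have "\<D> (energy U \<phi>) (x, c *\<^sub>R y) (0, w) = c ^ Suc 0 * \<D> (energy U \<phi>) (x, y) (0, w)"
    if "x \<in> \<phi> ` U" "y \<noteq> 0" "c > 0" for x y c
    using homogeneous_fibre_derivative[OF open_image[OF U] smooth_energy, of 1 x y c w] energy_homogeneous that by simp
  from homogeneous_fibre_derivative[OF open_image[OF U] smooth_energy_deriv this assms]
  show ?thesis by (simp add: hessian_def)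
qed

text \<open>Exchanges the outer two of the three derivatives. Together with
  \<open>cartan_tensor_sym2\<close>, which exchanges the inner two, it generates all
  permutations.\<close>

lemma cartan_tensor_sym1:
  "z \<in> \<Omega> \<Longrightarrow> cartan_tensor U \<phi> z x v w = cartan_tensor U \<phi> z v x w"
  unfolding cartan_tensor_def hessian_def[abs_def]
  by (rule second_derivative_symmetric[OF open_\<Omega> smooth_energy_deriv])

lemma cartan_tensor_sym2:
  "z \<in> \<Omega> \<Longrightarrow> cartan_tensor U \<phi> z x v w = cartan_tensor U \<phi> z x w v"
  unfolding cartan_tensor_def
  by (subst frechet_derivative_transform_within_open[OF smooth_on_differentiable[OF smooth_hessian] open_\<Omega>, of z v w "hessian U \<phi> w v"])
     (auto intro: hessian_sym)

lemma cartan_tensor_eta: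
  assumes "z \<in> \<Omega>" shows "cartan_tensor U \<phi> z (snd z) v w = 0"
proof -
  have z: "fst z \<in> \<phi> ` U" "snd z \<noteq> 0" using assms by (auto simp: mem_Times_iff)
  have "(hessian U \<phi> v w has_derivative \<D> (hessian U \<phi> v w) z) (at (z + 0 *\<^sub>R (0, snd z)))"
    using smooth_on_has_derivative[OF smooth_hessian assms] by (simp only: scaleR_zero_left add_0_right)
  from has_real_derivative_along_line[OF this]
  have 1: "((\<lambda>t. hessian U \<phi> v w (z + t *\<^sub>R (0, snd z))) has_real_derivative cartan_tensor U \<phi> z (snd z) v w) (at 0)"
    by (simp add: cartan_tensor_def)
  have "((\<lambda>t. hessian U \<phi> v w z) has_real_derivative 0) (at (0::real))" by simp
  then have "((\<lambda>t. hessian U \<phi> v w (z + t *\<^sub>R (0, snd z))) has_real_derivative 0) (at 0)"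
  \<comment> \<open>For \<open>t > -1\<close> the vector \<open>(1 + t) y\<close> is a positive
    multiple of \<open>y\<close>, and homogeneity applies.\<close>
  proof (rule has_field_derivative_transform_within_open[where S="{-1<..}"])
    fix t :: real assume "t \<in> {-1<..}"
    then have "hessian U \<phi> v w (fst z, (1 + t) *\<^sub>R snd z) = hessian U \<phi> v w (fst z, snd z)"
      using z by (intro hessian_homogeneous) auto
    moreover have "z + t *\<^sub>R (0, snd z) = (fst z, (1 + t) *\<^sub>R snd z)"
      by (simp add: prod_eq_iff scaleR_add_left)
    ultimately show "hessian U \<phi> v w z = hessian U \<phi> v w (z + t *\<^sub>R (0, snd z))" by simp
  qed auto
  then show ?thesis using 1 DERIV_unique by blast
qed

text \<open>Both one-variable derivatives run along straight lines in the fibre coordinates, so each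
  is a directional derivative of the energy or of its derivative.\<close>

lemma fibre_hessian_chart:
  assumes u: "u \<in> slit_dom U" and v: "v \<in> tangent_space M (fst u)" and w: "w \<in> tangent_space M (fst u)"
  shows "fibre_hessian L u v w = hessian U \<phi> (chart_components \<phi> v) (chart_components \<phi> w) (slit_chart \<phi> u)"
proof -
  let ?v = "chart_components \<phi> v" and ?w = "chart_components \<phi> w" and ?z = "slit_chart \<phi> u"
  let ?D = "\<lambda>z. \<D> (energy U \<phi>) z (0, ?w)"
  have p: "fst u \<in> U" "snd u \<in> tangent_space M (fst u)" using u by (simp_all add: slit_dom_iff)
  note c = chart_vector_components[OF U p(1)]
  have eq: "(1/2) * (L (fst u, snd u + vscale s v + vscale t w))\<^sup>2 = energy U \<phi> (?z + s *\<^sub>R (0, ?v) + t *\<^sub>R (0, ?w))" for s t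
    using c[OF p(2)] c[OF v] c[OF w]
    by (simp add: energy_def slit_chart_def case_prod_beta U p(1) chart_vector_add[OF U p(1)] chart_vector_scale[OF U p(1)])
  \<comment> \<open>The inner derivative is evaluated only where the shifted vector is nonzero; this
    holds for \<open>s\<close> near 0, which suffices for the outer derivative.\<close>
  define R where "R = {s. chart_components \<phi> (snd u) + s *\<^sub>R ?v \<noteq> 0}"
  have R: "open R" "0 \<in> R" using components_nonzero[OF U u]
    by (auto simp: R_def intro!: open_Collect_neq continuous_intros)
  have inner: "deriv (\<lambda>t. (1/2) * (L (fst u, snd u + vscale s v + vscale t w))\<^sup>2) 0 = ?D (?z + s *\<^sub>R (0, ?v))" if "s \<in> R" for s
  proof -
    have "?z + s *\<^sub>R (0, ?v) \<in> \<Omega>" using that p(1) by (simp add: slit_chart_def case_prod_beta R_def)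
    then have "(energy U \<phi> has_derivative \<D> (energy U \<phi>) (?z + s *\<^sub>R (0, ?v))) (at (?z + s *\<^sub>R (0, ?v) + 0 *\<^sub>R (0, ?w)))"
      using smooth_on_has_derivative[OF smooth_energy] by (simp only: scaleR_zero_left add_0_right)
    from has_real_derivative_along_line[OF this] show ?thesis unfolding eq by (rule DERIV_imp_deriv)
  qed
  have "(?D has_derivative \<D> ?D ?z) (at (?z + 0 *\<^sub>R (0, ?v)))"
    using smooth_on_has_derivative[OF smooth_energy_deriv slit_chart_\<Omega>[OF u]] by (simp only: scaleR_zero_left add_0_right)
  from has_real_derivative_along_line[OF this]
  have "((\<lambda>s. ?D (?z + s *\<^sub>R (0, ?v))) has_real_derivative hessian U \<phi> ?v ?w ?z) (at 0)"
    by (simp add: hessian_def)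
  then have "((\<lambda>s. deriv (\<lambda>t. (1/2) * (L (fst u, snd u + vscale s v + vscale t w))\<^sup>2) 0) has_real_derivative hessian U \<phi> ?v ?w ?z) (at 0)"
    by (rule has_field_derivative_transform_within_open[OF _ R]) (simp only: inner)
  then show ?thesis unfolding fibre_hessian_def by (rule DERIV_imp_deriv)
qed

end

section \<open>The metric on pi-vector fields and its derivative along the fibres\<close>

lemma fibre_hessian_sym:
  assumes "u \<in> TM0" "v \<in> tangent_space M (fst u)" "w \<in> tangent_space M (fst u)"
  shows "fibre_hessian L u v w = fibre_hessian L u w v"
proof -
  obtain U \<phi> where U: "(U, \<phi>) \<in> M" "u \<in> slit_dom U" using assms(1) slit_carrierE by blast
  show ?thesis
    unfolding fibre_hessian_chart[OF U assms(2,3)] fibre_hessian_chart[OF U assms(3,2)]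
    by (rule hessian_sym[OF U(1) slit_chart_\<Omega>[OF U]])
qed

lemma fibre_hessian_add:
  assumes "u \<in> TM0" "v \<in> tangent_space M (fst u)" "v' \<in> tangent_space M (fst u)" "w \<in> tangent_space M (fst u)"
  shows "fibre_hessian L u (v + v') w = fibre_hessian L u v w + fibre_hessian L u v' w"
proof -
  obtain U \<phi> where U: "(U, \<phi>) \<in> M" "u \<in> slit_dom U" using assms(1) slit_carrierE by blast
  have "v + v' \<in> tangent_space M (fst u)" using assms by (intro tangent_add) (simp_all add: carrier_slit)
  then show ?thesis
    using linear_add[OF hessian_linear[OF U(1) slit_chart_\<Omega>[OF U]]]
    by (simp add: fibre_hessian_chart[OF U] assms)
qed

lemma fibre_hessian_definite:
  assumes "u \<in> TM0" "v \<in> tangent_space M (fst u)" "fibre_hessian L u v v = 0"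
  shows "v = 0"
  using finsler assms unfolding finsler_manifold_def by force

text \<open>Expanding into products of real functions lets tangent vectors act by the sum and
  product rules.\<close>

lemma finsler_metric_chart:
  assumes "pfield Y" "pfield Z" and U: "(U, \<phi>) \<in> M" "u \<in> slit_dom U"
  shows "finsler_metric L Y Z u =
    (\<Sum>i\<in>Basis. \<Sum>j\<in>Basis. Y u (\<lambda>q. \<phi> q \<bullet> i) * Z u (\<lambda>q. \<phi> q \<bullet> j) * hessian U \<phi> i j (slit_chart \<phi> u))"
proof -
  have u: "u \<in> TM0" by (rule N.carrierI[OF slit_chart_in[OF U(1)] U(2)])
  show ?thesis
    unfolding finsler_metric_def fibre_hessian_chart[OF U pi_tangent[OF assms(1) u] pi_tangent[OF assms(2) u]]
      hessian_expand[OF U(1) slit_chart_\<Omega>[OF U], of "chart_components \<phi> (Y u)"]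
    by (simp add: chart_components_inner)
qed

context
  fixes U \<phi> u assumes U: "(U, \<phi>) \<in> M" "u \<in> slit_dom U"
begin

lemma coefficient_smooth_near:
  assumes Y: "pfield Y" and "i \<in> Basis"
  shows "(\<lambda>u. Y u (\<lambda>q. \<phi> q \<bullet> i)) \<in> smooth_near (slit M) u"
  using pi_smooth[OF Y N.carrierI[OF slit_chart_in[OF U(1)] U(2)] chart_coordinate[OF U(1) _ assms(2)]] U(2)
  by (simp add: slit_dom_iff)

lemma hessian_smooth_near: "(\<lambda>u. hessian U \<phi> i j (slit_chart \<phi> u)) \<in> smooth_near (slit M) u"
  using N.snear_compose[OF N.snear_chart[OF slit_chart_in[OF U(1)] U(2)] smooth_hessian[OF U(1)] open_\<Omega>[OF U(1)]
    slit_chart_\<Omega>[OF U] N.carrierI[OF slit_chart_in[OF U(1)] U(2)]] by simp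

end

lemma finsler_metric_smooth_near:
  assumes Y: "pfield Y" and Z: "pfield Z" and u: "u \<in> TM0"
  shows "finsler_metric L Y Z \<in> smooth_near (slit M) u"
proof -
  obtain U \<phi> where U: "(U, \<phi>) \<in> M" "u \<in> slit_dom U" using u slit_carrierE by blast
  have "(\<lambda>u. \<Sum>i\<in>Basis. \<Sum>j\<in>Basis. Y u (\<lambda>q. \<phi> q \<bullet> i) * Z u (\<lambda>q. \<phi> q \<bullet> j) * hessian U \<phi> i j (slit_chart \<phi> u)) \<in> smooth_near (slit M) u"
    by (intro N.smooth_near_sum u N.smooth_near_mult coefficient_smooth_near[OF U Y] coefficient_smooth_near[OF U Z] hessian_smooth_near[OF U])
  then show ?thesis
    by (rule N.smooth_near_transform)
       (use N.eventually_in_chart[OF slit_chart_in[OF U(1)] U(2)] in eventually_elim, simp add: finsler_metric_chart[OF Y Z U(1)])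
qed

text \<open>\<open>c\<close> is the third fibre derivative of \<open>L\<^sup>2/2\<close>; its contraction with \<open>\<eta>\<close> vanishes because the
  Hessian is homogeneous of degree \<open>0\<close>.\<close>

lemma metric_fibre_derivative:
  assumes u: "u \<in> TM0"
  obtains c :: "'a tvec \<Rightarrow> 'a tvec \<Rightarrow> 'a tvec \<Rightarrow> real" where
    "\<And>x y z. c x y z = c y x z" "\<And>x y z. c x y z = c x z y" "\<And>y z. c (eta u) y z = 0"
    "\<And>X Y Z y z. \<lbrakk>pfield X; pfield Y; pfield Z; y \<in> tangent_space M (fst u);
      z \<in> tangent_space M (fst u);
      (\<And>f. f \<in> smooth_near M (fst u) \<Longrightarrow> y f = gamma M X u (\<lambda>u. Y u f));
      (\<And>f. f \<in> smooth_near M (fst u) \<Longrightarrow> z f = gamma M X u (\<lambda>u. Z u f))\<rbrakk> \<Longrightarrow>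
      gamma M X u (finsler_metric L Y Z) =
        fibre_hessian L u y (Z u) + fibre_hessian L u (Y u) z + c (X u) (Y u) (Z u)"
proof -
  obtain U \<phi> where U: "(U, \<phi>) \<in> M" "u \<in> slit_dom U" using u slit_carrierE by blast
  note U' = slit_chart_in[OF U(1)] U(2)
  have p: "fst u \<in> U" using U by (simp add: slit_dom_iff)
  let ?z = "slit_chart \<phi> u" and ?k = "chart_components \<phi>" and ?H = "hessian U \<phi>"
  note z\<Omega> = slit_chart_\<Omega>[OF U]
  define c where "c x y z = cartan_tensor U \<phi> ?z (?k x) (?k y) (?k z)" for x y z
  show ?thesis
  proof (rule that[of c])
    show "c x y z = c y x z" "c x y z = c x z y" for x y z
      unfolding c_def by (rule cartan_tensor_sym1[OF U(1) z\<Omega>] cartan_tensor_sym2[OF U(1) z\<Omega>])+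
    show "c (eta u) y z = 0" for y z
      using cartan_tensor_eta[OF U(1) z\<Omega>] by (simp add: c_def eta_def slit_chart_def case_prod_beta)
    fix X Y Z y z
    \<comment> \<open>\<open>y\<close> and \<open>z\<close> are the derivatives of \<open>Y\<close>
      and \<open>Z\<close> by components along the fibre; they will be instantiated with D0_X Y and
      D0_X Z.\<close>
    assume X: "pfield X" and Y: "pfield Y" and Z: "pfield Z"
      and y: "y \<in> tangent_space M (fst u)" and z: "z \<in> tangent_space M (fst u)"
      and dy: "\<And>f. f \<in> smooth_near M (fst u) \<Longrightarrow> y f = gamma M X u (\<lambda>u. Y u f)"
      and dz: "\<And>f. f \<in> smooth_near M (fst u) \<Longrightarrow> z f = gamma M X u (\<lambda>u. Z u f)"
    let ?a = "gamma M X u"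
    have a: "?a \<in> tangent_space (slit M) u" by (rule gamma_tangent[where X=X, OF u pi_tangent[OF X u]])
    let ?Y = "\<lambda>i u. Y u (\<lambda>q. \<phi> q \<bullet> i)" and ?Z = "\<lambda>i u. Z u (\<lambda>q. \<phi> q \<bullet> i)" and ?h = "\<lambda>i j u. ?H i j (slit_chart \<phi> u)"
    note sY = coefficient_smooth_near[OF U Y] and sZ = coefficient_smooth_near[OF U Z] and sH = hessian_smooth_near[OF U]
    \<comment> \<open>The vertical lift has components \<open>(0, ?k (X u))\<close>, so it
      differentiates the Hessian coefficients in fibre directions only.\<close>
    have ah: "?a (?h i j) = \<D> (?H i j) ?z (0, ?k (X u))" for i j
    proof -
      have "(\<Sum>b\<in>Basis. ?a (\<lambda>q. slit_chart \<phi> q \<bullet> b) *\<^sub>R b) = (0, ?k (X u))"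
        using N.components_chart_vector[OF U', of "(0, ?k (X u))"] gamma_chart[where X=X, OF U pi_tangent[OF X u]]
        by (simp add: chart_components_def[of "slit_chart \<phi>"])
      then show ?thesis
        using N.tangent_apply_smooth_compose[OF u a N.snear_chart[OF U'] smooth_hessian[OF U(1)] open_\<Omega>[OF U(1)] z\<Omega>] by metis
    qed
    have "?a (finsler_metric L Y Z) = ?a (\<lambda>u. \<Sum>i\<in>Basis. \<Sum>j\<in>Basis. ?Y i u * ?Z j u * ?h i j u)"
      by (rule N.tangent_apply_cong[OF u a])
         (use N.eventually_in_chart[OF U'] in eventually_elim, simp add: finsler_metric_chart[OF Y Z U(1)])
    also have "\<dots> = (\<Sum>i\<in>Basis. \<Sum>j\<in>Basis. ?a (\<lambda>u. ?Y i u * ?Z j u * ?h i j u))"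
      by (simp add: N.tangent_apply_sum[OF u a] N.smooth_near_sum[OF u] N.smooth_near_mult sY sZ sH)
    also have "\<dots> = (\<Sum>i\<in>Basis. \<Sum>j\<in>Basis. y (\<lambda>q. \<phi> q \<bullet> i) * ?Z j u * ?h i j u + ?Y i u * z (\<lambda>q. \<phi> q \<bullet> j) * ?h i j u
        + ?Y i u * ?Z j u * \<D> (?H i j) ?z (0, ?k (X u)))"
      by (intro sum.cong refl)
         (simp add: N.tangent_apply_mult[OF u a] N.smooth_near_mult sY sZ sH ah dy dz chart_coordinate[OF U(1) p] algebra_simps)
    also have "\<dots> = (\<Sum>i\<in>Basis. \<Sum>j\<in>Basis. y (\<lambda>q. \<phi> q \<bullet> i) * ?Z j u * ?h i j u)
        + (\<Sum>i\<in>Basis. \<Sum>j\<in>Basis. ?Y i u * z (\<lambda>q. \<phi> q \<bullet> j) * ?h i j u)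
        + (\<Sum>i\<in>Basis. \<Sum>j\<in>Basis. ?Y i u * ?Z j u * \<D> (?H i j) ?z (0, ?k (X u)))"
      by (simp add: sum.distrib)
    also have "(\<Sum>i\<in>Basis. \<Sum>j\<in>Basis. y (\<lambda>q. \<phi> q \<bullet> i) * ?Z j u * ?h i j u) = fibre_hessian L u y (Z u)"
      unfolding fibre_hessian_chart[OF U y pi_tangent[OF Z u]] hessian_expand[OF U(1) z\<Omega>, of "?k y"]
      by (simp add: chart_components_inner)
    also have "(\<Sum>i\<in>Basis. \<Sum>j\<in>Basis. ?Y i u * z (\<lambda>q. \<phi> q \<bullet> j) * ?h i j u) = fibre_hessian L u (Y u) z"
      unfolding fibre_hessian_chart[OF U pi_tangent[OF Y u] z] hessian_expand[OF U(1) z\<Omega>, of "?k (Y u)"]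
      by (simp add: chart_components_inner)
    also have "(\<Sum>i\<in>Basis. \<Sum>j\<in>Basis. ?Y i u * ?Z j u * \<D> (?H i j) ?z (0, ?k (X u))) = c (X u) (Y u) (Z u)"
    proof -
      let ?v = "?k (Y u)" and ?w = "?k (Z u)"
      have "((\<lambda>x. \<Sum>i\<in>Basis. \<Sum>j\<in>Basis. (?v \<bullet> i) * (?w \<bullet> j) * ?H i j x) has_derivative
          (\<lambda>t. \<Sum>i\<in>Basis. \<Sum>j\<in>Basis. (?v \<bullet> i) * (?w \<bullet> j) * \<D> (?H i j) ?z t)) (at ?z)"
        by (intro has_derivative_sum has_derivative_mult_right smooth_on_has_derivative[OF smooth_hessian[OF U(1)] z\<Omega>])
      then have "(?H ?v ?w has_derivative
          (\<lambda>t. \<Sum>i\<in>Basis. \<Sum>j\<in>Basis. (?v \<bullet> i) * (?w \<bullet> j) * \<D> (?H i j) ?z t)) (at ?z)"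
        by (rule has_derivative_transform_within_open[OF _ open_\<Omega>[OF U(1)] z\<Omega>])
           (rule hessian_expand[OF U(1), symmetric])
      from fun_cong[OF frechet_derivative_at[OF this], of "(0, ?k (X u))"]
      show ?thesis by (simp add: c_def cartan_tensor_def chart_components_inner)
    qed
    finally show "?a (finsler_metric L Y Z) = fibre_hessian L u y (Z u) + fibre_hessian L u (Y u) z + c (X u) (Y u) (Z u)" .
  qed
qed

end

subsection \<open>The algebra of a Cartan connection\<close>

text \<open>\<open>VF\<close> stands for the vector fields on the slit bundle, \<open>PF\<close> for the \<open>\<pi>\<close>-vector fields and \<open>FF\<close> for
  the smooth functions.\<close>

locale cartan_algebra =
  fixes VF :: "'v::ab_group_add set" and PF :: "'p::ab_group_add set" and FF :: "('q \<Rightarrow> real) set"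
    and br :: "'v \<Rightarrow> 'v \<Rightarrow> 'v" and nab :: "'v \<Rightarrow> 'p \<Rightarrow> 'p" and act :: "'v \<Rightarrow> ('q \<Rightarrow> real) \<Rightarrow> ('q \<Rightarrow> real)"
    and rho :: "'v \<Rightarrow> 'p" and gam :: "'p \<Rightarrow> 'v" and bet :: "'p \<Rightarrow> 'v" and eta :: 'p
    and g :: "'p \<Rightarrow> 'p \<Rightarrow> ('q \<Rightarrow> real)"
  assumes VF_add [simp]: "A \<in> VF \<Longrightarrow> B \<in> VF \<Longrightarrow> A + B \<in> VF"
    and VF_uminus [simp]: "A \<in> VF \<Longrightarrow> - A \<in> VF"
    and PF_add [simp]: "X \<in> PF \<Longrightarrow> Y \<in> PF \<Longrightarrow> X + Y \<in> PF"
    and PF_uminus [simp]: "X \<in> PF \<Longrightarrow> - X \<in> PF"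
    and br_VF [simp]: "A \<in> VF \<Longrightarrow> B \<in> VF \<Longrightarrow> br A B \<in> VF"
    and nab_PF [simp]: "A \<in> VF \<Longrightarrow> X \<in> PF \<Longrightarrow> nab A X \<in> PF"
    and rho_PF [simp]: "A \<in> VF \<Longrightarrow> rho A \<in> PF"
    and gam_VF [simp]: "X \<in> PF \<Longrightarrow> gam X \<in> VF"
    and bet_VF [simp]: "X \<in> PF \<Longrightarrow> bet X \<in> VF"
    and eta_PF [simp]: "eta \<in> PF"
    and g_FF [simp]: "X \<in> PF \<Longrightarrow> Y \<in> PF \<Longrightarrow> g X Y \<in> FF"
    and br_add: "\<lbrakk>A \<in> VF; B \<in> VF; C \<in> VF\<rbrakk> \<Longrightarrow>
      br A (B + C) = br A B + br A C"
    and br_anti: "A \<in> VF \<Longrightarrow> B \<in> VF \<Longrightarrow> br A B = - br B A"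
    and jacobi: "\<lbrakk>A \<in> VF; B \<in> VF; C \<in> VF\<rbrakk> \<Longrightarrow>
      br A (br B C) + br B (br C A) + br C (br A B) = 0"
    and nab_add_left: "\<lbrakk>A \<in> VF; B \<in> VF; X \<in> PF\<rbrakk> \<Longrightarrow>
      nab (A + B) X = nab A X + nab B X"
    and nab_add: "\<lbrakk>A \<in> VF; X \<in> PF; Y \<in> PF\<rbrakk> \<Longrightarrow>
      nab A (X + Y) = nab A X + nab A Y"
    and rho_add: "A \<in> VF \<Longrightarrow> B \<in> VF \<Longrightarrow> rho (A + B) = rho A + rho B"
    and gam_add: "X \<in> PF \<Longrightarrow> Y \<in> PF \<Longrightarrow> gam (X + Y) = gam X + gam Y"
    and rho_gam [simp]: "X \<in> PF \<Longrightarrow> rho (gam X) = 0"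
    and rho_bet [simp]: "X \<in> PF \<Longrightarrow> rho (bet X) = X"
    and nab_bet_eta [simp]: "X \<in> PF \<Longrightarrow> nab (bet X) eta = 0"
    and nab_gam_eta [simp]: "X \<in> PF \<Longrightarrow> nab (gam X) eta = X"
    and rho_br_gam: "X \<in> PF \<Longrightarrow> Y \<in> PF \<Longrightarrow> rho (br (gam X) (gam Y)) = 0"
    and vertical_horizontal: "\<lbrakk>A \<in> VF; rho A = 0; nab A eta = 0\<rbrakk> \<Longrightarrow>
      A = 0"
    and g_sym: "X \<in> PF \<Longrightarrow> Y \<in> PF \<Longrightarrow> g X Y = g Y X"
    and g_add: "\<lbrakk>X \<in> PF; Y \<in> PF; Z \<in> PF\<rbrakk> \<Longrightarrow>
      g (X + Y) Z = g X Z + g Y Z"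
    and g_definite: "X \<in> PF \<Longrightarrow> g X X = 0 \<Longrightarrow> X = 0"
    and act_add: "\<lbrakk>A \<in> VF; f \<in> FF; h \<in> FF\<rbrakk> \<Longrightarrow>
      act A (f + h) = act A f + act A h"
    and act_br: "\<lbrakk>A \<in> VF; B \<in> VF; f \<in> FF\<rbrakk> \<Longrightarrow>
      act (br A B) f = act A (act B f) - act B (act A f)"
    and metric: "\<lbrakk>A \<in> VF; X \<in> PF; Y \<in> PF\<rbrakk> \<Longrightarrow>
      act A (g X Y) = g (nab A X) Y + g X (nab A Y)"
    and T_adjoint: "\<lbrakk>X \<in> PF; Y \<in> PF; Z \<in> PF\<rbrakk> \<Longrightarrow>
      g (nab (gam X) Y - rho (br (gam X) (bet Y))) Z = g (nab (gam X) Z - rho (br (gam X) (bet Z))) Y"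
    and T_sym': "X \<in> PF \<Longrightarrow> Y \<in> PF \<Longrightarrow>
      nab (gam X) Y - rho (br (gam X) (bet Y)) = nab (gam Y) X - rho (br (gam Y) (bet X))"
    and T_eta': "X \<in> PF \<Longrightarrow> nab (gam X) eta = rho (br (gam X) (bet eta))"
begin

text \<open>The torsion of a vertical and a horizontal lift after \<open>rho (gam X) = 0\<close> and
  \<open>rho (bet Y) = Y\<close>; the assumptions on the torsion are written in the same
  way.\<close>

definition T :: "'p \<Rightarrow> 'p \<Rightarrow> 'p" where "T X Y = nab (gam X) Y - rho (br (gam X) (bet Y))"
definition K :: "'v \<Rightarrow> 'v \<Rightarrow> 'p \<Rightarrow> 'p" where "K A B X = - nab A (nab B X) + nab B (nab A X) + nab (br A B) X"
definition S :: "'p \<Rightarrow> 'p \<Rightarrow> 'p \<Rightarrow> 'p" where "S X Y = K (gam X) (gam Y)"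
definition P :: "'p \<Rightarrow> 'p \<Rightarrow> 'p \<Rightarrow> 'p" where "P X Y = K (bet X) (gam Y)"

section \<open>Additive rules for the operations\<close>

lemma VF_diff [simp]: "A \<in> VF \<Longrightarrow> B \<in> VF \<Longrightarrow> A - B \<in> VF"
  using VF_add[OF _ VF_uminus, of A B] by simp

lemma PF_diff [simp]: "X \<in> PF \<Longrightarrow> Y \<in> PF \<Longrightarrow> X - Y \<in> PF"
  using PF_add[OF _ PF_uminus, of X Y] by simp

lemma PF_0 [simp]: "0 \<in> PF" using PF_diff[OF eta_PF eta_PF] by simp

lemma VF_0 [simp]: "0 \<in> VF" using VF_diff[OF gam_VF[OF eta_PF] gam_VF[OF eta_PF]] by simp

lemma T_PF [simp]: "X \<in> PF \<Longrightarrow> Y \<in> PF \<Longrightarrow> T X Y \<in> PF" by (simp add: T_def)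
lemma K_PF [simp]: "\<lbrakk>A \<in> VF; B \<in> VF; X \<in> PF\<rbrakk> \<Longrightarrow>
      K A B X \<in> PF" by (simp add: K_def)
lemma S_PF [simp]: "\<lbrakk>X \<in> PF; Y \<in> PF; Z \<in> PF\<rbrakk> \<Longrightarrow>
      S X Y Z \<in> PF" by (simp add: S_def)
lemma P_PF [simp]: "\<lbrakk>X \<in> PF; Y \<in> PF; Z \<in> PF\<rbrakk> \<Longrightarrow>
      P X Y Z \<in> PF" by (simp add: P_def)

lemma nab_0 [simp]: "A \<in> VF \<Longrightarrow> nab A 0 = 0"
  using nab_add[of A 0 0] by simp

lemma nab_uminus: "A \<in> VF \<Longrightarrow> X \<in> PF \<Longrightarrow> nab A (- X) = - nab A X"
  using nab_add[of A X "- X"] by (simp add: minus_unique)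

lemma nab_diff: "\<lbrakk>A \<in> VF; X \<in> PF; Y \<in> PF\<rbrakk> \<Longrightarrow>
      nab A (X - Y) = nab A X - nab A Y"
  using nab_add[of A X "- Y"] by (simp add: nab_uminus)

lemma nab_0_left [simp]: "X \<in> PF \<Longrightarrow> nab 0 X = 0"
  using nab_add_left[of 0 0 X] by simp

lemma nab_uminus_left: "A \<in> VF \<Longrightarrow> X \<in> PF \<Longrightarrow> nab (- A) X = - nab A X"
  using nab_add_left[of A "- A" X] by (simp add: minus_unique)

lemma nab_diff_left: "\<lbrakk>A \<in> VF; B \<in> VF; X \<in> PF\<rbrakk> \<Longrightarrow>
      nab (A - B) X = nab A X - nab B X"
  using nab_add_left[of A "- B" X] by (simp add: nab_uminus_left)

lemma br_uminus: "A \<in> VF \<Longrightarrow> B \<in> VF \<Longrightarrow> br A (- B) = - br A B"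
  using br_add[of A B "- B"] br_add[of A 0 0] by (simp add: minus_unique)

lemma br_diff: "\<lbrakk>A \<in> VF; B \<in> VF; C \<in> VF\<rbrakk> \<Longrightarrow>
      br A (B - C) = br A B - br A C"
  using br_add[of A B "- C"] by (simp add: br_uminus)

lemma br_add_left: "\<lbrakk>A \<in> VF; B \<in> VF; C \<in> VF\<rbrakk> \<Longrightarrow>
      br (A + B) C = br A C + br B C"
  using br_anti[of "A + B" C] br_add[of C A B] br_anti[of A C] br_anti[of B C] by simp

lemma br_diff_left: "\<lbrakk>A \<in> VF; B \<in> VF; C \<in> VF\<rbrakk> \<Longrightarrow>
      br (A - B) C = br A C - br B C"
  using br_anti[of "A - B" C] br_diff[of C A B] br_anti[of A C] br_anti[of B C] by simp

lemma rho_uminus: "A \<in> VF \<Longrightarrow> rho (- A) = - rho A"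
  using rho_add[of A "- A"] rho_add[of 0 0] by (simp add: minus_unique)

lemma rho_diff: "A \<in> VF \<Longrightarrow> B \<in> VF \<Longrightarrow> rho (A - B) = rho A - rho B"
  using rho_add[of A "- B"] by (simp add: rho_uminus)

lemma gam_uminus: "X \<in> PF \<Longrightarrow> gam (- X) = - gam X"
  using gam_add[of X "- X"] gam_add[of 0 0] by (simp add: minus_unique)

lemma gam_diff: "X \<in> PF \<Longrightarrow> Y \<in> PF \<Longrightarrow> gam (X - Y) = gam X - gam Y"
  using gam_add[of X "- Y"] by (simp add: gam_uminus)

lemma g_uminus: "X \<in> PF \<Longrightarrow> Z \<in> PF \<Longrightarrow> g (- X) Z = - g X Z"
  using g_add[of X "- X" Z] g_add[of 0 0 Z] by (simp add: eq_neg_iff_add_eq_0)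

lemma g_diff: "\<lbrakk>X \<in> PF; Y \<in> PF; Z \<in> PF\<rbrakk> \<Longrightarrow>
      g (X - Y) Z = g X Z - g Y Z"
  using g_add[of X "- Y" Z] by (simp add: g_uminus)

lemma g_0 [simp]: "Z \<in> PF \<Longrightarrow> g 0 Z = 0" using g_add[of 0 0 Z] by simp

section \<open>Splitting of vector fields and elementary properties of the torsion\<close>

lemma bet_0 [simp]: "bet 0 = 0"
  by (rule vertical_horizontal) simp_all

text \<open>The two sides have the same projection and the same derivative of \<open>eta\<close>,
  and \<open>vertical_horizontal\<close> says that these determine a field. That
  \<open>gam (nab A eta)\<close> is the vertical part rests on \<open>nab_gam_eta\<close>.\<close>

lemma decompose:
  assumes "A \<in> VF" shows "A = gam (nab A eta) + bet (rho A)"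
proof -
  have "A - gam (nab A eta) - bet (rho A) = 0"
    using assms by (intro vertical_horizontal) (simp_all add: rho_diff nab_diff_left)
  then show ?thesis by (simp add: algebra_simps)
qed

text \<open>The vertical part of \<open>A\<close> contributes a bracket of vertical lifts, which
  \<open>rho\<close> kills. This allows the operator on the right to be iterated.\<close>

lemma rho_br_gam_lift:
  assumes "X \<in> PF" "A \<in> VF" shows "rho (br (gam X) A) = nab (gam X) (rho A) - T X (rho A)"
proof -
  have "br (gam X) A = br (gam X) (gam (nab A eta)) + br (gam X) (bet (rho A))"
    using decompose[OF assms(2)] assms br_add[of "gam X" "gam (nab A eta)" "bet (rho A)"] by simp
  then show ?thesis using assms by (simp add: rho_add rho_br_gam T_def)
qed

lemma T_sym: "X \<in> PF \<Longrightarrow> Y \<in> PF \<Longrightarrow> T X Y = T Y X"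
  unfolding T_def by (rule T_sym')

lemma T_selfadjoint: "\<lbrakk>X \<in> PF; Y \<in> PF; Z \<in> PF\<rbrakk> \<Longrightarrow>
      g (T X Y) Z = g (T X Z) Y"
  unfolding T_def by (rule T_adjoint)

lemma T_eta [simp]: "X \<in> PF \<Longrightarrow> T X eta = 0" "X \<in> PF \<Longrightarrow> T eta X = 0"
  using T_eta'[of X] T_sym[of X eta] by (simp_all add: T_def)

lemma T_add_left: "\<lbrakk>X \<in> PF; Y \<in> PF; Z \<in> PF\<rbrakk> \<Longrightarrow>
      T (X + Y) Z = T X Z + T Y Z"
  by (simp add: T_def gam_add nab_add_left br_add_left rho_add)

lemma T_diff_left: "\<lbrakk>X \<in> PF; Y \<in> PF; Z \<in> PF\<rbrakk> \<Longrightarrow>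
      T (X - Y) Z = T X Z - T Y Z"
  by (simp add: T_def gam_diff nab_diff_left br_diff_left rho_diff)

text \<open>Carried over from the first argument by symmetry, as additivity of \<open>bet\<close> is
  not among the assumptions.\<close>

lemma T_add_right: "\<lbrakk>X \<in> PF; Y \<in> PF; Z \<in> PF\<rbrakk> \<Longrightarrow>
      T X (Y + Z) = T X Y + T X Z"
  using T_add_left[of Y Z X] T_sym[of X] by simp

lemma T_diff_right: "\<lbrakk>X \<in> PF; Y \<in> PF; Z \<in> PF\<rbrakk> \<Longrightarrow>
      T X (Y - Z) = T X Y - T X Z"
  using T_diff_left[of Y Z X] T_sym[of X] by simp

lemma T_0 [simp]: "X \<in> PF \<Longrightarrow> T X 0 = 0"
  using T_diff_right[of X 0 0] by simp

section \<open>Skew-symmetry and flatness\<close>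

lemma K_anti: "\<lbrakk>A \<in> VF; B \<in> VF; X \<in> PF\<rbrakk> \<Longrightarrow>
      K A B X = - K B A X"
  using br_anti[of A B] by (simp add: K_def nab_uminus_left)

lemma K_add: "\<lbrakk>A \<in> VF; B \<in> VF; C \<in> VF; X \<in> PF\<rbrakk> \<Longrightarrow>
      K (A + B) C X = K A C X + K B C X"
  by (simp add: K_def nab_add_left nab_add br_add_left)

lemma K_diff: "\<lbrakk>A \<in> VF; B \<in> VF; C \<in> VF; X \<in> PF\<rbrakk> \<Longrightarrow>
      K (A - B) C X = K A C X - K B C X"
  by (simp add: K_def nab_diff_left nab_diff br_diff_left)

lemma S_anti: "\<lbrakk>X \<in> PF; Y \<in> PF; Z \<in> PF\<rbrakk> \<Longrightarrow>
      S X Y Z = - S Y X Z"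
  unfolding S_def by (rule K_anti) simp_all

text \<open>\<open>br A B\<close> acts on \<open>g X Y\<close> as a commutator. Expanding both
  actions by the metric condition, the mixed terms cancel and the curvature terms remain.\<close>

lemma K_skew:
  assumes "A \<in> VF" "B \<in> VF" "X \<in> PF" "Y \<in> PF"
  shows "g (K A B X) Y = - g (K A B Y) X"
proof -
  have e1: "g (nab (br A B) X) Y + g X (nab (br A B) Y) =
     (g (nab A (nab B X)) Y + g (nab B X) (nab A Y) + (g (nab A X) (nab B Y) + g X (nab A (nab B Y)))) -
     (g (nab B (nab A X)) Y + g (nab A X) (nab B Y) + (g (nab B X) (nab A Y) + g X (nab B (nab A Y))))"
    using metric[of "br A B" X Y] act_br[of A B "g X Y"] assms by (simp add: metric act_add)
  have e2: "g (K A B Y) X = - g X (nab A (nab B Y)) + g X (nab B (nab A Y)) + g X (nab (br A B) Y)"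
    using assms by (simp add: K_def g_add g_diff g_uminus g_sym[of X])
  have e3: "g (K A B X) Y = - g (nab A (nab B X)) Y + g (nab B (nab A X)) Y + g (nab (br A B) X) Y"
    using assms by (simp add: K_def g_add g_diff g_uminus)
  show ?thesis
  proof
    \<comment> \<open>At a point the three expansions are equations between real numbers and combine
      linearly.\<close>
    fix q show "g (K A B X) Y q = (- g (K A B Y) X) q"
      using fun_cong[OF e1, of q] fun_cong[OF e2, of q] fun_cong[OF e3, of q] by simp
  qed
qed

text \<open>\<open>X, Z \<mapsto> \<nabla>\<^sub>\<gamma>\<^sub>X Z - T X Z\<close> is a flat partial connection because \<open>\<rho>[\<gamma>X, \<cdot>]\<close> satisfies the Jacobi
  identity.\<close>

lemma flatness:
  fixes X Y Z defines "U \<equiv> nab (br (gam X) (gam Y)) eta"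
  assumes "X \<in> PF" "Y \<in> PF" "Z \<in> PF"
  shows "T X (T Y Z) - T Y (T X Z) - S X Y Z =
    nab (gam X) (T Y Z) - T Y (nab (gam X) Z) - (nab (gam Y) (T X Z) - T X (nab (gam Y) Z)) - T U Z"
proof -
  have U: "U \<in> PF" "br (gam X) (gam Y) = gam U"
    using decompose[of "br (gam X) (gam Y)"] assms rho_br_gam[of X Y] by (simp_all add: U_def)
  define d where "d X Z = nab (gam X) Z - T X Z" for X Z
  \<comment> \<open>\<open>br (gam X) (gam Y)\<close> has been identified as the lift of
    \<open>U\<close>. The explicit value of \<open>U\<close> is only obtained in
    \<open>br_gam\<close>, which depends on the result proved from this lemma.\<close>
  have d: "rho (br (gam X) A) = d X (rho A)" if "X \<in> PF" "A \<in> VF" for X A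
    using rho_br_gam_lift that by (simp add: d_def)
  have "br (gam X) (br (gam Y) (bet Z)) + br (gam Y) (br (bet Z) (gam X)) + br (bet Z) (br (gam X) (gam Y)) = 0"
    using assms(2-) by (intro jacobi) simp_all
  then have "br (gam X) (br (gam Y) (bet Z)) - br (gam Y) (br (gam X) (bet Z)) - br (gam U) (bet Z) = 0"
    using assms(2-) U br_anti[of "bet Z" "gam X"] br_anti[of "bet Z" "gam U"] by (simp add: br_uminus)
  then have "rho (br (gam X) (br (gam Y) (bet Z)) - br (gam Y) (br (gam X) (bet Z)) - br (gam U) (bet Z)) = 0"
    using rho_add[of 0 0] by simp
  \<comment> \<open>Under \<open>rho\<close> each bracket with a vertical lift becomes an
    application of \<open>d\<close>, so the projected Jacobi identity says that \<open>d\<close> has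
    no curvature.\<close>
  then have "d X (d Y Z) - d Y (d X Z) - d U Z = 0"
    using assms(2-) U(1) by (simp add: rho_diff d)
  then show ?thesis using assms(2-) U
    by (simp add: d_def S_def K_def nab_diff T_diff_right algebra_simps)
qed

text \<open>The left-hand side of the flatness identity is skew and its right-hand side is selfadjoint
  with respect to the metric, so both vanish.\<close>

lemma S_eq_and_codazzi:
  assumes XY: "X \<in> PF" "Y \<in> PF" and Z: "Z \<in> PF"
  shows "S X Y Z = T X (T Y Z) - T Y (T X Z)"
    and "nab (gam X) (T Y Z) - T Y (nab (gam X) Z) - (nab (gam Y) (T X Z) - T X (nab (gam Y) Z))
      - T (nab (br (gam X) (gam Y)) eta) Z = 0"
proof -
  define U where "U = nab (br (gam X) (gam Y)) eta"
  have U: "U \<in> PF" using assms by (simp add: U_def)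
  \<comment> \<open>The common value of both sides of the flatness identity, as an operator in
    \<open>Z\<close>.\<close>
  define \<sigma> where "\<sigma> Z = T X (T Y Z) - T Y (T X Z) - S X Y Z" for Z
  have \<sigma>: "\<sigma> Z \<in> PF" if "Z \<in> PF" for Z using that XY by (simp add: \<sigma>_def)
  have \<sigma>': "\<sigma> Z = nab (gam X) (T Y Z) - T Y (nab (gam X) Z) - (nab (gam Y) (T X Z) - T X (nab (gam Y) Z)) - T U Z"
    if "Z \<in> PF" for Z using flatness[OF XY that] by (simp add: \<sigma>_def U_def)
  have skew: "g (\<sigma> Z) W = - g (\<sigma> W) Z" if ZW: "Z \<in> PF" "W \<in> PF" for Z W
  proof -
    \<comment> \<open>The adjoint of a product is the product in reverse order, so the commutator of
      selfadjoint operators is skew.\<close>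
    have 1: "g (T X (T Y Z)) W = g (T Y (T X W)) Z" if "X \<in> PF" "Y \<in> PF" for X Y
      using that ZW T_selfadjoint[of X "T Y Z" W] T_selfadjoint[of Y "T X W" Z] g_sym[of "T X W" "T Y Z"] by simp
    show ?thesis using ZW XY K_skew[of "gam X" "gam Y" Z W] 1[of X Y] 1[of Y X]
      by (simp add: \<sigma>_def g_diff g_add S_def algebra_simps)
  qed
  have sym: "g (\<sigma> Z) W = g (\<sigma> W) Z" if ZW: "Z \<in> PF" "W \<in> PF" for Z W
  proof -
    \<comment> \<open>The covariant derivative of a selfadjoint operator is selfadjoint:
      differentiate \<open>g (T Y Z) W = g (T Y W) Z\<close> by the metric condition.\<close>
    have 1: "g (nab (gam X) (T Y Z) - T Y (nab (gam X) Z)) W = g (nab (gam X) (T Y W) - T Y (nab (gam X) W)) Z"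
      if XY: "X \<in> PF" "Y \<in> PF" for X Y
    proof -
      have "act (gam X) (g (T Y Z) W) = act (gam X) (g (T Y W) Z)"
        using that ZW T_selfadjoint[of Y Z W] by simp
      then have "g (nab (gam X) (T Y Z)) W + g (T Y Z) (nab (gam X) W) = g (nab (gam X) (T Y W)) Z + g (T Y W) (nab (gam X) Z)"
        using that ZW by (simp add: metric)
      moreover have "g (T Y Z) (nab (gam X) W) = g (T Y (nab (gam X) W)) Z" "g (T Y W) (nab (gam X) Z) = g (T Y (nab (gam X) Z)) W"
        using that ZW T_selfadjoint by simp_all
      ultimately show ?thesis using that ZW by (simp add: g_diff algebra_simps)
    qed
    have "g (\<sigma> Z) W = g (nab (gam X) (T Y Z) - T Y (nab (gam X) Z)) W - g (nab (gam Y) (T X Z) - T X (nab (gam Y) Z)) W - g (T U Z) W"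
      if "Z \<in> PF" "W \<in> PF" for Z W using that XY U by (simp add: \<sigma>' g_diff)
    then show ?thesis using ZW 1[OF XY] 1[OF XY(2,1)] T_selfadjoint[OF U] by simp
  qed
  have "g (\<sigma> Z) W = 0" if "W \<in> PF" for W
  proof
    fix q
    have "g (\<sigma> Z) W q = - g (\<sigma> Z) W q" using skew[OF Z that] sym[OF Z that] by (metis fun_Compl_def)
    then show "g (\<sigma> Z) W q = 0 q" by simp
  qed
  then have "\<sigma> Z = 0" using g_definite \<sigma>[OF Z] by blast
  then show "S X Y Z = T X (T Y Z) - T Y (T X Z)"
    "nab (gam X) (T Y Z) - T Y (nab (gam X) Z) - (nab (gam Y) (T X Z) - T X (nab (gam Y) Z))
      - T (nab (br (gam X) (gam Y)) eta) Z = 0"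
    using \<sigma>'[OF Z] by (simp_all add: \<sigma>_def U_def)
qed

lemmas S_eq = S_eq_and_codazzi(1) and codazzi = S_eq_and_codazzi(2)

section \<open>Algebraic identities for the v-curvature and formulas for brackets\<close>

lemma S_skew: "\<lbrakk>X \<in> PF; Y \<in> PF; Z \<in> PF; W \<in> PF\<rbrakk> \<Longrightarrow>
      g (S X Y Z) W = - g (S X Y W) Z"
  unfolding S_def by (rule K_skew) simp_all

lemma g_S: "\<lbrakk>X \<in> PF; Y \<in> PF; Z \<in> PF; W \<in> PF\<rbrakk> \<Longrightarrow>
      g (S X Y Z) W = g (T X W) (T Y Z) - g (T Y W) (T X Z)"
  using T_selfadjoint[of X "T Y Z" W] T_selfadjoint[of Y "T X Z" W] by (simp add: S_eq g_diff)

text \<open>By \<open>g_S\<close> both sides are differences of the same two products, up to the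
  symmetry of \<open>T\<close> and \<open>g\<close>.\<close>

lemma S_pair: "\<lbrakk>X \<in> PF; Y \<in> PF; Z \<in> PF; W \<in> PF\<rbrakk> \<Longrightarrow>
      g (S Z W X) Y = g (S X Y Z) W"
  using g_sym[of "T Z Y" "T W X"] g_sym[of "T W Y" "T Z X"]
  by (simp add: g_S T_sym[of Z Y] T_sym[of W X] T_sym[of W Y] T_sym[of Z X])

text \<open>Both terms of the commutator formula contain a torsion with an argument
  \<open>eta\<close>.\<close>

lemma S_eta [simp]:
  assumes "X \<in> PF" "Y \<in> PF" shows "S X eta Y = 0" "S eta X Y = 0" "S X Y eta = 0"
  using assms by (simp_all add: S_eq)

text \<open>The vanishing of \<open>S X Y eta\<close>, solved for the derivative of
  \<open>eta\<close> along the bracket, gives its vertical part; its horizontal part is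
  zero.\<close>

lemma br_gam: "X \<in> PF \<Longrightarrow> Y \<in> PF \<Longrightarrow> br (gam X) (gam Y) = gam (nab (gam X) Y - nab (gam Y) X)"
proof -
  assume XY: "X \<in> PF" "Y \<in> PF"
  have "nab (br (gam X) (gam Y)) eta = nab (gam X) Y - nab (gam Y) X"
    using S_eta(3)[OF XY] XY by (simp add: S_def K_def algebra_simps)
  then show ?thesis using decompose[of "br (gam X) (gam Y)"] XY rho_br_gam[of X Y] by simp
qed

text \<open>\<open>P Z X eta\<close> contains the derivative of \<open>eta\<close> along the
  bracket, hence the vertical part of the bracket; the horizontal part is the definition of
  \<open>T\<close>.\<close>

lemma br_gam_bet:
  assumes "X \<in> PF" "Z \<in> PF"
  shows "br (gam X) (bet Z) = bet (nab (gam X) Z - T X Z) - gam (nab (bet Z) X + P Z X eta)"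
proof -
  have 1: "rho (br (gam X) (bet Z)) = nab (gam X) Z - T X Z" using assms by (simp add: T_def)
  have "nab (br (bet Z) (gam X)) eta = nab (bet Z) X + P Z X eta" using assms by (simp add: P_def K_def)
  then have 2: "nab (br (gam X) (bet Z)) eta = - (nab (bet Z) X + P Z X eta)"
    using assms br_anti[of "gam X" "bet Z"] by (simp add: nab_uminus_left)
  show ?thesis using decompose[of "br (gam X) (bet Z)"] assms unfolding 1 2 by (simp add: gam_uminus gam_add gam_diff)
qed

text \<open>The six terms of the commutator formula cancel in pairs by the symmetry of
  \<open>T\<close>.\<close>

lemma S_cyclic: "\<lbrakk>X \<in> PF; Y \<in> PF; Z \<in> PF\<rbrakk> \<Longrightarrow>
      S X Y Z + S Y Z X + S Z X Y = 0"
  by (simp add: S_eq T_sym[of Y X] T_sym[of Z X] T_sym[of Z Y])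

text \<open>The formal Jacobi identity for commutators with \<open>nab A\<close>,
  \<open>nab B\<close>, \<open>nab C\<close>. The bracket terms of \<open>K\<close> leave nested
  brackets, which sum to zero by the Jacobi identity for fields.\<close>

lemma bianchi:
  assumes "A \<in> VF" "B \<in> VF" "C \<in> VF" "X \<in> PF"
  shows "nab A (K B C X) - K B C (nab A X) + nab B (K C A X) - K C A (nab B X) + nab C (K A B X) - K A B (nab C X)
    = K (br A B) C X + K (br B C) A X + K (br C A) B X"
proof -
  have j: "nab (br (br A B) C) X + nab (br (br B C) A) X + nab (br (br C A) B) X = 0"
  proof -
    have "br (br A B) C + br (br B C) A + br (br C A) B = - (br A (br B C) + br B (br C A) + br C (br A B))"
      using br_anti[of "br A B" C] br_anti[of "br B C" A] br_anti[of "br C A" B] assms by simp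
    then have "br (br A B) C + br (br B C) A + br (br C A) B = 0" using jacobi assms by simp
    then show ?thesis using assms nab_add_left[of "br (br A B) C + br (br B C) A" "br (br C A) B" X]
      nab_add_left[of "br (br A B) C" "br (br B C) A" X] by simp
  qed
  then have j': "nab (br (br C A) B) X = - nab (br (br A B) C) X - nab (br (br B C) A) X"
    by (simp add: algebra_simps eq_neg_iff_add_eq_0)
  show ?thesis using assms
    by (simp add: K_def nab_add nab_diff nab_uminus nab_add_left j' algebra_simps)
qed

section \<open>Covariant derivatives of the curvatures\<close>

definition nabS :: "'v \<Rightarrow> 'p \<Rightarrow> 'p \<Rightarrow> 'p \<Rightarrow> 'p" where
  "nabS A X Y Z = nab A (S X Y Z) - S (nab A X) Y Z - S X (nab A Y) Z - S X Y (nab A Z)"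

definition nabP :: "'v \<Rightarrow> 'p \<Rightarrow> 'p \<Rightarrow> 'p \<Rightarrow> 'p" where
  "nabP A X Y Z = nab A (P X Y Z) - P (nab A X) Y Z - P X (nab A Y) Z - P X Y (nab A Z)"

text \<open>By \<open>br_gam\<close> the bracket terms of the Bianchi identity become exactly the
  terms of \<open>nabS\<close> in which the first two arguments of \<open>S\<close> are
  differentiated.\<close>

lemma nabS_cyclic:
  assumes "X \<in> PF" "Y \<in> PF" "Z \<in> PF" "W \<in> PF"
  shows "nabS (gam X) Y Z W + nabS (gam Y) Z X W + nabS (gam Z) X Y W = 0"
proof -
  have k: "K (br (gam X) (gam Y)) (gam Z) W = S (nab (gam X) Y) Z W + S Z (nab (gam Y) X) W"
    if "X \<in> PF" "Y \<in> PF" "Z \<in> PF" for X Y Z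
    using that assms(4) S_anti[of Z "nab (gam Y) X" W] by (simp add: br_gam gam_diff K_diff S_def)
  show ?thesis
    using bianchi[of "gam X" "gam Y" "gam Z" W] assms
    unfolding k[OF assms(1,2,3)] k[OF assms(2,3,1)] k[OF assms(3,1,2)]
    by (simp add: nabS_def S_def[symmetric] algebra_simps)
qed

text \<open>For \<open>Y = eta\<close> the Codazzi equation says that the derivative of
  \<open>T\<close> along \<open>gam eta\<close> is \<open>- T\<close>. As \<open>S\<close> is
  quadratic in \<open>T\<close>, the factor is -2, written as a difference because an abelian group
  has no scalars.\<close>

lemma nabS_gam_eta:
  assumes "X \<in> PF" "Y \<in> PF" "Z \<in> PF"
  shows "nabS (gam eta) X Y Z = - S X Y Z - S X Y Z"
proof -
  have T: "nab (gam eta) (T X Z) = T X (nab (gam eta) Z) + T (nab (gam eta) X) Z - T X Z"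
    if "X \<in> PF" "Z \<in> PF" for X Z
    using codazzi[of X eta Z] that by (simp add: br_gam nab_diff_left gam_diff T_diff_left algebra_simps)
  show ?thesis using assms
    by (simp add: nabS_def S_eq T nab_diff T_add_left T_add_right T_diff_right algebra_simps)
qed

text \<open>In the Bianchi identity for \<open>bet Z\<close>, \<open>gam X\<close>,
  \<open>gam Y\<close> the mixed brackets are resolved by \<open>br_gam_bet\<close>: their vertical
  parts give the terms \<open>P _ _ eta\<close> inside \<open>S\<close>, their horizontal parts the
  terms \<open>T _ _\<close> inside \<open>P\<close>.\<close>

lemma nabS_bet:
  assumes "X \<in> PF" "Y \<in> PF" "Z \<in> PF" "W \<in> PF"
  shows "nabS (bet Z) X Y W = nabP (gam X) Z Y W - nabP (gam Y) Z X W
    - S (P Z Y eta) X W + S (P Z X eta) Y W - P (T Y Z) X W + P (T X Z) Y W"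
proof -
  \<comment> \<open>Additivity of \<open>bet\<close> is obtained from \<open>decompose\<close>,
    applied to a difference of lifts.\<close>
  have Kb: "K (bet (U - V)) C W = K (bet U) C W - K (bet V) C W" if "U \<in> PF" "V \<in> PF" "C \<in> VF" for U V C
  proof -
    have "bet (U - V) = bet U - bet V"
      using decompose[of "bet U - bet V"] gam_add[of 0 0] that by (simp add: rho_diff nab_diff_left)
    then show ?thesis using that assms by (simp add: K_diff)
  qed
  have 1: "K (br (bet Z) (gam X)) (gam Y) W = S (nab (bet Z) X) Y W + S (P Z X eta) Y W - P (nab (gam X) Z) Y W + P (T X Z) Y W"
    if "X \<in> PF" "Y \<in> PF" for X Y
    using that assms br_anti[of "bet Z" "gam X"]
    by (simp add: br_gam_bet K_diff Kb gam_add K_add) (simp add: S_def P_def algebra_simps)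
  have 2: "K (br (gam Y) (bet Z)) (gam X) W = - K (br (bet Z) (gam Y)) (gam X) W"
    using assms br_anti[of "gam Y" "bet Z"] K_diff[of 0 "br (bet Z) (gam Y)" "gam X" W] K_add[of 0 0 "gam X" W] by simp
  have 3: "K (br (gam X) (gam Y)) (bet Z) W = - P Z (nab (gam X) Y) W + P Z (nab (gam Y) X) W"
    using assms K_anti[of "bet Z" "gam (nab (gam X) Y)" W] K_anti[of "bet Z" "gam (nab (gam Y) X)" W]
    by (simp add: br_gam gam_diff K_diff P_def)
  have 4: "K (gam Y) (bet Z) V = - P Z Y V" if "V \<in> PF" for V
    using assms that K_anti[of "gam Y" "bet Z" V] by (simp add: P_def)
  have 5: "S X (nab (bet Z) Y) W = - S (nab (bet Z) Y) X W" using assms by (intro S_anti) simp_all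
  have "nab (bet Z) (S X Y W) - S X Y (nab (bet Z) W) + nab (gam X) (- P Z Y W) + P Z Y (nab (gam X) W) + nab (gam Y) (P Z X W) - P Z X (nab (gam Y) W)
    = S (nab (bet Z) X) Y W + S (P Z X eta) Y W - P (nab (gam X) Z) Y W + P (T X Z) Y W
     - P Z (nab (gam X) Y) W + P Z (nab (gam Y) X) W
     - (S (nab (bet Z) Y) X W + S (P Z Y eta) X W - P (nab (gam Y) Z) X W + P (T Y Z) X W)"
    using bianchi[of "bet Z" "gam X" "gam Y" W] assms 4
    unfolding 1[OF assms(1,2)] 2 1[OF assms(2,1)] 3
    by (simp add: S_def[symmetric] P_def[symmetric])
  then show ?thesis using assms unfolding nabS_def nabP_def 5
    by (simp add: nab_uminus algebra_simps)
qed

end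

subsection \<open>The Cartan connection of a Finsler manifold\<close>

locale cartan_bundle = regular_slit_bundle M D + finsler_bundle M L
  for M :: "('a, 'e::euclidean_space) atlas" and D L +
  assumes cartan: "cartan_connection M L D"
begin

text \<open>Fields are normalised to be \<open>0\<close> off the slit bundle, so that fields that agree on the slit
  bundle become equal.\<close>

definition on_slit :: "('a tpoint \<Rightarrow> 'z::zero) \<Rightarrow> 'a tpoint \<Rightarrow> 'z" where
  "on_slit X u = (if u \<in> TM0 then X u else 0)"

definition VF :: "'a slit_field set" where "VF = {A. vfield A \<and> on_slit A = A}"
definition PF :: "'a pi_field set" where "PF = {X. pfield X \<and> on_slit X = X}"
definition FF :: "('a tpoint \<Rightarrow> real) set" where
  "FF = {f. (\<forall>u\<in>TM0. f \<in> smooth_near (slit M) u) \<and> on_slit f = f}"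
definition "bracket' A B = on_slit (lie_bracket (slit M) A B)"
definition "nabla' A X = on_slit (cov D A X)"
definition "act' A f = on_slit (\<lambda>u. A u f)"
definition "rho' A = on_slit (rho M A)"
definition "gamma' X = on_slit (gamma M X)"
definition "beta' X = on_slit (beta M D X)"
definition "eta' = on_slit eta"
definition "metric' X Y = on_slit (finsler_metric L X Y)"

lemma on_slit_at [simp]: "u \<in> TM0 \<Longrightarrow> on_slit X u = X u"
  by (simp add: on_slit_def)

lemma on_slit_idem [simp]: "on_slit (on_slit X) = on_slit X"
  by (simp add: on_slit_def fun_eq_iff)

lemma on_slit_eqI: "(\<And>u. u \<in> TM0 \<Longrightarrow> X u = Y u) \<Longrightarrow> on_slit X = on_slit Y"
  by (simp add: on_slit_def fun_eq_iff)

lemma on_slit_0 [simp]: "on_slit 0 = 0"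
  by (simp add: on_slit_def fun_eq_iff)

lemma on_slit_add: "on_slit (X + Y) = on_slit X + on_slit Y" for X Y :: "'a tpoint \<Rightarrow> 'z::ab_group_add"
  by (simp add: on_slit_def fun_eq_iff)

lemma on_slit_uminus: "on_slit (- X) = - on_slit X" for X :: "'a tpoint \<Rightarrow> 'z::ab_group_add"
  by (simp add: on_slit_def fun_eq_iff)

lemma on_slit_diff: "on_slit (X - Y) = on_slit X - on_slit Y" for X Y :: "'a tpoint \<Rightarrow> 'z::ab_group_add"
  by (simp add: on_slit_def fun_eq_iff)

lemma vector_field_along: "vfield A \<longleftrightarrow> smooth_atlas_map.field_along (slit M) (slit M) (\<lambda>p. p) A"
  unfolding vector_field_def by (rule smooth_atlas_map.smooth_map_tangent_bundle_iff[OF N.smooth_atlas_map_id])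

lemma vector_field_on_slit: "vfield A \<Longrightarrow> vfield (on_slit A)"
  unfolding vector_field_along by (erule smooth_atlas_map.field_along_cong[OF N.smooth_atlas_map_id]) simp

lemma pi_field_on_slit: "pfield X \<Longrightarrow> pfield (on_slit X)"
  unfolding pi_vector_field_iff by (erule pull.field_along_cong) simp

lemma VF_on_slit [simp]: "vfield A \<Longrightarrow> on_slit A \<in> VF"
  by (simp add: VF_def vector_field_on_slit)

lemma PF_on_slit [simp]: "pfield X \<Longrightarrow> on_slit X \<in> PF"
  by (simp add: PF_def pi_field_on_slit)

lemma VF_D: "A \<in> VF \<Longrightarrow> vfield A" "A \<in> VF \<Longrightarrow> on_slit A = A"
  by (simp_all add: VF_def)

lemma PF_D: "X \<in> PF \<Longrightarrow> pfield X" "X \<in> PF \<Longrightarrow> on_slit X = X"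
  by (simp_all add: PF_def)

lemma vector_field_add: "vfield A \<Longrightarrow> vfield B \<Longrightarrow> vfield (A + B)"
  unfolding vector_field_along by (rule smooth_atlas_map.field_along_add[OF N.smooth_atlas_map_id])

lemma vector_field_uminus: "vfield A \<Longrightarrow> vfield (- A)"
  unfolding vector_field_along by (rule smooth_atlas_map.field_along_uminus[OF N.smooth_atlas_map_id])

lemma pi_field_add: "pfield X \<Longrightarrow> pfield Y \<Longrightarrow> pfield (X + Y)"
  unfolding pi_vector_field_iff by (rule pull.field_along_add)

lemma pi_field_diff: "pfield X \<Longrightarrow> pfield Y \<Longrightarrow> pfield (X - Y)"
  unfolding pi_vector_field_iff by (rule pull.field_along_diff)

lemma pi_field_uminus: "pfield X \<Longrightarrow> pfield (- X)"
  unfolding pi_vector_field_iff by (rule pull.field_along_uminus)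

lemma on_slit_bracket:
  "vfield A \<Longrightarrow> vfield B \<Longrightarrow>
    on_slit (lie_bracket (slit M) A B) = bracket' (on_slit A) (on_slit B)"
  unfolding bracket'_def by (intro on_slit_eqI N.lie_bracket_cong) simp_all

lemma on_slit_cov:
  assumes "vfield A" "pfield X"
  shows "on_slit (cov D A X) = nabla' (on_slit A) (on_slit X)"
  unfolding nabla'_def
proof (rule on_slit_eqI)
  fix u assume u: "u \<in> TM0"
  show "cov D A X u = cov D (on_slit A) (on_slit X) u"
    using D_cong[OF u N.vector_field_tangent[OF assms(1) u] assms(2) pi_field_on_slit[OF assms(2)]] u
    by (simp add: cov_def)
qed

lemma on_slit_rho: "on_slit (rho M A) = rho' (on_slit A)"
  unfolding rho'_def by (intro on_slit_eqI) (simp add: rho_def)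

lemma on_slit_gamma: "on_slit (gamma M X) = gamma' (on_slit X)"
  unfolding gamma'_def by (intro on_slit_eqI) (simp add: gamma_def cong: if_cong)

lemma on_slit_beta: "on_slit (beta M D X) = beta' (on_slit X)"
  unfolding beta'_def by (intro on_slit_eqI) (simp add: beta_def)

lemma on_slit_metric: "on_slit (finsler_metric L X Y) = metric' (on_slit X) (on_slit Y)"
  unfolding metric'_def by (intro on_slit_eqI) (simp add: finsler_metric_def)

text \<open>\<open>rho M (beta M D Y)\<close> agrees with \<open>Y\<close> on the slit bundle only,
  and \<open>rho M (gamma M X)\<close> is zero there; \<open>D_cong\<close> and
  \<open>D_vanishing\<close> make this enough.\<close>

lemma T_torsion_eq:
  assumes X: "pfield X" and Y: "pfield Y" and u: "u \<in> TM0"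
  shows "T_torsion M D X Y u = cov D (gamma M X) Y u - rho M (lie_bracket (slit M) (gamma M X) (beta M D Y)) u"
proof -
  have 1: "cov D (gamma M X) (rho M (beta M D Y)) u = cov D (gamma M X) Y u"
    unfolding cov_def
    by (rule D_cong[OF u N.vector_field_tangent[OF vector_field_gamma[OF X] u]
          pi_vector_field_rho[OF vector_field_beta[OF Y]] Y rho_beta])
       (use pi_tangent[OF Y] in auto)
  have 2: "cov D (beta M D Y) (rho M (gamma M X)) u = 0"
    unfolding cov_def
    by (rule D_vanishing[OF u N.vector_field_tangent[OF vector_field_beta[OF Y] u]
          pi_vector_field_rho[OF vector_field_gamma[OF X]]]) (rule rho_gamma)
  show ?thesis by (simp add: T_torsion_def torsion_def 1 2)
qed

lemma on_slit_T_torsion: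
  assumes X: "pfield X" and Y: "pfield Y"
  shows "on_slit (T_torsion M D X Y) =
    nabla' (gamma' (on_slit X)) (on_slit Y) - rho' (bracket' (gamma' (on_slit X)) (beta' (on_slit Y)))"
proof -
  have "on_slit (T_torsion M D X Y) = on_slit (cov D (gamma M X) Y - rho M (lie_bracket (slit M) (gamma M X) (beta M D Y)))"
    by (rule on_slit_eqI) (simp add: T_torsion_eq X Y)
  then show ?thesis
    by (simp add: on_slit_diff on_slit_cov on_slit_rho on_slit_bracket vector_field_gamma vector_field_beta X Y
        on_slit_gamma on_slit_beta)
qed

lemma pi_field_T_torsion:
  assumes X: "pfield X" and Y: "pfield Y"
  shows "pfield (T_torsion M D X Y)"
  unfolding T_torsion_def torsion_def
  by (intro pi_field_diff pi_field_cov pi_vector_field_rho vector_field_gamma vector_field_beta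
      N.vector_field_lie_bracket X Y)

lemma T_torsion_adjoint:
  "\<lbrakk>pfield X; pfield Y; pfield Z; u \<in> TM0\<rbrakk> \<Longrightarrow>
      finsler_metric L (T_torsion M D X Y) Z u = finsler_metric L (T_torsion M D X Z) Y u"
  using cartan by (simp add: cartan_connection_def)

lemma metric_compatible:
  "\<lbrakk>vfield A; pfield X; pfield Y; u \<in> TM0\<rbrakk> \<Longrightarrow>
      A u (finsler_metric L X Y) = finsler_metric L (cov D A X) Y u + finsler_metric L X (cov D A Y) u"
  using cartan by (simp add: cartan_connection_def)

text \<open>Since \<open>\<nabla>g = 0\<close>, the tensor \<open>2 g(T(X, Y), Z)\<close> is the fibre derivative of the metric.\<close>

lemma T_torsion_cartan_tensor:
  assumes u: "u \<in> TM0"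
  obtains c :: "'a tvec \<Rightarrow> 'a tvec \<Rightarrow> 'a tvec \<Rightarrow> real" where
    "\<And>x y z. c x y z = c y x z" "\<And>x y z. c x y z = c x z y" "\<And>y z. c (eta u) y z = 0"
    "\<And>X Y Z. \<lbrakk>pfield X; pfield Y; pfield Z\<rbrakk> \<Longrightarrow>
      2 * finsler_metric L (T_torsion M D X Y) Z u = c (X u) (Y u) (Z u)"
proof (rule metric_fibre_derivative[OF u], goal_cases)
  case (1 c)
  note d = 1(5)
  have "2 * finsler_metric L (T_torsion M D X Y) Z u = c (X u) (Y u) (Z u)"
    if X: "pfield X" and Y: "pfield Y" and Z: "pfield Z" for X Y Z
  proof -
    note gX = vector_field_gamma[OF X]
    \<comment> \<open>\<open>d Y\<close> is D0_X Y at \<open>u\<close>: by \<open>da\<close> it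
      differentiates the components of \<open>Y\<close> along the fibre, and \<open>cov\<close>
      exhibits the torsion as the difference from the connection.\<close>
    define d where "d Y = rho M (lie_bracket (slit M) (gamma M X) (beta M D Y)) u" for Y
    have dt: "d Y \<in> tangent_space M (fst u)" if "pfield Y" for Y
      unfolding d_def by (rule pi_tangent[OF pi_vector_field_rho[OF N.vector_field_lie_bracket[OF gX vector_field_beta[OF that]]] u])
    have da: "d Y f = gamma M X u (\<lambda>u. Y u f)" if Y: "pfield Y" and f: "f \<in> smooth_near M (fst u)" for Y f
      unfolding d_def rho_bracket_gamma[OF X vector_field_beta[OF Y] u f]
    proof (rule N.tangent_apply_cong[OF u N.vector_field_tangent[OF gX u]])
      show "\<forall>\<^sub>F w in nhdsin (mtop (slit M)) u. rho M (beta M D Y) w f = Y w f"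
        using N.eventually_carrier[of u] by eventually_elim (simp add: rho_beta[where X=Y] pi_tangent[OF Y])
    qed
    have cov: "cov D (gamma M X) Y u = T_torsion M D X Y u + d Y" if "pfield Y" for Y
      unfolding T_torsion_eq[OF X that u] d_def by simp
    have Tt: "T_torsion M D X Y u \<in> tangent_space M (fst u)" if "pfield Y" for Y
      by (rule pi_tangent[OF pi_field_T_torsion[OF X that] u])
    note t = Tt[OF Y] Tt[OF Z] dt[OF Y] dt[OF Z] pi_tangent[OF Y u] pi_tangent[OF Z u]
    have "gamma M X u (finsler_metric L Y Z) =
        fibre_hessian L u (T_torsion M D X Y u + d Y) (Z u) + fibre_hessian L u (Y u) (T_torsion M D X Z u + d Z)"
      using metric_compatible[OF gX Y Z u] by (simp add: finsler_metric_def cov[OF Y] cov[OF Z])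
    also have "fibre_hessian L u (T_torsion M D X Y u + d Y) (Z u) = finsler_metric L (T_torsion M D X Y) Z u + fibre_hessian L u (d Y) (Z u)"
      using fibre_hessian_add[OF u t(1,3,6)] by (simp add: finsler_metric_def)
    also have "fibre_hessian L u (Y u) (T_torsion M D X Z u + d Z) = finsler_metric L (T_torsion M D X Z) Y u + fibre_hessian L u (Y u) (d Z)"
      using fibre_hessian_add[OF u t(2,4,5)] fibre_hessian_sym[OF u t(5) t(4)]
        fibre_hessian_sym[OF u t(5) tangent_add[OF _ t(2) t(4)]] u by (simp add: finsler_metric_def carrier_slit)
    \<comment> \<open>The two torsion terms coincide by \<open>T_torsion_adjoint\<close>, whence the
      factor 2; the terms with \<open>d\<close> are those of the fibre derivative of the
      metric.\<close>
    finally show ?thesis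
      using d[OF X Y Z t(3,4) da[OF Y] da[OF Z]] T_torsion_adjoint[OF X Z Y u] by simp
  qed
  with 1(2-4) show ?case by (rule 1(1))
qed

lemma finsler_metric_definite:
  assumes "pfield X" "u \<in> TM0" "finsler_metric L X X u = 0" shows "X u = 0"
  using fibre_hessian_definite[OF assms(2) pi_tangent[OF assms(1,2)]] assms(3) by (simp add: finsler_metric_def)

lemma finsler_metric_add:
  assumes "pfield X" "pfield Y" "pfield Z" "u \<in> TM0"
  shows "finsler_metric L (X + Y) Z u = finsler_metric L X Z u + finsler_metric L Y Z u"
  using fibre_hessian_add[OF assms(4) pi_tangent[OF assms(1,4)] pi_tangent[OF assms(2,4)] pi_tangent[OF assms(3,4)]]
  by (simp add: finsler_metric_def)

lemma finsler_metric_diff: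
  assumes "pfield X" "pfield Y" "pfield Z" "u \<in> TM0"
  shows "finsler_metric L (X - Y) Z u = finsler_metric L X Z u - finsler_metric L Y Z u"
  using finsler_metric_add[OF pi_field_diff[OF assms(1,2)] assms(2,3,4)] by simp

lemma T_torsion_sym:
  assumes X: "pfield X" and Y: "pfield Y" and u: "u \<in> TM0"
  shows "T_torsion M D X Y u = T_torsion M D Y X u"
proof -
  obtain c :: "'a tvec \<Rightarrow> 'a tvec \<Rightarrow> 'a tvec \<Rightarrow> real" where c: "\<And>x y z. c x y z = c y x z"
    and T: "\<And>X Y Z. \<lbrakk>pfield X; pfield Y; pfield Z\<rbrakk> \<Longrightarrow>
      2 * finsler_metric L (T_torsion M D X Y) Z u = c (X u) (Y u) (Z u)"
    by (rule T_torsion_cartan_tensor[OF u], rule that)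
  \<comment> \<open>Definiteness is used by pairing the difference of the two torsions with
    itself.\<close>
  let ?Z = "T_torsion M D X Y - T_torsion M D Y X"
  note TXY = pi_field_T_torsion[OF X Y] pi_field_T_torsion[OF Y X]
  have Z: "pfield ?Z" by (rule pi_field_diff[OF TXY])
  have "finsler_metric L ?Z ?Z u = 0"
    using T[OF X Y Z] T[OF Y X Z] c[of "X u" "Y u"] finsler_metric_diff[OF TXY Z u] by simp
  then have "?Z u = 0" by (rule finsler_metric_definite[OF Z u])
  then show ?thesis by simp
qed

lemma T_torsion_eta:
  assumes X: "pfield X" and u: "u \<in> TM0"
  shows "T_torsion M D X eta u = 0"
proof -
  obtain c :: "'a tvec \<Rightarrow> 'a tvec \<Rightarrow> 'a tvec \<Rightarrow> real" where c: "\<And>y z. c (eta u) y z = 0"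
    and T: "\<And>X Y Z. \<lbrakk>pfield X; pfield Y; pfield Z\<rbrakk> \<Longrightarrow>
      2 * finsler_metric L (T_torsion M D X Y) Z u = c (X u) (Y u) (Z u)"
    by (rule T_torsion_cartan_tensor[OF u], rule that)
  note TX = pi_field_T_torsion[OF pi_field_eta X]
  have "T_torsion M D eta X u = 0"
    using T[OF pi_field_eta X TX] c by (intro finsler_metric_definite[OF TX u]) simp
  then show ?thesis using T_torsion_sym[OF X pi_field_eta u] by simp
qed

text \<open>The components of \<open>eta\<close> are the fibre coordinates, whose derivative along
  \<open>gamma M X\<close> is \<open>X\<close>. So D0_X eta is \<open>X\<close>, and the torsion
  term is zero.\<close>

lemma cov_gamma_eta:
  assumes X: "pfield X" and u: "u \<in> TM0"
  shows "cov D (gamma M X) eta u = X u"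
proof -
  let ?B = "lie_bracket (slit M) (gamma M X) (beta M D eta)"
  have b: "vfield (beta M D eta)" by (rule vector_field_beta[OF pi_field_eta])
  have t: "rho M ?B u \<in> tangent_space M (fst u)"
    by (rule pi_tangent[OF pi_vector_field_rho[OF N.vector_field_lie_bracket[OF vector_field_gamma[OF X] b]] u])
  have p: "fst u \<in> carrier M" using u by (simp add: carrier_slit)
  have "rho M ?B u = X u"
  proof
    fix f
    show "rho M ?B u f = X u f"
    proof (cases "f \<in> smooth_near M (fst u)")
      case True
      have "rho M ?B u f = gamma M X u (\<lambda>u. rho M (beta M D eta) u f)"
        by (rule rho_bracket_gamma[OF X b u True])
      also have "\<dots> = gamma M X u (\<lambda>u. snd u f)"
      proof (rule N.tangent_apply_cong[OF u N.vector_field_tangent[OF vector_field_gamma[OF X] u]])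
        show "\<forall>\<^sub>F w in nhdsin (mtop (slit M)) u. rho M (beta M D eta) w f = snd w f"
          using N.eventually_carrier[of u]
          by eventually_elim (simp add: rho_beta[where X=eta] pi_tangent[OF pi_field_eta], simp add: eta_def)
      qed
      also have "\<dots> = X u f" by (rule gamma_snd[OF u True])
      finally show ?thesis .
    \<comment> \<open>On functions that are not smooth at the base point both tangent vectors have
      the default value 0.\<close>
    qed (use tangent_apply_eq0[OF p t] tangent_apply_eq0[OF p pi_tangent[OF X u]] in simp)
  qed
  then show ?thesis using T_torsion_eq[OF X pi_field_eta u] T_torsion_eta[OF X u] by simp
qed

end

text \<open>Each assumption of the locale is an identity at points of the slit bundle, which
  \<open>on_slit_eqI\<close> turns into an equality of cut-off fields. Operations are compatible
  with the cut-off because they depend on values or germs at such points, and \<open>nabla'\<close>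
  by \<open>D_cong\<close>.\<close>

sublocale cartan_bundle \<subseteq> alg: cartan_algebra VF PF FF bracket' nabla' act' rho' gamma' beta' eta' metric'
proof
  show "A + B \<in> VF" if "A \<in> VF" "B \<in> VF" for A B
    using that by (simp add: VF_def vector_field_add on_slit_add)
  show "- A \<in> VF" if "A \<in> VF" for A
    using that by (simp add: VF_def vector_field_uminus on_slit_uminus)
  show "X + Y \<in> PF" if "X \<in> PF" "Y \<in> PF" for X Y
    using that by (simp add: PF_def pi_field_add on_slit_add)
  show "- X \<in> PF" if "X \<in> PF" for X
    using that by (simp add: PF_def pi_field_uminus on_slit_uminus)
  show "bracket' A B \<in> VF" if "A \<in> VF" "B \<in> VF" for A B
    unfolding bracket'_def by (intro VF_on_slit N.vector_field_lie_bracket VF_D that)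
  show "nabla' A X \<in> PF" if "A \<in> VF" "X \<in> PF" for A X
    unfolding nabla'_def by (intro PF_on_slit pi_field_cov VF_D PF_D that)
  show "rho' A \<in> PF" if "A \<in> VF" for A
    unfolding rho'_def by (intro PF_on_slit pi_vector_field_rho VF_D that)
  show gamma_VF: "gamma' X \<in> VF" if "X \<in> PF" for X
    unfolding gamma'_def by (intro VF_on_slit vector_field_gamma PF_D that)
  show beta_VF: "beta' X \<in> VF" if "X \<in> PF" for X
    unfolding beta'_def by (intro VF_on_slit vector_field_beta PF_D that)
  show "eta' \<in> PF" unfolding eta'_def by (intro PF_on_slit pi_field_eta)
  show "metric' X Y \<in> FF" if "X \<in> PF" "Y \<in> PF" for X Y
  proof -
    have "metric' X Y \<in> smooth_near (slit M) u" if u: "u \<in> TM0" for u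
      by (rule N.smooth_near_transform[OF finsler_metric_smooth_near[OF PF_D(1)[OF \<open>X \<in> PF\<close>] PF_D(1)[OF \<open>Y \<in> PF\<close>] u]])
         (use N.eventually_carrier[of u] in eventually_elim, simp add: metric'_def)
    then show ?thesis by (simp add: FF_def metric'_def)
  qed
  show "bracket' A (B + C) = bracket' A B + bracket' A C" if "A \<in> VF" "B \<in> VF" "C \<in> VF" for A B C
    unfolding bracket'_def on_slit_add[symmetric]
    by (intro on_slit_eqI) (simp add: N.lie_bracket_add VF_D that)
  show "bracket' A B = - bracket' B A" for A B
    unfolding bracket'_def on_slit_uminus[symmetric]
    by (intro on_slit_eqI) (simp add: N.lie_bracket_anti[of A B])
  show "bracket' A (bracket' B C) + bracket' B (bracket' C A) + bracket' C (bracket' A B) = 0"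
    if "A \<in> VF" "B \<in> VF" "C \<in> VF" for A B C
  proof -
    have "bracket' A (bracket' B C) = on_slit (lie_bracket (slit M) A (lie_bracket (slit M) B C))"
      if "A \<in> VF" "B \<in> VF" "C \<in> VF" for A B C
      using on_slit_bracket[OF VF_D(1)[OF that(1)] N.vector_field_lie_bracket[OF VF_D(1)[OF that(2)] VF_D(1)[OF that(3)]]]
      by (simp add: bracket'_def[of B C] VF_D(2)[OF that(1)])
    then have "bracket' A (bracket' B C) + bracket' B (bracket' C A) + bracket' C (bracket' A B) =
      on_slit (lie_bracket (slit M) A (lie_bracket (slit M) B C) + lie_bracket (slit M) B (lie_bracket (slit M) C A)
        + lie_bracket (slit M) C (lie_bracket (slit M) A B))"
      by (simp add: on_slit_add that)
    also have "\<dots> = on_slit 0"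
      using N.lie_bracket_jacobi[OF VF_D(1)[OF that(1)] VF_D(1)[OF that(2)] VF_D(1)[OF that(3)]]
      by (intro on_slit_eqI) simp
    finally show ?thesis by simp
  qed
  show "nabla' (A + B) X = nabla' A X + nabla' B X" if "A \<in> VF" "B \<in> VF" "X \<in> PF" for A B X
    unfolding nabla'_def on_slit_add[symmetric]
    by (intro on_slit_eqI) (simp add: fun_eq_iff cov_def D_add_left N.vector_field_tangent VF_D PF_D that)
  show "nabla' A (X + Y) = nabla' A X + nabla' A Y" if "A \<in> VF" "X \<in> PF" "Y \<in> PF" for A X Y
    unfolding nabla'_def on_slit_add[symmetric]
    by (intro on_slit_eqI) (simp add: fun_eq_iff cov_def D_add N.vector_field_tangent VF_D PF_D that)
  show "rho' (A + B) = rho' A + rho' B" for A B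
    unfolding rho'_def on_slit_add[symmetric] by (intro on_slit_eqI) (simp add: rho_add)
  show "gamma' (X + Y) = gamma' X + gamma' Y" if "X \<in> PF" "Y \<in> PF" for X Y
    unfolding gamma'_def on_slit_add[symmetric]
    by (intro on_slit_eqI) (simp add: gamma_add[where X=X and Y=Y] pi_tangent PF_D that)
  show "rho' (gamma' X) = 0" for X
  proof -
    have "rho' (gamma' X) = on_slit (rho M (gamma M X))" by (simp add: on_slit_rho gamma'_def)
    also have "\<dots> = on_slit 0" by (rule on_slit_eqI) (simp add: rho_gamma)
    finally show ?thesis by simp
  qed
  show "rho' (beta' X) = X" if "X \<in> PF" for X
  proof -
    have "rho' (beta' X) = on_slit (rho M (beta M D X))" by (simp add: on_slit_rho beta'_def)
    also have "\<dots> = on_slit X"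
      by (rule on_slit_eqI, rule rho_beta) (simp_all add: pi_tangent[OF PF_D(1)[OF that]])
    finally show ?thesis by (simp add: PF_D(2)[OF that])
  qed
  show "nabla' (beta' X) eta' = 0" if "X \<in> PF" for X
  proof -
    have "nabla' (beta' X) eta' = on_slit (cov D (beta M D X) eta)"
      by (simp add: on_slit_cov vector_field_beta PF_D that beta'_def eta'_def)
    also have "\<dots> = on_slit 0"
      by (rule on_slit_eqI) (simp add: cov_beta_eta[where X=X] pi_tangent[OF PF_D(1)[OF that]])
    finally show ?thesis by simp
  qed
  show gamma_eta: "nabla' (gamma' X) eta' = X" if "X \<in> PF" for X
  proof -
    have "nabla' (gamma' X) eta' = on_slit (cov D (gamma M X) eta)"
      by (simp add: on_slit_cov vector_field_gamma PF_D that gamma'_def eta'_def)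
    also have "\<dots> = on_slit X" by (rule on_slit_eqI) (rule cov_gamma_eta[OF PF_D(1)[OF that]])
    finally show ?thesis by (simp add: PF_D(2)[OF that])
  qed
  show "rho' (bracket' (gamma' X) (gamma' Y)) = 0" if "X \<in> PF" "Y \<in> PF" for X Y
  proof -
    have "rho' (bracket' (gamma' X) (gamma' Y)) = on_slit (rho M (lie_bracket (slit M) (gamma M X) (gamma M Y)))"
      by (simp add: on_slit_rho on_slit_bracket vector_field_gamma PF_D that gamma'_def)
    also have "\<dots> = on_slit 0"
      by (rule on_slit_eqI) (simp add: rho_bracket_gamma_gamma PF_D that)
    finally show ?thesis by simp
  qed
  show "A = 0" if A: "A \<in> VF" "rho' A = 0" "nabla' A eta' = 0" for A
  proof -
    have "A u = 0" if u: "u \<in> TM0" for u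
    proof (rule horizontal_vertical_0[OF u])
      note t = N.vector_field_tangent[OF VF_D(1)[OF A(1)] u]
      have "on_slit (cov D A eta) = nabla' A eta'"
        using on_slit_cov[OF VF_D(1)[OF A(1)] pi_field_eta] by (simp add: VF_D(2)[OF A(1)] eta'_def)
      then have "on_slit (cov D A eta) u = 0" using A(3) by simp
      then show "A u \<in> horizontal M D u" using t u by (simp add: horizontal_def cov_def)
      show "differential M fst u (A u) = 0"
        using fun_cong[OF A(2), of u] u by (simp add: rho'_def rho_def)
    qed
    then have "on_slit A = on_slit 0" by (intro on_slit_eqI) simp
    then show ?thesis using VF_D(2)[OF A(1)] by simp
  qed
  show "metric' X Y = metric' Y X" if "X \<in> PF" "Y \<in> PF" for X Y
    unfolding metric'_def
    by (intro on_slit_eqI) (simp add: finsler_metric_def fibre_hessian_sym[where v="X _"] pi_tangent PF_D that)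
  show "metric' (X + Y) Z = metric' X Z + metric' Y Z" if "X \<in> PF" "Y \<in> PF" "Z \<in> PF" for X Y Z
    unfolding metric'_def on_slit_add[symmetric]
    by (intro on_slit_eqI) (simp add: finsler_metric_add PF_D that)
  show "X = 0" if X: "X \<in> PF" "metric' X X = 0" for X
  proof -
    have "on_slit X = on_slit 0"
    proof (rule on_slit_eqI)
      fix u assume u: "u \<in> TM0"
      show "X u = 0 u"
        using finsler_metric_definite[OF PF_D(1)[OF X(1)] u] fun_cong[OF X(2), of u] u by (simp add: metric'_def)
    qed
    then show ?thesis using PF_D(2)[OF X(1)] by simp
  qed
  show "act' A (f + h) = act' A f + act' A h" if "A \<in> VF" "f \<in> FF" "h \<in> FF" for A f h
    unfolding act'_def on_slit_add[symmetric]
  proof (rule on_slit_eqI)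
    fix u assume u: "u \<in> TM0"
    then show "A u (f + h) = ((\<lambda>u. A u f) + (\<lambda>u. A u h)) u"
      using N.tangent_apply_add[OF u N.vector_field_tangent[OF VF_D(1)[OF that(1)] u], of f h] that
      by (simp add: FF_def plus_fun_def)
  qed
  show "act' (bracket' A B) f = act' A (act' B f) - act' B (act' A f)" if A: "A \<in> VF" and B: "B \<in> VF" and f: "f \<in> FF" for A B f
    unfolding act'_def on_slit_diff[symmetric]
  proof (rule on_slit_eqI)
    fix u assume u: "u \<in> TM0"
    \<comment> \<open>The cut-off does not alter the germ of \<open>h\<close> at a point of the slit
      bundle.\<close>
    have *: "A u (on_slit h) = A u h" if "A \<in> VF" for A and h :: "'a tpoint \<Rightarrow> real"
      by (rule N.tangent_apply_cong[OF u N.vector_field_tangent[OF VF_D(1)[OF that] u]])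
         (use N.eventually_carrier[of u] in eventually_elim, simp)
    show "bracket' A B u f = ((\<lambda>u. A u (on_slit (\<lambda>u. B u f))) - (\<lambda>u. B u (on_slit (\<lambda>u. A u f)))) u"
      using u f by (simp add: *[OF A] *[OF B] bracket'_def lie_bracket_def FF_def)
  qed
  show "act' A (metric' X Y) = metric' (nabla' A X) Y + metric' X (nabla' A Y)" if A: "A \<in> VF" and X: "X \<in> PF" and Y: "Y \<in> PF" for A X Y
    unfolding act'_def metric'_def on_slit_add[symmetric]
  proof (rule on_slit_eqI)
    fix u assume u: "u \<in> TM0"
    have "A u (on_slit (finsler_metric L X Y)) = A u (finsler_metric L X Y)"
      by (rule N.tangent_apply_cong[OF u N.vector_field_tangent[OF VF_D(1)[OF A] u]])
         (use N.eventually_carrier[of u] in eventually_elim, simp)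
    then show "A u (on_slit (finsler_metric L X Y)) = (finsler_metric L (nabla' A X) Y + finsler_metric L X (nabla' A Y)) u"
      using metric_compatible[OF VF_D(1)[OF A] PF_D(1)[OF X] PF_D(1)[OF Y] u] u
      by (simp add: finsler_metric_def nabla'_def)
  qed
  have T: "nabla' (gamma' X) Y - rho' (bracket' (gamma' X) (beta' Y)) = on_slit (T_torsion M D X Y)"
    if "X \<in> PF" "Y \<in> PF" for X Y
    using on_slit_T_torsion[OF PF_D(1)[OF that(1)] PF_D(1)[OF that(2)]] that by (simp add: PF_D)
  show "metric' (nabla' (gamma' X) Y - rho' (bracket' (gamma' X) (beta' Y))) Z = metric' (nabla' (gamma' X) Z - rho' (bracket' (gamma' X) (beta' Z))) Y"
    if "X \<in> PF" "Y \<in> PF" "Z \<in> PF" for X Y Z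
  proof -
    have "on_slit (finsler_metric L (T_torsion M D X Y) Z) = on_slit (finsler_metric L (T_torsion M D X Z) Y)"
      by (rule on_slit_eqI) (simp add: T_torsion_adjoint[of X Y Z] PF_D that)
    then show ?thesis by (simp add: T that on_slit_metric PF_D)
  qed
  show "nabla' (gamma' X) Y - rho' (bracket' (gamma' X) (beta' Y)) = nabla' (gamma' Y) X - rho' (bracket' (gamma' Y) (beta' X))"
    if "X \<in> PF" "Y \<in> PF" for X Y
    unfolding T[OF that] T[OF that(2,1)] by (rule on_slit_eqI) (simp add: T_torsion_sym[of X Y] PF_D that)
  show "nabla' (gamma' X) eta' = rho' (bracket' (gamma' X) (beta' eta'))" if X: "X \<in> PF" for X
  proof -
    have e: "eta' \<in> PF" unfolding eta'_def by (intro PF_on_slit pi_field_eta)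
    \<comment> \<open>The locale uses the cut-off field \<open>eta'\<close>, while
      \<open>T_torsion_eta\<close> is about \<open>eta\<close>; the bracket and the derivative see
      no difference on the slit bundle.\<close>
    have "on_slit (T_torsion M D X eta') = on_slit (T_torsion M D X eta)"
    proof (rule on_slit_eqI)
      fix u assume u: "u \<in> TM0"
      have "beta M D eta' w = beta M D eta w" if "w \<in> TM0" for w
        using that by (simp add: beta_def eta'_def)
      then have "lie_bracket (slit M) (gamma M X) (beta M D eta') u = lie_bracket (slit M) (gamma M X) (beta M D eta) u"
        using vector_field_gamma[OF PF_D(1)[OF X]] vector_field_beta[OF PF_D(1)[OF e]] u by (intro N.lie_bracket_cong) auto
      moreover have "cov D (gamma M X) eta' u = cov D (gamma M X) eta u"
        unfolding cov_def
        by (rule D_cong[OF u N.vector_field_tangent[OF vector_field_gamma[OF PF_D(1)[OF X]] u] PF_D(1)[OF e] pi_field_eta])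
           (simp add: eta'_def)
      ultimately show "T_torsion M D X eta' u = T_torsion M D X eta u"
        unfolding T_torsion_eq[OF PF_D(1)[OF X] PF_D(1)[OF e] u] T_torsion_eq[OF PF_D(1)[OF X] pi_field_eta u] rho_def by simp
    qed
    also have "\<dots> = on_slit 0" by (rule on_slit_eqI) (simp add: T_torsion_eta PF_D X)
    finally show ?thesis using T[OF X e] by simp
  qed
qed

section \<open>Transfer of the algebraic identities to the Cartan connection\<close>

context cartan_bundle
begin

lemma on_slit_T: "pfield X \<Longrightarrow> pfield Y \<Longrightarrow>
    on_slit (T_torsion M D X Y) = alg.T (on_slit X) (on_slit Y)"
  by (simp add: on_slit_T_torsion alg.T_def)

lemma pi_field_curvature:
  assumes "vfield A" "vfield B" "pfield X"
  shows "pfield (curvature M D A B X)"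
  unfolding curvature_def
  by (intro pi_field_add pi_field_uminus pi_field_cov N.vector_field_lie_bracket assms)

lemma on_slit_curvature:
  "\<lbrakk>vfield A; vfield B; pfield X\<rbrakk> \<Longrightarrow>
      on_slit (curvature M D A B X) = alg.K (on_slit A) (on_slit B) (on_slit X)"
  by (simp add: curvature_def alg.K_def on_slit_add on_slit_uminus on_slit_diff on_slit_cov on_slit_bracket
      pi_field_cov N.vector_field_lie_bracket)

lemma pi_field_S: "\<lbrakk>pfield X; pfield Y; pfield Z\<rbrakk> \<Longrightarrow>
      pfield (S_curv M D X Y Z)"
  by (simp add: S_curv_def pi_field_curvature vector_field_gamma)

lemma pi_field_P: "\<lbrakk>pfield X; pfield Y; pfield Z\<rbrakk> \<Longrightarrow>
      pfield (P_curv M D X Y Z)"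
  by (simp add: P_curv_def pi_field_curvature vector_field_gamma vector_field_beta)

lemma on_slit_S: "\<lbrakk>pfield X; pfield Y; pfield Z\<rbrakk> \<Longrightarrow>
      on_slit (S_curv M D X Y Z) = alg.S (on_slit X) (on_slit Y) (on_slit Z)"
  by (simp add: S_curv_def alg.S_def on_slit_curvature vector_field_gamma on_slit_gamma)

lemma on_slit_P: "\<lbrakk>pfield X; pfield Y; pfield Z\<rbrakk> \<Longrightarrow>
      on_slit (P_curv M D X Y Z) = alg.P (on_slit X) (on_slit Y) (on_slit Z)"
  by (simp add: P_curv_def alg.P_def on_slit_curvature vector_field_gamma vector_field_beta on_slit_gamma on_slit_beta)

lemma on_slit_cov_S:
  "\<lbrakk>vfield A; pfield X; pfield Y; pfield Z\<rbrakk> \<Longrightarrow>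
      on_slit (cov_curv D A (S_curv M D) X Y Z) = alg.nabS (on_slit A) (on_slit X) (on_slit Y) (on_slit Z)"
  by (simp add: cov_curv_def alg.nabS_def on_slit_diff on_slit_cov on_slit_S pi_field_S pi_field_cov)

lemma on_slit_cov_P:
  "\<lbrakk>vfield A; pfield X; pfield Y; pfield Z\<rbrakk> \<Longrightarrow>
      on_slit (cov_curv D A (P_curv M D) X Y Z) = alg.nabP (on_slit A) (on_slit X) (on_slit Y) (on_slit Z)"
  by (simp add: cov_curv_def alg.nabP_def on_slit_diff on_slit_cov on_slit_P pi_field_P pi_field_cov)

lemma on_slit_S4:
  "\<lbrakk>pfield X; pfield Y; pfield Z; pfield W\<rbrakk> \<Longrightarrow>
      on_slit (S4 M L D X Y Z W) = metric' (alg.S (on_slit X) (on_slit Y) (on_slit Z)) (on_slit W)"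
  by (simp add: S4_def on_slit_metric on_slit_S)

lemma on_slitD: "on_slit F = on_slit G \<Longrightarrow> u \<in> TM0 \<Longrightarrow> F u = G u"
  by (metis on_slit_at)

context
  fixes X Y Z W u
  assumes fields: "pfield X" "pfield Y" "pfield Z" "pfield W"
    and u: "u \<in> TM0"
begin

lemmas fields_simps = fields pi_field_eta pi_field_S pi_field_P pi_field_T_torsion
  vector_field_gamma vector_field_beta
text \<open>Pushes the cut-off down to the individual fields, which turns an expression in geometric
  operators into one in the operators of \<open>cartan_algebra\<close>.\<close>

lemmas to_alg = on_slit_add on_slit_uminus on_slit_diff on_slit_S on_slit_P on_slit_T on_slit_S4 on_slit_metric
  on_slit_cov_S on_slit_cov_P on_slit_gamma on_slit_beta

lemma S4_anti: "S4 M L D X Y Z W u = - S4 M L D Y X Z W u"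
proof -
  have "on_slit (S4 M L D X Y Z W) = on_slit (- S4 M L D Y X Z W)"
    using alg.S_anti[of "on_slit X" "on_slit Y" "on_slit Z"] by (simp add: to_alg fields_simps alg.g_uminus)
  from on_slitD[OF this u] show ?thesis by simp
qed

lemma S4_skew: "S4 M L D X Y Z W u = - S4 M L D X Y W Z u"
proof -
  have "on_slit (S4 M L D X Y Z W) = on_slit (- S4 M L D X Y W Z)"
    by (simp add: to_alg fields_simps alg.S_skew[of _ _ "on_slit Z"])
  from on_slitD[OF this u] show ?thesis by simp
qed

lemma S_curv_torsion: "S_curv M D X Y Z u =
    T_torsion M D X (T_torsion M D Y Z) u - T_torsion M D Y (T_torsion M D X Z) u"
proof -
  have "on_slit (S_curv M D X Y Z) = on_slit (T_torsion M D X (T_torsion M D Y Z) - T_torsion M D Y (T_torsion M D X Z))"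
    by (simp add: to_alg fields_simps alg.S_eq)
  from on_slitD[OF this u] show ?thesis by simp
qed

lemma S4_torsion: "S4 M L D X Y Z W u = finsler_metric L (T_torsion M D X W) (T_torsion M D Y Z) u
    - finsler_metric L (T_torsion M D Y W) (T_torsion M D X Z) u"
proof -
  have "on_slit (S4 M L D X Y Z W) = on_slit (finsler_metric L (T_torsion M D X W) (T_torsion M D Y Z)
    - finsler_metric L (T_torsion M D Y W) (T_torsion M D X Z))"
    by (simp add: to_alg fields_simps alg.g_S)
  from on_slitD[OF this u] show ?thesis by simp
qed

lemma S4_pair: "S4 M L D Z W X Y u = S4 M L D X Y Z W u"
proof -
  have "on_slit (S4 M L D Z W X Y) = on_slit (S4 M L D X Y Z W)"
    by (simp add: to_alg fields_simps alg.S_pair[of "on_slit X"])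
  from on_slitD[OF this u] show ?thesis .
qed

lemma S_curv_eta: "S_curv M D X eta Y u = 0" "S_curv M D eta X Y u = 0" "S_hat M D X Y u = 0"
proof -
  have "on_slit (S_curv M D X eta Y) = on_slit 0" "on_slit (S_curv M D eta X Y) = on_slit 0" "on_slit (S_hat M D X Y) = on_slit 0"
    \<comment> \<open>Folding \<open>on_slit eta\<close> back into \<open>eta'\<close> makes the
      simplification rules for the abstract \<open>eta\<close> applicable.\<close>
    by (simp_all add: S_hat_def to_alg fields_simps flip: eta'_def)
  from this[THEN on_slitD, OF u] show "S_curv M D X eta Y u = 0" "S_curv M D eta X Y u = 0" "S_hat M D X Y u = 0"
    by simp_all
qed

lemma cov_S_cyclic:
  "cyclic_sum (\<lambda>X Y Z. cov_curv D (gamma M X) (S_curv M D) Y Z W) X Y Z u = 0"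
proof -
  have "on_slit (cyclic_sum (\<lambda>X Y Z. cov_curv D (gamma M X) (S_curv M D) Y Z W) X Y Z) = on_slit 0"
    using alg.nabS_cyclic[of "on_slit X" "on_slit Y" "on_slit Z" "on_slit W"]
    by (simp add: cyclic_sum_def to_alg fields_simps)
  from on_slitD[OF this u] show ?thesis by simp
qed

lemma S_curv_cyclic: "cyclic_sum (\<lambda>X Y Z. S_curv M D X Y Z) X Y Z u = 0"
proof -
  have "on_slit (cyclic_sum (\<lambda>X Y Z. S_curv M D X Y Z) X Y Z) = on_slit 0"
    using alg.S_cyclic[of "on_slit X" "on_slit Y" "on_slit Z"] by (simp add: cyclic_sum_def to_alg fields_simps)
  from on_slitD[OF this u] show ?thesis by simp
qed

lemma cov_gamma_eta_S:
  "cov_curv D (gamma M eta) (S_curv M D) X Y Z u = vscale (-2) (S_curv M D X Y Z u)"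
proof -
  \<comment> \<open>The algebraic result has the form \<open>- S - S\<close>; the scalar -2 appears
    only on evaluation at \<open>u\<close>.\<close>
  have "on_slit (cov_curv D (gamma M eta) (S_curv M D) X Y Z) = - on_slit (S_curv M D X Y Z) - on_slit (S_curv M D X Y Z)"
    using alg.nabS_gam_eta[of "on_slit X" "on_slit Y" "on_slit Z"] by (simp add: to_alg fields_simps flip: eta'_def)
  from fun_cong[OF this, of u] u show ?thesis by (simp add: vscale_def fun_eq_iff)
qed

lemma cov_beta_S:
  "cov_curv D (beta M D Z) (S_curv M D) X Y W u =
     cov_curv D (gamma M X) (P_curv M D) Z Y W u
     - cov_curv D (gamma M Y) (P_curv M D) Z X W u
     - S_curv M D (P_hat M D Z Y) X W u
     + S_curv M D (P_hat M D Z X) Y W u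
     - P_curv M D (T_torsion M D Y Z) X W u
     + P_curv M D (T_torsion M D X Z) Y W u"
proof -
  have "on_slit (cov_curv D (beta M D Z) (S_curv M D) X Y W) = on_slit (
     cov_curv D (gamma M X) (P_curv M D) Z Y W
     - cov_curv D (gamma M Y) (P_curv M D) Z X W
     - S_curv M D (P_hat M D Z Y) X W
     + S_curv M D (P_hat M D Z X) Y W
     - P_curv M D (T_torsion M D Y Z) X W
     + P_curv M D (T_torsion M D X Z) Y W)"
    using alg.nabS_bet[of "on_slit X" "on_slit Y" "on_slit Z" "on_slit W"]
    by (simp add: P_hat_def to_alg fields_simps flip: eta'_def)
  from on_slitD[OF this u] show ?thesis by simp
qed

end

end

theorem theorem3p4:
  fixes M :: "('a, 'e::euclidean_space) atlas"
    and L :: "'a tpoint \<Rightarrow> real"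
    and D :: "'a conn"
    and X Y Z W :: "'a pi_field"
    and u :: "'a tpoint"
  assumes "finsler_manifold M L"
    and "cartan_connection M L D"
    and "pi_vector_field M X" "pi_vector_field M Y" "pi_vector_field M Z" "pi_vector_field M W"
    and "u \<in> carrier (slit M)"
  shows "(S4 M L D X Y Z W u = - S4 M L D Y X Z W u) \<and>
     (S4 M L D X Y Z W u = - S4 M L D X Y W Z u) \<and>
     (S_curv M D X Y Z u =
             T_torsion M D X (T_torsion M D Y Z) u - T_torsion M D Y (T_torsion M D X Z) u) \<and>
     (S4 M L D X Y Z W u =
             finsler_metric L (T_torsion M D X W) (T_torsion M D Y Z) u
             - finsler_metric L (T_torsion M D Y W) (T_torsion M D X Z) u) \<and>
     (S4 M L D Z W X Y u = S4 M L D X Y Z W u) \<and>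
     (S_curv M D X eta Y u = 0 \<and> S_curv M D eta X Y u = 0 \<and> S_hat M D X Y u = 0) \<and>
     (cyclic_sum (\<lambda>X Y Z. cov_curv D (gamma M X) (S_curv M D) Y Z W) X Y Z u = 0) \<and>
     (cyclic_sum (\<lambda>X Y Z. S_curv M D X Y Z) X Y Z u = 0) \<and>
     (cov_curv D (gamma M eta) (S_curv M D) X Y Z u = vscale (-2) (S_curv M D X Y Z u)) \<and>
     (cov_curv D (beta M D Z) (S_curv M D) X Y W u =
             cov_curv D (gamma M X) (P_curv M D) Z Y W u
             - cov_curv D (gamma M Y) (P_curv M D) Z X W u
             - S_curv M D (P_hat M D Z Y) X W u
             + S_curv M D (P_hat M D Z X) Y W u
             - P_curv M D (T_torsion M D Y Z) X W u
             + P_curv M D (T_torsion M D X Z) Y W u)"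
proof -
  have M: "smooth_manifold M" using assms(1) by (simp add: finsler_manifold_def)
  interpret cartan_bundle M D L
  proof
    fix U \<phi> V \<psi> assume "(U, \<phi>) \<in> M"
    then show "inj_on \<phi> U" "open (\<phi> ` U)" using M by (auto simp: smooth_manifold_def)
    assume "(V, \<psi>) \<in> M"
    with \<open>(U, \<phi>) \<in> M\<close> show "open (\<phi> ` (U \<inter> V))" "smooth_on (\<phi> ` (U \<inter> V)) (\<lambda>x. \<psi> (inv_into U \<phi> x))"
      using M by (auto simp: smooth_manifold_def o_def)
  next
    show "Hausdorff_space (mtop M)" using M by (simp add: smooth_manifold_def)
    show "regular_connection M D" using assms(2) by (simp add: cartan_connection_def)
  qed (fact assms)+
  note f = assms(3-7)
  show ?thesis
    by (intro conjI S4_anti[OF f] S4_skew[OF f] S_curv_torsion[OF f] S4_torsion[OF f] S4_pair[OF f]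
        S_curv_eta[OF f] cov_S_cyclic[OF f] S_curv_cyclic[OF f] cov_gamma_eta_S[OF f] cov_beta_S[OF f])
qed

end
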